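(* Let $T_1<T_2$ and let $\psi=\psi(x,t)$ be a bounded energy solution of the Schrödinger equation $i\psi_t=-\frac12\Delta\psi+V(x)\psi$, $x\in\mathbb{R}^d$. Let $\varrho=|\psi|^2$, $J=\mathrm{Im}(\bar\psi\nabla\psi)$, and suppose that $\varrho(\cdot,T_1)$ and $\varrho(\cdot,T_2)$ are continuous on $\mathbb{R}^d$ and that all connected components of $\{x\in\mathbb{R}^d:\varrho(x,T_1)\neq0\}$ and of $\{x\in\mathbb{R}^d:\varrho(x,T_2)\neq0\}$ are Caccioppoli sets (sets of locally finite perimeter). Let $N_{T_j}$ be the number of connected components of $\{x\in\mathbb{R}^d:\varrho(x,T_j)\neq0\}$, $j=1,2$. If $N_{T_1}\neq N_{T_2}$, then the QHD-trajectory $\{(\varrho,J)(t):t\in[T_1,T_2]\}$ is not trajectory-unique.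
   Context: Standing assumption: the real potential $V$ is in $C^{1,1}_{loc}(\mathbb{R}^d)$ and bounded from below, and such that $H:=-\frac12\Delta+V$ is essentially self-adjoint on $L^2(\mathbb{R}^d)$. A bounded energy solution of the Schrödinger equation is $\psi\in C(\mathbb{R}_t;L^2(\mathbb{R}^d_x))$ given by the unitary evolution generated by (the closure of) $H$ from a datum in $L^2(\mathbb{R}^d)$ whose energy $\frac12\int|\nabla\psi|^2dx+\int V|\psi|^2dx$ is finite (it is then constant in time, so that $\psi\in L^\infty(\mathbb{R}_t;H^1(\mathbb{R}^d_x))$). The QHD system is $$\varrho_t+\mathrm{div}J=0,\qquad J_t+\mathrm{div}\Big[\frac{J\otimes J}{\varrho}\Big]+\varrho\nabla V-\frac12\varrho\nabla\Big(\frac{\Delta\sqrt\varrho}{\sqrt\varrho}\Big)=0,$$ in the sense of distributions. Its solutions considered here are Schrödinger-generated: a solution-curve (QHD-trajectory) is a curve $t\mapsto(\varrho(t),J(t))$, continuous in time with values in $L^1(\mathbb{R}^d)\times\mathcal{D}'(\mathbb{R}^d)^d$ and with $J\in L^\infty_t(L^1_x)^d$, of the form $\varrho=|\psi|^2$, $J=\mathrm{Im}(\bar\psi\nabla\psi)$ with $\psi$ a bounded energy solution of the Schrödinger equation (such a pair is known to satisfy the QHD system in the sense of distributions). A solution-curve on a time interval $\mathcal{I}$ (here $\mathcal{I}=[T_1,T_2]$) is called trajectory-unique if for every other such solution-curve $\{(\sigma(t),I(t)):t\in\mathcal{I}\}$ one has either $(\varrho,J)(t)\neq(\sigma,I)(t)$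 for all $t\in\mathcal{I}$, or $(\varrho,J)(t)=(\sigma,I)(t)$ for all $t\in\mathcal{I}$. *)

theory Defs
  imports "HOL-Analysis.Analysis" "HOL-Library.Extended_Nat"
begin

section \<open>Smooth functions, test functions, distributional gradient\<close>

definition partial_deriv ::
  "'d::finite \<Rightarrow> (real^'d \<Rightarrow> 'b::real_normed_vector) \<Rightarrow> real^'d \<Rightarrow> 'b" where
  "partial_deriv i f x = frechet_derivative f (at x) (axis i 1)"

primrec Ck :: "nat \<Rightarrow> (real^'d::finite \<Rightarrow> 'b::real_normed_vector) \<Rightarrow> bool" where
  "Ck 0 f = continuous_on UNIV f"
| "Ck (Suc k) f = ((\<forall>x. f differentiable at x) \<and> (\<forall>i. Ck k (partial_deriv i f)))"

abbreviation supp :: "(real^'d::finite \<Rightarrow> 'b::real_normed_vector) \<Rightarrow> (real^'d) set" where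
  "supp f \<equiv> closure {x. f x \<noteq> 0}"

definition test_functions :: "(real^'d::finite \<Rightarrow> 'b::real_normed_vector) set" where
  "test_functions = {\<phi>. (\<forall>k. Ck k \<phi>) \<and> compact (supp \<phi>)}"

definition laplacian :: "(real^'d::finite \<Rightarrow> 'b::real_normed_vector) \<Rightarrow> real^'d \<Rightarrow> 'b" where
  "laplacian f x = (\<Sum>i\<in>UNIV. partial_deriv i (partial_deriv i f) x)"

definition divergence :: "(real^'d::finite \<Rightarrow> real^'d) \<Rightarrow> real^'d \<Rightarrow> real" where
  "divergence X x = (\<Sum>i\<in>UNIV. partial_deriv i X x $ i)"

definition C11_loc :: "(real^'d::finite \<Rightarrow> real) \<Rightarrow> bool" where
  "C11_loc V \<longleftrightarrow> (\<exists>G. (\<forall>x. GDERIV V x :> G x) \<and> (\<forall>K. compact K \<longrightarrow> (\<exists>L. L-lipschitz_on K G)))"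

definition L1_loc :: "(real^'d::finite \<Rightarrow> 'b::euclidean_space) \<Rightarrow> bool" where
  "L1_loc f \<longleftrightarrow> (\<forall>K. compact K \<longrightarrow> set_integrable lebesgue K f)"

definition weak_gradient ::
  "(real^'d::finite \<Rightarrow> complex) \<Rightarrow> (real^'d \<Rightarrow> complex^'d) \<Rightarrow> bool" where
  "weak_gradient u g \<longleftrightarrow> L1_loc u \<and> L1_loc g \<and>
     (\<forall>\<phi>\<in>test_functions. \<forall>i.
        (LINT x|lebesgue. (partial_deriv i \<phi> x :: real) *\<^sub>R u x)
          = - (LINT x|lebesgue. \<phi> x *\<^sub>R (g x $ i)))"


section \<open>The Hilbert space of square integrable functions and its operators\<close>

text \<open>Elements of the Hilbert space are represented by functions; everything below is
  insensitive to changes on Lebesgue null sets.  Operators are represented by their graphs.\<close>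

definition L2 :: "(real^'d::finite \<Rightarrow> complex) set" where
  "L2 = {f. f \<in> borel_measurable lebesgue \<and> integrable lebesgue (\<lambda>x. (cmod (f x))\<^sup>2)}"

definition L2_inner :: "(real^'d::finite \<Rightarrow> complex) \<Rightarrow> (real^'d \<Rightarrow> complex) \<Rightarrow> complex" where
  "L2_inner f g = (LINT x|lebesgue. cnj (f x) * g x)"

definition L2_norm :: "(real^'d::finite \<Rightarrow> complex) \<Rightarrow> real" where
  "L2_norm f = sqrt (LINT x|lebesgue. (cmod (f x))\<^sup>2)"

type_synonym 'd operator_graph = "((real^'d \<Rightarrow> complex) \<times> (real^'d \<Rightarrow> complex)) set"

definition graph_closure :: "'d::finite operator_graph \<Rightarrow> 'd operator_graph" where
  "graph_closure A = {(f, g). f \<in> L2 \<and> g \<in> L2 \<and>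
     (\<exists>u v. (\<forall>n::nat. (u n, v n) \<in> A) \<and>
        (\<lambda>n. L2_norm (\<lambda>x. u n x - f x)) \<longlonglongrightarrow> 0 \<and>
        (\<lambda>n. L2_norm (\<lambda>x. v n x - g x)) \<longlonglongrightarrow> 0)}"

definition graph_adjoint :: "'d::finite operator_graph \<Rightarrow> 'd operator_graph" where
  "graph_adjoint A = {(f, g). f \<in> L2 \<and> g \<in> L2 \<and>
     (\<forall>(u, v)\<in>A. L2_inner f v = L2_inner g u)}"

definition densely_defined :: "'d::finite operator_graph \<Rightarrow> bool" where
  "densely_defined A \<longleftrightarrow> (\<forall>f\<in>L2. \<forall>\<epsilon>>0. \<exists>(u, v)\<in>A. L2_norm (\<lambda>x. f x - u x) < \<epsilon>)"

definition self_adjoint :: "'d::finite operator_graph \<Rightarrow> bool" where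
  "self_adjoint A \<longleftrightarrow> densely_defined A \<and> graph_adjoint A = A"

definition essentially_self_adjoint :: "'d::finite operator_graph \<Rightarrow> bool" where
  "essentially_self_adjoint A \<longleftrightarrow> self_adjoint (graph_closure A)"

text \<open>The operator \<open>H = - 1/2 \<Delta> + V\<close>, with the smooth compactly supported functions as
  its domain.\<close>

definition hamiltonian :: "(real^'d::finite \<Rightarrow> real) \<Rightarrow> 'd operator_graph" where
  "hamiltonian V =
     {(u, \<lambda>x. - (1/2) * laplacian u x + complex_of_real (V x) * u x) | u. u \<in> test_functions}"


section \<open>Bounded energy solutions of the Schroedinger equation\<close>

text \<open>Strongly continuous one-parameter groups of unitary operators; linear isometries forming
  a group are surjective, hence unitary, and a linear isometry respects equality almost
  everywhere.\<close>

definition unitary_group ::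
  "(real \<Rightarrow> (real^'d::finite \<Rightarrow> complex) \<Rightarrow> real^'d \<Rightarrow> complex) \<Rightarrow> bool" where
  "unitary_group U \<longleftrightarrow>
     (\<forall>t. \<forall>f\<in>L2. U t f \<in> L2 \<and> L2_norm (U t f) = L2_norm f) \<and>
     (\<forall>t a b. \<forall>f\<in>L2. \<forall>g\<in>L2. AE x in lebesgue.
        U t (\<lambda>y. a * f y + b * g y) x = a * U t f x + b * U t g x) \<and>
     (\<forall>f\<in>L2. AE x in lebesgue. U 0 f x = f x) \<and>
     (\<forall>s t. \<forall>f\<in>L2. AE x in lebesgue. U (s + t) f x = U s (U t f) x) \<and>
     (\<forall>f\<in>L2. \<forall>s. ((\<lambda>t. L2_norm (\<lambda>x. U t f x - U s f x)) \<longlongrightarrow> 0) (at s))"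

text \<open>The self-adjoint \<open>A\<close> with \<open>U t = exp (- \<i> t A)\<close>: by Stone's theorem \<open>f\<close> is in the domain
  of \<open>A\<close> iff \<open>\<i> (U t f - f) / t\<close> converges as \<open>t \<rightarrow> 0\<close>, and then the limit is \<open>A f\<close>.\<close>

definition group_generator ::
  "(real \<Rightarrow> (real^'d::finite \<Rightarrow> complex) \<Rightarrow> real^'d \<Rightarrow> complex) \<Rightarrow> 'd operator_graph" where
  "group_generator U = {(f, g). f \<in> L2 \<and> g \<in> L2 \<and>
     ((\<lambda>t. L2_norm (\<lambda>x. \<i> / complex_of_real t * (U t f x - f x) - g x)) \<longlongrightarrow> 0) (at 0)}"

text \<open>Finiteness of \<open>1/2 \<integral> |\<nabla>u|\<^sup>2 + \<integral> V |u|\<^sup>2\<close>, meant for \<open>V\<close> bounded from below.\<close>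

definition finite_energy :: "(real^'d::finite \<Rightarrow> real) \<Rightarrow> (real^'d \<Rightarrow> complex) \<Rightarrow> bool" where
  "finite_energy V u \<longleftrightarrow> u \<in> L2 \<and>
     (\<exists>g. weak_gradient u g \<and> integrable lebesgue (\<lambda>x. (norm (g x))\<^sup>2)) \<and>
     integrable lebesgue (\<lambda>x. V x * (cmod (u x))\<^sup>2)"

definition bounded_energy_solution ::
  "(real^'d::finite \<Rightarrow> real) \<Rightarrow> (real \<Rightarrow> real^'d \<Rightarrow> complex) \<Rightarrow> bool" where
  "bounded_energy_solution V \<psi> \<longleftrightarrow>
     (\<exists>U. unitary_group U \<and> group_generator U = graph_closure (hamiltonian V) \<and>
        finite_energy V (\<psi> 0) \<and>
        (\<forall>t. \<psi> t \<in> L2 \<and> (AE x in lebesgue. \<psi> t x = U t (\<psi> 0) x)))"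


section \<open>QHD-trajectories and trajectory uniqueness\<close>

text \<open>\<open>\<rho> = |u|\<^sup>2\<close> and \<open>J = Im (cnj u \<nabla>u)\<close>.\<close>

definition hydrodynamic_state ::
  "(real^'d::finite \<Rightarrow> complex) \<Rightarrow> (real^'d \<Rightarrow> real) \<Rightarrow> (real^'d \<Rightarrow> real^'d) \<Rightarrow> bool" where
  "hydrodynamic_state u \<rho> J \<longleftrightarrow>
     (AE x in lebesgue. \<rho> x = (cmod (u x))\<^sup>2) \<and>
     (\<exists>g. weak_gradient u g \<and>
        (AE x in lebesgue. J x = (\<chi> i. Im (cnj (u x) * g x $ i))))"

text \<open>The current \<open>J t\<close> is a locally integrable function, identified with the distribution it
  defines.  The continuity clauses are continuity in the Lebesgue space of integrable functions
  for \<open>\<rho>\<close> and weak-star continuity in the space of distributions for \<open>J\<close>; the latter makes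
  \<open>J\<close> measurable in time, so that the last clause is essential boundedness in time with values
  in the integrable functions.\<close>

definition qhd_trajectory ::
  "(real^'d::finite \<Rightarrow> real) \<Rightarrow> real set \<Rightarrow> (real \<Rightarrow> real^'d \<Rightarrow> real) \<Rightarrow>
   (real \<Rightarrow> real^'d \<Rightarrow> real^'d) \<Rightarrow> bool" where
  "qhd_trajectory V I \<rho> J \<longleftrightarrow>
     (\<exists>\<psi>. bounded_energy_solution V \<psi> \<and> (\<forall>t\<in>I. hydrodynamic_state (\<psi> t) (\<rho> t) (J t))) \<and>
     (\<forall>t\<in>I. integrable lebesgue (\<rho> t)) \<and>
     (\<forall>s\<in>I. ((\<lambda>t. LINT x|lebesgue. \<bar>\<rho> t x - \<rho> s x\<bar>) \<longlongrightarrow> 0) (at s within I)) \<and>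
     (\<forall>t\<in>I. L1_loc (J t)) \<and>
     (\<forall>\<phi>\<in>test_functions. continuous_on I (\<lambda>t. LINT x|lebesgue. (\<phi> x :: real) *\<^sub>R J t x)) \<and>
     (\<exists>C. AE t in lebesgue. t \<in> I \<longrightarrow>
        integrable lebesgue (J t) \<and> (LINT x|lebesgue. norm (J t x)) \<le> C)"

definition same_state ::
  "(real^'d::finite \<Rightarrow> real) \<Rightarrow> (real^'d \<Rightarrow> real^'d) \<Rightarrow>
   (real^'d \<Rightarrow> real) \<Rightarrow> (real^'d \<Rightarrow> real^'d) \<Rightarrow> bool" where
  "same_state \<rho> J \<sigma> K \<longleftrightarrow> (AE x in lebesgue. \<rho> x = \<sigma> x) \<and> (AE x in lebesgue. J x = K x)"

definition trajectory_unique ::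
  "(real^'d::finite \<Rightarrow> real) \<Rightarrow> real set \<Rightarrow> (real \<Rightarrow> real^'d \<Rightarrow> real) \<Rightarrow>
   (real \<Rightarrow> real^'d \<Rightarrow> real^'d) \<Rightarrow> bool" where
  "trajectory_unique V I \<rho> J \<longleftrightarrow>
     (\<forall>\<sigma> K. qhd_trajectory V I \<sigma> K \<longrightarrow>
        (\<forall>t\<in>I. \<not> same_state (\<rho> t) (J t) (\<sigma> t) (K t)) \<or>
        (\<forall>t\<in>I. same_state (\<rho> t) (J t) (\<sigma> t) (K t)))"


section \<open>Caccioppoli sets and number of components\<close>

text \<open>De Giorgi's perimeter of \<open>E\<close> in the open set \<open>\<Omega>\<close>.\<close>

definition perimeter :: "(real^'d::finite) set \<Rightarrow> (real^'d) set \<Rightarrow> ereal" where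
  "perimeter E \<Omega> =
     (SUP X\<in>{X :: real^'d \<Rightarrow> real^'d.
               Ck 1 X \<and> compact (supp X) \<and> supp X \<subseteq> \<Omega> \<and> (\<forall>x. norm (X x) \<le> 1)}.
        ereal (LINT x:E|lebesgue. divergence X x))"

definition caccioppoli :: "(real^'d::finite) set \<Rightarrow> bool" where
  "caccioppoli E \<longleftrightarrow> E \<in> sets lebesgue \<and>
     (\<forall>\<Omega>. open \<Omega> \<and> bounded \<Omega> \<longrightarrow> perimeter E \<Omega> < \<infinity>)"

text \<open>An open set has at most countably many components, so there is only one infinite value.\<close>

definition num_components :: "(real^'d::finite) set \<Rightarrow> enat" where
  "num_components S = (if finite (components S) then enat (card (components S)) else \<infinity>)"

end

theory Submission
  imports Defs
begin

text \<open>
  On an open component of \<open>{\<rho> \<noteq> 0}\<close> the phase of the state may be changed by a constant without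
  affecting density or current, and conversely two states with the same density and current differ
  on each component of \<open>{\<rho> \<noteq> 0}\<close> by a constant factor.  If the trajectory were unique, changing the
  sign of \<open>\<psi>(T)\<close> on a component \<open>\<Omega>\<close> would not change the hydrodynamic state at time \<open>T'\<close>, so the
  unitary evolution would map each \<open>1\<^sub>\<Omega> \<psi>(T)\<close> into the span of the functions \<open>1\<^sub>\<Omega>' \<psi>(T')\<close>, where
  \<open>\<Omega>'\<close> ranges over the components at time \<open>T'\<close>.  As the evolution is linear and injective, there
  are at least as many components at time \<open>T'\<close> as at time \<open>T\<close>, and by symmetry equally many.

  The states obtained by sign changes must again have finite energy for all times.  This is the
  invariance of the form domain: \<open>u\<close> has finite energy iff \<open>\<phi> \<mapsto> \<langle>(H + c) \<phi>, u\<rangle>\<close> is bounded in the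
  energy norm on test functions, a condition that the evolution respects.  The proof of this
  characterisation also shows that states of finite energy are limits of test functions in the first
  Sobolev space, which gives the chain rule.
\<close>

section \<open>Smooth functions\<close>

text \<open>Two obstacles shape the proof. The first is that finite energy has to be carried through
  time although the evolution is known only through its generator, the closure of an operator on
  test functions. The energy is therefore replaced by the bound on a functional: U(-t) maps a test
  function into the domain of the closed operator without changing its quadratic form, so the bound
  for \<open>u\<close> becomes a bound for U(t) \<open>u\<close> with the same constant. Conversely,
  a bounded functional is represented by minimising a quadratic functional, as in the Dirichlet
  principle. The second obstacle is regularity: at the end times only the density has a continuous
  representative, while the state and its gradient are defined almost everywhere. Neither a
  pointwise phase nor a trace on the boundary of a component is at hand. Every nonlinear step is
  therefore a chain rule for a C1 function of a pair of states with bounded differential: truncation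
  of small values (\<open>trunc\<close>), comparison of densities (\<open>squash\<close>) and
  comparison of phases (\<open>quot\<close>).\<close>

lemma partial_deriv_eq: "(f has_derivative f') (at x) \<Longrightarrow> partial_deriv i f x = f' (axis i 1)"
  by (metis frechet_derivative_at partial_deriv_def)

lemma Ck_cong: "(\<And>x. f x = g x) \<Longrightarrow> Ck k f = Ck k g"
  by presburger

lemma Ck_Suc_D:
  assumes "Ck (Suc k) f"
  shows "f differentiable at x" "Ck k (partial_deriv i f)"
  using assms by auto

lemma Ck_imp_continuous: "Ck k f \<Longrightarrow> continuous_on UNIV f"
  by (cases k) (auto intro!: differentiable_imp_continuous_on simp: differentiable_on_def)

lemma Ck_Suc_imp: "Ck (Suc k) f \<Longrightarrow> Ck k f"
proof (induction k arbitrary: f)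
  case 0
  then show ?case using Ck_imp_continuous[OF 0] by simp
next
  case (Suc k)
  then show ?case by (metis Ck.simps(2))
qed

lemma partial_deriv_const: "partial_deriv i (\<lambda>x. c) = (\<lambda>x. 0)"
  by (rule ext, subst partial_deriv_eq[OF has_derivative_const]) simp

lemma Ck_const: "Ck k (\<lambda>x. c)"
  by (induction k arbitrary: c) (auto simp: partial_deriv_const)

lemma partial_deriv_bounded_linear_compose:
  assumes "bounded_linear T" "f differentiable at x"
  shows "partial_deriv i (\<lambda>x. T (f x)) x = T (partial_deriv i f x)"
proof -
  have "(f has_derivative frechet_derivative f (at x)) (at x)"
    using assms(2) frechet_derivative_works by blast
  from bounded_linear.has_derivative[OF assms(1) this]
  show ?thesis by (subst partial_deriv_eq) (auto simp: partial_deriv_def)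
qed

lemma Ck_bounded_linear_compose:
  assumes T: "bounded_linear T"
  shows "Ck k f \<Longrightarrow> Ck k (\<lambda>x. T (f x))"
proof (induction k arbitrary: f)
  case 0
  then show ?case using T by (auto intro: bounded_linear.continuous_on)
next
  case (Suc k)
  have d: "f differentiable at x" for x using Suc.prems by simp
  have "(\<lambda>x. T (f x)) differentiable at x" for x
    using d[of x] bounded_linear.has_derivative[OF T] unfolding differentiable_def by blast
  moreover have "partial_deriv i (\<lambda>x. T (f x)) = (\<lambda>x. T (partial_deriv i f x))" for i
    using partial_deriv_bounded_linear_compose[OF T d] by blast
  ultimately show ?case using Suc by simp
qed

lemma Ck_bounded_linear: "bounded_linear T \<Longrightarrow> Ck k T"
proof (cases k)
  case (Suc m)
  assume T: "bounded_linear T"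
  then have "(T has_derivative T) (at x)" for x by (rule bounded_linear_imp_has_derivative)
  then have "partial_deriv i T = (\<lambda>x. T (axis i 1))" "T differentiable at x" for i x
    using partial_deriv_eq differentiable_def by blast+
  then show ?thesis using Suc by (simp add: Ck_const)
qed (auto simp: linear_continuous_on)

lemma partial_deriv_add:
  assumes "f differentiable at x" "g differentiable at x"
  shows "partial_deriv i (\<lambda>x. f x + g x) x = partial_deriv i f x + partial_deriv i g x"
  using has_derivative_add[of f "frechet_derivative f (at x)" "at x" g "frechet_derivative g (at x)"] assms
  by (subst partial_deriv_eq) (auto simp: partial_deriv_def frechet_derivative_works)

lemma Ck_add: "Ck k f \<Longrightarrow> Ck k g \<Longrightarrow> Ck k (\<lambda>x. f x + g x)"
proof (induction k arbitrary: f g)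
  case (Suc k)
  then have d: "f differentiable at x" "g differentiable at x" for x by auto
  have "partial_deriv i (\<lambda>x. f x + g x) = (\<lambda>x. partial_deriv i f x + partial_deriv i g x)" for i
    using partial_deriv_add[OF d] by blast
  then show ?case using Suc d by (auto intro: differentiable_add)
qed (auto intro: continuous_intros)

lemma Ck_uminus: "Ck k f \<Longrightarrow> Ck k (\<lambda>x. - f x)"
  using Ck_bounded_linear_compose[OF bounded_linear_minus[OF bounded_linear_ident]] by auto

lemma Ck_diff: "Ck k f \<Longrightarrow> Ck k g \<Longrightarrow> Ck k (\<lambda>x. f x - g x)"
  using Ck_add[OF _ Ck_uminus, of k f g] by simp

lemma partial_deriv_bilinear:
  assumes B: "bounded_bilinear B" and "f differentiable at x" "g differentiable at x"
  shows "partial_deriv i (\<lambda>x. B (f x) (g x)) x = B (f x) (partial_deriv i g x) + B (partial_deriv i f x) (g x)"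
  using bounded_bilinear.FDERIV[OF B, of f "frechet_derivative f (at x)" x UNIV g "frechet_derivative g (at x)"] assms
  by (subst partial_deriv_eq) (auto simp: partial_deriv_def frechet_derivative_works)

lemma Ck_bilinear:
  assumes B: "bounded_bilinear B"
  shows "Ck k f \<Longrightarrow> Ck k g \<Longrightarrow> Ck k (\<lambda>x. B (f x) (g x))"
proof (induction k arbitrary: f g)
  case 0
  then show ?case using bounded_bilinear.continuous_on[OF B] by auto
next
  case (Suc k)
  then have d: "f differentiable at x" "g differentiable at x" for x by auto
  have "(\<lambda>x. B (f x) (g x)) differentiable at x" for x
    using bounded_bilinear.FDERIV[OF B] d[of x] unfolding differentiable_def by blast
  moreover have "partial_deriv i (\<lambda>x. B (f x) (g x))
      = (\<lambda>x. B (f x) (partial_deriv i g x) + B (partial_deriv i f x) (g x))" for i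
    using partial_deriv_bilinear[OF B d] by blast
  moreover have "Ck k (\<lambda>x. B (f x) (partial_deriv i g x) + B (partial_deriv i f x) (g x))" for i
    by (rule Ck_add; rule Suc.IH) (use Suc.prems Ck_Suc_imp in \<open>auto simp del: Ck.simps dest: Ck_Suc_D(2)\<close>)
  ultimately show ?case by simp
qed

lemmas Ck_mult = Ck_bilinear[OF bounded_bilinear_mult]
lemmas Ck_scaleR = Ck_bilinear[OF bounded_bilinear_scaleR]

lemma partial_deriv_translate:
  assumes "\<And>x. f differentiable at x"
  shows "partial_deriv i (\<lambda>x. f (x + a)) x = partial_deriv i f (x + a)"
proof -
  have "((\<lambda>x. x + a) has_derivative (\<lambda>x. x)) (at x)" by (auto intro!: derivative_eq_intros)
  moreover have "(f has_derivative frechet_derivative f (at (x + a))) (at (x + a))"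
    using assms frechet_derivative_works by blast
  ultimately have "((\<lambda>x. f (x + a)) has_derivative frechet_derivative f (at (x + a))) (at x)"
    using diff_chain_at[of "\<lambda>x. x + a" "\<lambda>x. x" x f] by (simp add: o_def)
  then show ?thesis by (subst partial_deriv_eq) (auto simp: partial_deriv_def)
qed

lemma Ck_translate: "Ck k f \<Longrightarrow> Ck k (\<lambda>x. f (x + a))"
proof (induction k arbitrary: f)
  case 0
  then have c: "continuous_on UNIV f" by simp
  have "continuous_on UNIV (\<lambda>x. f (x + a))"
    by (rule continuous_on_compose2[OF c]) (auto intro!: continuous_intros)
  then show ?case by simp
next
  case (Suc k)
  then have d: "f differentiable at x" for x by auto
  have "(\<lambda>x. f (x + a)) differentiable at x" for x
    using differentiable_chain_at[of "\<lambda>x. x + a" x f] d by (simp add: differentiable_add o_def)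
  then show ?case using Suc partial_deriv_translate[OF d] by (simp cong: Ck_cong)
qed

lemma differentiable_of_real_compose:
  fixes F :: "real \<Rightarrow> real"
  assumes "(F has_real_derivative F') (at (f x))" "f differentiable at x"
  shows "(\<lambda>x. F (f x)) differentiable at x"
    and "partial_deriv i (\<lambda>x. F (f x)) x = F' * partial_deriv i f x"
proof -
  have "(f has_derivative frechet_derivative f (at x)) (at x)"
    using assms(2) frechet_derivative_works by blast
  from diff_chain_at[OF this, of F "\<lambda>h. F' * h"] assms(1)
  have "((\<lambda>x. F (f x)) has_derivative (\<lambda>h. F' * frechet_derivative f (at x) h)) (at x)"
    by (simp add: o_def has_field_derivative_def)
  then show "(\<lambda>x. F (f x)) differentiable at x"
    and "partial_deriv i (\<lambda>x. F (f x)) x = F' * partial_deriv i f x"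
    by (auto simp: differentiable_def partial_deriv_def dest: partial_deriv_eq)
qed

text \<open>The classical flat function exp(-1/s) and its quotients by powers of s. The index
  \<open>k\<close> closes the family under differentiation: the derivative of member
  \<open>k\<close> combines members \<open>k + 2\<close> and \<open>k + 1\<close>, so that
  smoothness follows by induction.\<close>

definition flat_exp :: "nat \<Rightarrow> real \<Rightarrow> real" where
  "flat_exp k s = (if s > 0 then exp (- 1 / s) / s ^ k else 0)"

lemma flat_exp_tendsto_0: "(flat_exp k \<longlongrightarrow> 0) (at 0)"
proof -
  have r: "(flat_exp k \<longlongrightarrow> 0) (at_right 0)"
  proof -
    have "((\<lambda>s. inverse s ^ k / exp (inverse s)) \<longlongrightarrow> (0::real)) (at_right 0)"
      by (rule filterlim_compose[OF tendsto_power_div_exp_0 filterlim_inverse_at_top_right])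
    moreover have "\<forall>\<^sub>F s in at_right 0. inverse s ^ k / exp (inverse s) = flat_exp k s"
      by (auto simp: eventually_at_right_field flat_exp_def exp_minus field_simps intro!: exI[of _ 1])
    ultimately show ?thesis by (rule Lim_transform_eventually)
  qed
  have "\<forall>\<^sub>F s in at_left 0. 0 = flat_exp k s"
    by (auto simp: eventually_at_left_field flat_exp_def intro!: exI[of _ "-1"])
  then have l: "(flat_exp k \<longlongrightarrow> 0) (at_left 0)" by (rule Lim_transform_eventually[OF tendsto_const])
  show ?thesis using l r by (rule filterlim_split_at)
qed

lemma DERIV_flat_exp:
  "(flat_exp k has_real_derivative flat_exp (Suc (Suc k)) s - real k * flat_exp (Suc k) s) (at s)"
proof (cases "s = 0")
  case True
  \<comment> \<open>At the origin the difference quotient of one member is the next member, whose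
    limit is known to be 0.\<close>
  have "(\<lambda>h. (flat_exp k (0 + h) - flat_exp k 0) / h) = flat_exp (Suc k)"
    by (auto simp: flat_exp_def fun_eq_iff)
  then show ?thesis using True flat_exp_tendsto_0[of "Suc k"]
    by (simp add: DERIV_def) (simp add: flat_exp_def)
next
  case False
  show ?thesis
  proof (cases "s > 0")
    case True
    have "((\<lambda>s. exp (- 1 / s) / s ^ k) has_real_derivative
        flat_exp (Suc (Suc k)) s - real k * flat_exp (Suc k) s) (at s)"
      using True by (auto intro!: derivative_eq_intros simp: flat_exp_def field_simps power_add
        power2_eq_square simp flip: power_Suc) (cases k; simp add: field_simps)
    then show ?thesis
      by (rule has_field_derivative_transform_within_open[of _ _ _ "{0<..}"])
        (use True in \<open>auto simp: flat_exp_def\<close>)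
  next
    case False
    then have "s < 0" using \<open>s \<noteq> 0\<close> by simp
    have "((\<lambda>s. 0) has_real_derivative
        flat_exp (Suc (Suc k)) s - real k * flat_exp (Suc k) s) (at s)"
      using \<open>s < 0\<close> by (simp add: flat_exp_def)
    then show ?thesis
      by (rule has_field_derivative_transform_within_open[of _ _ _ "{..<0}"])
        (use \<open>s < 0\<close> in \<open>auto simp: flat_exp_def\<close>)
  qed
qed

lemma continuous_flat_exp: "continuous_on S f \<Longrightarrow> continuous_on S (\<lambda>x. flat_exp k (f x))"
proof -
  have "continuous_on UNIV (flat_exp k)"
    using DERIV_flat_exp by (meson DERIV_isCont continuous_at_imp_continuous_on)
  then show "continuous_on S f \<Longrightarrow> ?thesis" by (rule continuous_on_compose2) auto
qed

lemma Ck_flat_exp: "Ck n f \<Longrightarrow> Ck n (\<lambda>x. flat_exp k (f x))"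
proof (induction n arbitrary: k)
  case 0
  then show ?case by (simp add: continuous_flat_exp)
next
  case (Suc n)
  then have d: "f differentiable at x" for x by auto
  note c = differentiable_of_real_compose[where f=f, OF DERIV_flat_exp d]
  have "Ck n f" using Suc.prems by (rule Ck_Suc_imp)
  then have "Ck n (partial_deriv i (\<lambda>x. flat_exp k (f x)))" for i
    using Suc.prems by (subst Ck_cong[OF c(2)]) (intro Ck_mult Ck_diff Ck_const Suc.IH, auto)
  then show ?case using c(1) by simp
qed

lemma partial_deriv_zero_open:
  assumes "open S" "x \<in> S" "\<And>y. y \<in> S \<Longrightarrow> f y = 0"
  shows "partial_deriv i f x = 0"
proof -
  have "(f has_derivative (\<lambda>x. 0)) (at x)"
    by (rule has_derivative_transform_within_open[OF has_derivative_const assms(1,2)]) (simp add: assms(3))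
  then show ?thesis by (subst partial_deriv_eq) auto
qed

section \<open>Supports and the space of test functions\<close>

lemma in_supp: "f x \<noteq> 0 \<Longrightarrow> x \<in> supp f"
  by (rule subsetD[OF closure_subset]) simp

lemma partial_deriv_outside_supp: "x \<notin> supp f \<Longrightarrow> partial_deriv i f x = 0"
  by (rule partial_deriv_zero_open[of "- supp f"]) (auto simp: open_Compl dest: in_supp)

lemma supp_mono: "(\<And>x. f x = 0 \<Longrightarrow> g x = 0) \<Longrightarrow> supp g \<subseteq> supp f"
  by (rule closure_mono) auto

lemma supp_subset_closed: "closed C \<Longrightarrow> (\<And>x. x \<notin> C \<Longrightarrow> f x = 0) \<Longrightarrow> supp f \<subseteq> C"
  by (rule closure_minimal) auto

lemma supp_partial_deriv: "supp (partial_deriv i f) \<subseteq> supp f"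
  by (rule supp_subset_closed) (auto intro: partial_deriv_outside_supp)

lemma compact_supp: "compact K \<Longrightarrow> supp f \<subseteq> K \<Longrightarrow> compact (supp f)"
  using closed_Int_compact[of "supp f" K] by (simp add: inf_absorb1)

lemma test_functions_Ck: "\<phi> \<in> test_functions \<Longrightarrow> Ck k \<phi>"
  by (simp add: test_functions_def)

lemma test_functions_differentiable: "\<phi> \<in> test_functions \<Longrightarrow> \<phi> differentiable at x"
  using test_functions_Ck[of \<phi> "Suc 0"] by simp

lemma test_functions_compact: "\<phi> \<in> test_functions \<Longrightarrow> compact (supp \<phi>)"
  by (simp add: test_functions_def)

lemma test_functions_I:
  assumes "\<And>k. Ck k f" "\<phi> \<in> test_functions" "\<And>x. \<phi> x = 0 \<Longrightarrow> f x = 0"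
  shows "f \<in> test_functions"
  using assms supp_mono[of \<phi> f] compact_supp[of "supp \<phi>" f]
  by (auto simp: test_functions_def)

lemma test_functions_partial_deriv:
  assumes "\<phi> \<in> test_functions"
  shows "partial_deriv i \<phi> \<in> test_functions"
  using assms supp_partial_deriv[of i \<phi>] compact_supp[of "supp \<phi>" "partial_deriv i \<phi>"]
    Ck_Suc_D(2)[OF test_functions_Ck]
  by (auto simp: test_functions_def)

lemma test_functions_linear:
  assumes "bounded_linear T" "\<phi> \<in> test_functions"
  shows "(\<lambda>x. T (\<phi> x)) \<in> test_functions"
  by (rule test_functions_I[OF _ assms(2)])
    (auto intro: Ck_bounded_linear_compose[OF assms(1)] test_functions_Ck[OF assms(2)]
      simp: linear_0 bounded_linear.linear[OF assms(1)])

lemma test_functions_add: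
  assumes "\<phi> \<in> test_functions" "\<eta> \<in> test_functions"
  shows "(\<lambda>x. \<phi> x + \<eta> x) \<in> test_functions"
proof -
  have "supp (\<lambda>x. \<phi> x + \<eta> x) \<subseteq> closure ({x. \<phi> x \<noteq> 0} \<union> {x. \<eta> x \<noteq> 0})"
    by (rule closure_mono) auto
  then have "supp (\<lambda>x. \<phi> x + \<eta> x) \<subseteq> supp \<phi> \<union> supp \<eta>"
    by (simp only: closure_Un)
  then have "compact (supp (\<lambda>x. \<phi> x + \<eta> x))"
    by (rule compact_supp[rotated]) (intro compact_Un test_functions_compact assms)
  then show ?thesis
    unfolding test_functions_def using Ck_add[OF test_functions_Ck test_functions_Ck, OF assms] by simp
qed

lemma test_functions_zero: "(\<lambda>x. 0) \<in> test_functions"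
  by (auto simp: test_functions_def Ck_const)

lemma test_functions_bilinear_left:
  assumes B: "bounded_bilinear B" "\<phi> \<in> test_functions" "\<And>k. Ck k f"
  shows "(\<lambda>x. B (\<phi> x) (f x)) \<in> test_functions"
  by (rule test_functions_I[OF _ assms(2)])
    (auto intro: Ck_bilinear[OF B(1)] test_functions_Ck[OF assms(2)] assms(3)
      simp: bounded_bilinear.zero_left[OF B(1)])

lemma test_functions_translate:
  assumes "\<phi> \<in> test_functions"
  shows "(\<lambda>x. \<phi> (x + a)) \<in> test_functions"
proof -
  let ?K = "(\<lambda>x. x - a) ` supp \<phi>"
  have c: "compact ?K"
    by (intro compact_continuous_image test_functions_compact assms continuous_intros)
  have "supp (\<lambda>x. \<phi> (x + a)) \<subseteq> ?K"
  proof (rule supp_subset_closed)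
    fix x assume "x \<notin> ?K"
    then have "x + a \<notin> supp \<phi>" by (metis add_diff_cancel_right' image_eqI)
    then show "\<phi> (x + a) = 0" using in_supp by blast
  qed (use c compact_imp_closed in blast)
  then have "compact (supp (\<lambda>x. \<phi> (x + a)))"
    using compact_supp[OF c] by simp
  then show ?thesis using test_functions_Ck[OF assms] by (auto simp: test_functions_def intro: Ck_translate)
qed

text \<open>The squared distance is used because it is smooth also at the centre, unlike the
  distance itself.\<close>

definition bump :: "real^'d::finite \<Rightarrow> real \<Rightarrow> real^'d \<Rightarrow> real" where
  "bump a \<delta> x = flat_exp 0 (\<delta>\<^sup>2 - (x - a) \<bullet> (x - a))"

lemma bump_nonneg: "bump a \<delta> x \<ge> 0"
  by (simp add: bump_def flat_exp_def)

lemma bump_pos_iff: "\<delta> > 0 \<Longrightarrow> bump a \<delta> x > 0 \<longleftrightarrow> x \<in> ball a \<delta>"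
  using abs_le_square_iff[of \<delta> "norm (x - a)"]
  by (auto simp: not_le[symmetric] bump_def flat_exp_def dist_norm norm_minus_commute[of a] power2_norm_eq_inner[symmetric])

lemma bump_eq_0_iff: "\<delta> > 0 \<Longrightarrow> bump a \<delta> x = 0 \<longleftrightarrow> x \<notin> ball a \<delta>"
  using bump_pos_iff[of \<delta> a x] bump_nonneg[of a \<delta> x] by linarith

lemma Ck_bump: "Ck k (bump a \<delta>)"
proof -
  have i: "Ck k (\<lambda>x. x - a)" by (intro Ck_diff Ck_const Ck_bounded_linear bounded_linear_ident)
  show ?thesis unfolding bump_def
    by (intro Ck_flat_exp Ck_diff Ck_const Ck_bilinear[OF bounded_bilinear_inner] i)
qed

lemma supp_bump: "\<delta> > 0 \<Longrightarrow> supp (bump a \<delta>) \<subseteq> cball a \<delta>"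
  by (rule supp_subset_closed) (auto simp: bump_eq_0_iff)

lemma bump_test: "\<delta> > 0 \<Longrightarrow> bump a \<delta> \<in> test_functions"
  using supp_bump[of \<delta> a] by (simp add: test_functions_def Ck_bump compact_supp[OF compact_cball] del: compact_closure)

lemma test_functions_sum:
  "(\<And>a. a \<in> A \<Longrightarrow> f a \<in> test_functions) \<Longrightarrow> (\<lambda>x. \<Sum>a\<in>A. f a x) \<in> test_functions"
  by (induction A rule: infinite_finite_induct) (simp_all add: test_functions_zero test_functions_add)

text \<open>The sum of the bumps of a finite subcover is at least some m > 0 on \<open>K\<close>. A
  flat function of this sum that saturates at the level m equals 1 on \<open>K\<close>. Flatness at
  the saturation level also gives the vanishing gradient at the points of \<open>K\<close>, so no
  neighbourhood of \<open>K\<close> on which the cutoff is constant has to be produced.\<close>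

lemma smooth_cutoff:
  fixes K :: "(real^'d::finite) set"
  assumes K: "compact K" and op: "open \<Omega>" and "K \<subseteq> \<Omega>"
  obtains \<eta> :: "real^'d \<Rightarrow> real" where "\<eta> \<in> test_functions" "supp \<eta> \<subseteq> \<Omega>"
    "\<And>x. 0 \<le> \<eta> x" "\<And>x. \<eta> x \<le> 1" "\<And>x. x \<in> K \<Longrightarrow> \<eta> x = 1" "\<And>x i. x \<in> K \<Longrightarrow> partial_deriv i \<eta> x = 0"
proof -
  have "\<exists>\<delta>>0. cball x \<delta> \<subseteq> \<Omega>" if "x \<in> K" for x
    using that assms(3) op open_contains_cball by blast
  then obtain \<delta> where \<delta>: "\<And>x. x \<in> K \<Longrightarrow> \<delta> x > 0 \<and> cball x (\<delta> x) \<subseteq> \<Omega>" by metis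
  obtain A where A: "A \<subseteq> K" "finite A" "K \<subseteq> (\<Union>x\<in>A. ball x (\<delta> x))"
    by (rule compactE_image[OF K, of K "\<lambda>x. ball x (\<delta> x)"]) (use \<delta> in auto)
  define S where "S x = (\<Sum>a\<in>A. bump a (\<delta> a) x)" for x
  have S_test: "S \<in> test_functions" unfolding S_def by (rule test_functions_sum) (use A \<delta> bump_test in blast)
  have S_nn: "S x \<ge> 0" for x unfolding S_def by (intro sum_nonneg bump_nonneg)
  have S_pos: "S x > 0" if "x \<in> K" for x
  proof -
    obtain a where a: "a \<in> A" "x \<in> ball a (\<delta> a)" using A(3) \<open>x \<in> K\<close> by blast
    then have "bump a (\<delta> a) x > 0" using bump_pos_iff \<delta> A by blast
    then show ?thesis unfolding S_def using a A by (intro sum_pos2[of _ a]) (auto simp: bump_nonneg)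
  qed
  obtain m where m: "m > 0" "\<And>x. x \<in> K \<Longrightarrow> S x \<ge> m"
  proof (cases "K = {}")
    case False
    have "continuous_on K S"
      using Ck_imp_continuous[OF test_functions_Ck[OF S_test]] continuous_on_subset by blast
    then obtain y where "y \<in> K" "\<And>x. x \<in> K \<Longrightarrow> S y \<le> S x"
      using continuous_attains_inf[OF K False] by blast
    then show ?thesis using S_pos that by blast
  qed (use that[of 1] in auto)
  \<comment> \<open>The factor \<open>exp 1\<close> is the inverse of \<open>flat_exp 0 1\<close>,
    so the value is 0 where \<open>S\<close> vanishes; where \<open>S\<close> is at least
    \<open>m\<close> the argument is nonpositive and the value is 1.\<close>
  define \<eta> where "\<eta> x = 1 - exp 1 * flat_exp 0 (1 - S x / m)" for x
  have ck: "Ck k (\<lambda>x. 1 - S x / m)" for k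
    using Ck_diff[OF Ck_const[of k 1] Ck_scaleR[OF Ck_const[of k "1/m"] test_functions_Ck[OF S_test]]]
    by simp
  have chi_Ck: "Ck k \<eta>" for k
    unfolding \<eta>_def by (intro Ck_diff Ck_mult Ck_const Ck_flat_exp ck)
  have z: "\<eta> x = 0" if "S x = 0" for x using that by (simp add: \<eta>_def flat_exp_def exp_minus)
  have T: "\<eta> \<in> test_functions"
    by (rule test_functions_I[OF chi_Ck S_test z])
  have "supp S \<subseteq> (\<Union>a\<in>A. cball a (\<delta> a))"
  proof (rule supp_subset_closed)
    show "closed (\<Union>a\<in>A. cball a (\<delta> a))" using A by auto
    show "S x = 0" if "x \<notin> (\<Union>a\<in>A. cball a (\<delta> a))" for x
      unfolding S_def using that A \<delta> by (intro sum.neutral) (force simp: bump_eq_0_iff)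
  qed
  also have "\<dots> \<subseteq> \<Omega>" using A \<delta> by blast
  finally have s: "supp \<eta> \<subseteq> \<Omega>" using supp_mono[of S \<eta>] z by blast
  have e: "exp 1 * exp (- (1 / t)) \<le> 1" if "t > 0" "t \<le> 1" for t :: real
    using that by (simp flip: exp_add)
  have b: "0 \<le> \<eta> x" "\<eta> x \<le> 1" for x
    using e[of "1 - S x / m"] S_nn[of x] m(1) by (auto simp: \<eta>_def flat_exp_def)
  have one: "\<eta> x = 1" if "x \<in> K" for x
    using m(1) m(2)[OF that] by (auto simp: \<eta>_def flat_exp_def)
  have "partial_deriv i \<eta> x = 0" if "x \<in> K" for x i
  proof -
    have d: "(\<lambda>x. 1 - S x / m) differentiable at x" using ck[of "Suc 0"] by simp
    have der: "((\<lambda>s. 1 - exp 1 * flat_exp 0 s) has_real_derivative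
        - exp 1 * (flat_exp 2 (1 - S x / m))) (at (1 - S x / m))"
      using DERIV_flat_exp[of 0 "1 - S x / m"]
      by (auto intro!: derivative_eq_intros simp: numeral_2_eq_2)
    have "partial_deriv i \<eta> x = - exp 1 * (flat_exp 2 (1 - S x / m)) * partial_deriv i (\<lambda>x. 1 - S x / m) x"
      using differentiable_of_real_compose(2)[OF der d] by (simp add: \<eta>_def[abs_def])
    also have "flat_exp 2 (1 - S x / m) = 0" using m(1) m(2)[OF that] by (auto simp: flat_exp_def)
    finally show ?thesis by simp
  qed
  then show ?thesis using that T s b one by blast
qed

section \<open>Testing against smooth functions\<close>

lemma has_derivative_partial_deriv:
  fixes f :: "real^'d::finite \<Rightarrow> 'b::real_normed_vector"
  assumes "f differentiable at x"
  shows "(f has_derivative (\<lambda>h. \<Sum>i\<in>UNIV. h $ i *\<^sub>R partial_deriv i f x)) (at x)"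
proof -
  let ?D = "frechet_derivative f (at x)"
  have d: "(f has_derivative ?D) (at x)" using assms frechet_derivative_works by blast
  then have l: "linear ?D" by (rule has_derivative_linear)
  have "?D h = (\<Sum>i\<in>UNIV. h $ i *\<^sub>R partial_deriv i f x)" for h
  proof -
    have "?D h = ?D (\<Sum>i\<in>UNIV. h $ i *s axis i 1)" by (simp add: basis_expansion)
    also have "\<dots> = (\<Sum>i\<in>UNIV. h $ i *\<^sub>R partial_deriv i f x)"
      by (simp add: linear_sum[OF l] scalar_mult_eq_scaleR linear_scale[OF l] partial_deriv_def)
    finally show ?thesis .
  qed
  then have "?D = (\<lambda>h. \<Sum>i\<in>UNIV. h $ i *\<^sub>R partial_deriv i f x)" by blast
  then show ?thesis using d by simp
qed

section \<open>Integration against continuous functions of compact support\<close>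

lemma continuous_compact_supp_bounded:
  assumes "continuous_on UNIV f" "compact (supp f)"
  obtains C where "C \<ge> 0" "\<And>x. norm (f x) \<le> C"
proof -
  have "bounded (f ` supp f)"
    by (intro compact_imp_bounded compact_continuous_image assms(2) continuous_on_subset[OF assms(1)]) auto
  then obtain C where C: "\<And>x. x \<in> supp f \<Longrightarrow> norm (f x) \<le> C"
    unfolding bounded_iff by blast
  have "norm (f x) \<le> max C 0" for x
    using C[OF in_supp[of f x]] by (cases "f x = 0") auto
  then show ?thesis using that[of "max C 0"] by auto
qed

lemma continuous_measurable_lebesgue:
  fixes f :: "real^'d::finite \<Rightarrow> 'b::topological_space"
  shows "continuous_on UNIV f \<Longrightarrow> f \<in> borel_measurable lebesgue"
  by (rule measurable_completion) (simp add: borel_measurable_continuous_onI)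

lemma L1_locD: "L1_loc h \<Longrightarrow> compact K \<Longrightarrow> integrable lebesgue (\<lambda>x. indicator K x *\<^sub>R h x)"
  unfolding L1_loc_def set_integrable_def by blast

lemma L1_loc_abs:
  fixes h :: "real^'d::finite \<Rightarrow> real"
  shows "L1_loc h \<Longrightarrow> compact K \<Longrightarrow> integrable lebesgue (\<lambda>x. indicator K x * \<bar>h x\<bar>)"
  using integrable_abs[OF L1_locD, of h K] by (simp add: abs_mult)

lemma L1_loc_measurable:
  assumes "L1_loc f"
  shows "f \<in> borel_measurable lebesgue"
proof (rule borel_measurable_LIMSEQ_metric)
  fix n :: nat
  have "integrable lebesgue (\<lambda>x. indicator (cball 0 (real n)) x *\<^sub>R f x)"
    using assms unfolding L1_loc_def set_integrable_def by (auto intro: compact_cball)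
  then show "(\<lambda>x. indicator (cball 0 (real n)) x *\<^sub>R f x) \<in> borel_measurable lebesgue"
    by (rule borel_measurable_integrable)
next
  fix x :: "real^'a"
  have "\<forall>\<^sub>F n in sequentially. indicator (cball 0 (real n)) x *\<^sub>R f x = f x"
    using eventually_ge_at_top[of "nat \<lceil>norm x\<rceil>"]
  proof eventually_elim
    case (elim n)
    then have "norm x \<le> real n" by linarith
    then show ?case by (simp add: dist_norm)
  qed
  then show "(\<lambda>n. indicator (cball 0 (real n)) x *\<^sub>R f x) \<longlonglongrightarrow> f x"
    by (rule tendsto_eventually)
qed

text \<open>Keeping the product abstract covers real products as well as scalings of complex and
  vector valued functions, which all occur as pairings with test functions.\<close>

lemma integrable_bilinear_L1_loc:
  fixes f :: "real^'d::finite \<Rightarrow> 'a::euclidean_space" and h :: "real^'d \<Rightarrow> 'b::euclidean_space"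
    and B :: "'a \<Rightarrow> 'b \<Rightarrow> 'c::euclidean_space"
  assumes B: "bounded_bilinear B" and h: "L1_loc h" and f: "continuous_on UNIV f" "compact (supp f)"
  shows "integrable lebesgue (\<lambda>x. B (f x) (h x))"
proof -
  obtain C where C: "C \<ge> 0" "\<And>x. norm (f x) \<le> C" using continuous_compact_supp_bounded[OF f] by blast
  obtain M where M: "M \<ge> 0" "\<And>a b. norm (B a b) \<le> norm a * norm b * M"
    using bounded_bilinear.nonneg_bounded[OF B] by blast
  have i: "integrable lebesgue (\<lambda>x. (C * M) *\<^sub>R (indicator (supp f) x *\<^sub>R h x))"
    using h f(2) unfolding L1_loc_def set_integrable_def by (intro integrable_scaleR_right) auto
  have "continuous_on UNIV (\<lambda>p. B (fst p) (snd p))"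
    by (intro bounded_bilinear.continuous_on[OF B] continuous_intros)
  then have cB: "(\<lambda>p. B (fst p) (snd p)) \<in> borel_measurable borel"
    by (rule borel_measurable_continuous_onI)
  have "(\<lambda>x. (f x, h x)) \<in> borel_measurable lebesgue"
    using continuous_measurable_lebesgue[OF f(1)] L1_loc_measurable[OF h] by simp
  from measurable_compose[OF this cB]
  have m: "(\<lambda>x. B (f x) (h x)) \<in> borel_measurable lebesgue" by simp
  show ?thesis
  proof (rule Bochner_Integration.integrable_bound[OF i m], rule AE_I2)
    fix x
    show "norm (B (f x) (h x)) \<le> norm ((C * M) *\<^sub>R (indicator (supp f) x *\<^sub>R h x))"
    proof (cases "f x = 0")
      case False
      then have "x \<in> supp f" by (rule in_supp)
      have "norm (B (f x) (h x)) \<le> norm (f x) * norm (h x) * M" by (rule M(2))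
      also have "\<dots> \<le> C * norm (h x) * M"
        by (intro mult_right_mono C M norm_ge_zero)
      finally show ?thesis using \<open>x \<in> supp f\<close> C(1) M(1) by (simp add: abs_mult mult_ac)
    qed (simp add: bounded_bilinear.zero_left[OF B])
  qed
qed

lemma L1_loc_const: "L1_loc (\<lambda>x::real^'d::finite. c :: 'b::euclidean_space)"
  unfolding L1_loc_def set_integrable_def
proof safe
  fix K :: "(real^'d) set" assume "compact K"
  from borel_integrable_compact[OF this continuous_on_const, of c]
  show "integrable lebesgue (\<lambda>x. indicator K x *\<^sub>R c)"
    by (simp add: integrable_completion borel_measurable_integrable)
qed

lemma integrable_continuous_compact_supp:
  fixes f :: "real^'d::finite \<Rightarrow> 'b::euclidean_space"
  assumes "continuous_on UNIV f" "compact (supp f)"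
  shows "integrable lebesgue f"
  using integrable_bilinear_L1_loc[OF bounded_bilinear.flip[OF bounded_bilinear_scaleR] L1_loc_const[of 1] assms]
  by simp

lemma lebesgue_integral_translate:
  fixes f :: "real^'d::finite \<Rightarrow> 'b::euclidean_space"
  assumes "continuous_on UNIV f"
  shows "(LINT x|lebesgue. f (x + a)) = (LINT x|lebesgue. f x)"
proof -
  have c: "continuous_on UNIV (\<lambda>x. f (x + a))"
    by (rule continuous_on_compose2[OF assms]) (auto intro!: continuous_intros)
  have "(LINT x|lborel. f (x + a)) = (LINT x|distr lborel borel ((+) a). f x)"
    by (subst integral_distr) (auto intro: borel_measurable_continuous_onI assms simp: add.commute)
  then show ?thesis
    using assms c by (simp add: lborel_distr_plus integral_completion borel_measurable_continuous_onI)
qed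

text \<open>Differentiation under the integral sign. The difference quotients are dominated by a
  bound for the directional derivative times the indicator of a compact set that contains the
  supports of all translates with \<open>\<bar>t\<bar> \<le> 1\<close>. With \<open>e = 1\<close>
  this leads to the divergence theorem; with an \<open>e\<close> of vanishing weak gradient it leads
  to translation invariance.\<close>

lemma DERIV_integral_translate_0:
  fixes \<Psi> :: "real^'d::finite \<Rightarrow> real"
  assumes e: "L1_loc e" and \<Psi>: "Ck 1 \<Psi>" "compact (supp \<Psi>)"
  shows "((\<lambda>t. LINT x|lebesgue. \<Psi> (x + t *\<^sub>R a) * e x) has_real_derivative
     (LINT x|lebesgue. (\<Sum>i\<in>UNIV. a $ i * partial_deriv i \<Psi> x) * e x)) (at 0)"
proof -
  define D where "D x = (\<Sum>i\<in>UNIV. a $ i * partial_deriv i \<Psi> x)" for x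
  have dif: "\<Psi> differentiable at x" for x using \<Psi> by simp
  have line: "((\<lambda>t. \<Psi> (x + t *\<^sub>R a)) has_real_derivative D (x + t *\<^sub>R a)) (at t)" for x t
  proof -
    have "((\<lambda>t. x + t *\<^sub>R a) has_derivative (\<lambda>t. t *\<^sub>R a)) (at t)"
      by (auto intro!: derivative_eq_intros)
    from diff_chain_at[OF this has_derivative_partial_deriv[OF dif]]
    have "((\<lambda>t. \<Psi> (x + t *\<^sub>R a)) has_derivative
        (\<lambda>h. \<Sum>i\<in>UNIV. (h *\<^sub>R a) $ i *\<^sub>R partial_deriv i \<Psi> (x + t *\<^sub>R a))) (at t)"
      by (simp add: o_def)
    moreover have "(\<lambda>h. \<Sum>i\<in>UNIV. (h *\<^sub>R a) $ i *\<^sub>R partial_deriv i \<Psi> y) = (*) (D y)" for y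
      by (simp add: D_def sum_distrib_left sum_distrib_right mult_ac fun_eq_iff)
    ultimately show ?thesis by (simp only: has_field_derivative_def)
  qed
  have contp: "continuous_on UNIV (partial_deriv i \<Psi>)" for i using \<Psi>(1) by simp
  have contD: "continuous_on UNIV D"
    unfolding D_def by (intro continuous_intros contp)
  have cont\<Psi>: "continuous_on UNIV \<Psi>" using \<Psi>(1) by (rule Ck_imp_continuous)
  have suppD: "supp D \<subseteq> supp \<Psi>"
    by (rule supp_subset_closed) (auto simp: D_def partial_deriv_outside_supp)
  have cD: "compact (supp D)" by (rule compact_supp[OF \<Psi>(2) suppD])
  obtain C where C: "C \<ge> 0" "\<And>x. \<bar>D x\<bar> \<le> C"
    using continuous_compact_supp_bounded[OF contD cD] by auto
  have lip: "\<bar>\<Psi> (x + t *\<^sub>R a) - \<Psi> x\<bar> \<le> C * \<bar>t\<bar>" for x t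
  proof -
    have "norm (\<Psi> (x + t *\<^sub>R a) - \<Psi> (x + 0 *\<^sub>R a)) \<le> C * norm (t - 0)"
      by (rule field_differentiable_bound[of UNIV _ "\<lambda>t. D (x + t *\<^sub>R a)"])
        (use line C in \<open>auto simp: has_field_derivative_at_within\<close>)
    then show ?thesis by simp
  qed
  define K where "K = (\<lambda>(x, t). x - t *\<^sub>R a) ` (supp \<Psi> \<times> {-1..1::real})"
  have K: "compact K" unfolding K_def split_def
    by (intro compact_continuous_image compact_Times \<Psi>(2) compact_Icc continuous_intros)
  have outK: "\<Psi> (x + t *\<^sub>R a) = 0" if "x \<notin> K" "\<bar>t\<bar> \<le> 1" for x t
  proof (rule ccontr)
    assume "\<Psi> (x + t *\<^sub>R a) \<noteq> 0"
    then have "x + t *\<^sub>R a \<in> supp \<Psi>" by (rule in_supp)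
    then have "x \<in> K" unfolding K_def using that(2) by (intro image_eqI[of _ _ "(x + t *\<^sub>R a, t)"]) auto
    then show False using that by blast
  qed
  have contt: "continuous_on UNIV (\<lambda>x. \<Psi> (x + t *\<^sub>R a))" for t
    by (rule continuous_on_compose2[OF cont\<Psi>]) (auto intro!: continuous_intros)
  have compt: "compact (supp (\<lambda>x. \<Psi> (x + t *\<^sub>R a)))" if "\<bar>t\<bar> \<le> 1" for t
    by (rule compact_supp[OF K supp_subset_closed]) (use K outK that compact_imp_closed in auto)
  note integ = integrable_bilinear_L1_loc[OF bounded_bilinear_mult e]
  have iK: "integrable lebesgue (\<lambda>x. C * (indicator K x * \<bar>e x\<bar>))"
    by (intro integrable_mult_right L1_loc_abs e K)
  show ?thesis unfolding DERIV_def tendsto_at_iff_sequentially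
  proof (intro allI impI)
    fix X :: "nat \<Rightarrow> real" assume X: "\<forall>n. X n \<in> UNIV - {0}" "X \<longlonglongrightarrow> 0"
    define q where "q n x = (\<Psi> (x + X n *\<^sub>R a) - \<Psi> x) / X n * e x" for n x
    have ev: "\<forall>\<^sub>F n in sequentially. \<bar>X n\<bar> \<le> 1"
      using tendstoD[OF X(2) zero_less_one] by eventually_elim (simp add: dist_norm)
    have "\<exists>N. \<forall>n\<ge>N. \<bar>X n\<bar> \<le> 1" using ev unfolding eventually_sequentially by simp
    then obtain N where N: "\<And>n. n \<ge> N \<Longrightarrow> \<bar>X n\<bar> \<le> 1" by blast
    \<comment> \<open>The domination needs \<open>\<bar>X n\<bar> \<le> 1\<close>, which is known
      only from \<open>N\<close> on; the shift makes it hold for every index.\<close>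
    have "(\<lambda>n. LINT x|lebesgue. q (n + N) x) \<longlonglongrightarrow> (LINT x|lebesgue. D x * e x)"
    proof (rule integral_dominated_convergence[OF _ _ iK])
      show "(\<lambda>x. D x * e x) \<in> borel_measurable lebesgue"
        using integ[OF contD cD] by (rule borel_measurable_integrable)
      show "q (n + N) \<in> borel_measurable lebesgue" for n
        unfolding q_def using continuous_measurable_lebesgue[OF cont\<Psi>]
          continuous_measurable_lebesgue[OF contt] L1_loc_measurable[OF e] by measurable
      show "AE x in lebesgue. (\<lambda>n. q (n + N) x) \<longlonglongrightarrow> D x * e x"
      proof (rule AE_I2)
        fix x
        have "((\<lambda>h. (\<Psi> (x + h *\<^sub>R a) - \<Psi> x) / h) \<longlongrightarrow> D x) (at 0)"
          using line[of x 0] by (simp add: DERIV_def)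
        then have "(\<lambda>n. (\<Psi> (x + X n *\<^sub>R a) - \<Psi> x) / X n) \<longlonglongrightarrow> D x"
          unfolding tendsto_at_iff_sequentially o_def using X by blast
        then have "(\<lambda>n. q n x) \<longlonglongrightarrow> D x * e x"
          unfolding q_def by (intro tendsto_intros)
        then show "(\<lambda>n. q (n + N) x) \<longlonglongrightarrow> D x * e x" by (rule LIMSEQ_ignore_initial_segment)
      qed
      show "AE x in lebesgue. norm (q (n + N) x) \<le> C * (indicator K x * \<bar>e x\<bar>)" for n
      proof (rule AE_I2)
        fix x
        have n: "\<bar>X (n + N)\<bar> \<le> 1" "X (n + N) \<noteq> 0" using N[of "n + N"] X(1) by auto
        show "norm (q (n + N) x) \<le> C * (indicator K x * \<bar>e x\<bar>)"
        proof (cases "x \<in> K")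
          case True
          have "\<bar>(\<Psi> (x + X (n + N) *\<^sub>R a) - \<Psi> x) / X (n + N)\<bar> \<le> C"
            using lip[of x "X (n + N)"] n by (simp add: abs_divide divide_le_eq)
          from mult_right_mono[OF this abs_ge_zero[of "e x"]] show ?thesis
            using True by (simp add: q_def abs_mult)
        next
          case False
          then show ?thesis using outK[OF False n(1)] outK[OF False, of 0] by (simp add: q_def)
        qed
      qed
    qed
    then have lim: "(\<lambda>n. LINT x|lebesgue. q n x) \<longlonglongrightarrow> (LINT x|lebesgue. D x * e x)"
      by (rule LIMSEQ_offset)
    have "\<forall>\<^sub>F n in sequentially. (LINT x|lebesgue. q n x) = ((\<lambda>h. ((LINT x|lebesgue. \<Psi> (x + (0 + h) *\<^sub>R a) * e x) -
            (LINT x|lebesgue. \<Psi> (x + 0 *\<^sub>R a) * e x)) / h) \<circ> X) n"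
      using ev
    proof eventually_elim
      case (elim n)
      have "(LINT x|lebesgue. \<Psi> (x + X n *\<^sub>R a) * e x) - (LINT x|lebesgue. \<Psi> x * e x)
         = (LINT x|lebesgue. \<Psi> (x + X n *\<^sub>R a) * e x - \<Psi> x * e x)"
        by (rule Bochner_Integration.integral_diff[symmetric])
          (use integ[OF contt compt[OF elim]] integ[OF cont\<Psi> \<Psi>(2)] in auto)
      also have "\<dots> = (LINT x|lebesgue. X n * q n x)"
        by (rule Bochner_Integration.integral_cong) (use X(1) in \<open>auto simp: q_def field_simps\<close>)
      also have "\<dots> = X n * (LINT x|lebesgue. q n x)" by simp
      finally show ?case using X(1) by simp
    qed
    with lim show "((\<lambda>h. ((LINT x|lebesgue. \<Psi> (x + (0 + h) *\<^sub>R a) * e x) -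
            (LINT x|lebesgue. \<Psi> (x + 0 *\<^sub>R a) * e x)) / h) \<circ> X)
         \<longlonglongrightarrow> (LINT x|lebesgue. (\<Sum>i\<in>UNIV. a $ i * partial_deriv i \<Psi> x) * e x)"
      unfolding D_def[symmetric] by (rule Lim_transform_eventually)
  qed
qed

text \<open>The integral of a translate does not depend on the translation, so its derivative along
  a coordinate axis is 0. This avoids iterated integration over the coordinates.\<close>

lemma integral_partial_deriv_eq_0_real:
  fixes f :: "real^'d::finite \<Rightarrow> real"
  assumes "Ck 1 f" "compact (supp f)"
  shows "(LINT x|lebesgue. partial_deriv i f x) = 0"
proof -
  have c: "continuous_on UNIV f" using assms(1) by (rule Ck_imp_continuous)
  have "((\<lambda>t. LINT x|lebesgue. f (x + t *\<^sub>R axis i 1) * 1) has_real_derivative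
     (LINT x|lebesgue. (\<Sum>j\<in>UNIV. axis i 1 $ j * partial_deriv j f x) * 1)) (at 0)"
    by (rule DERIV_integral_translate_0[OF L1_loc_const assms])
  moreover have "(\<Sum>j\<in>UNIV. axis i 1 $ j * partial_deriv j f x) = partial_deriv i f x" for x
    by (simp add: axis_def if_distrib[of "\<lambda>z. z * _"] cong: if_cong)
  ultimately have "((\<lambda>t. LINT x|lebesgue. f x) has_real_derivative
     (LINT x|lebesgue. partial_deriv i f x)) (at 0)"
    by (simp add: lebesgue_integral_translate[OF c])
  then show ?thesis using DERIV_unique DERIV_const by blast
qed

lemma integral_partial_deriv_eq_0:
  fixes f :: "real^'d::finite \<Rightarrow> complex"
  assumes f: "Ck 1 f" "compact (supp f)"
  shows "(LINT x|lebesgue. partial_deriv i f x) = 0"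
proof -
  have d: "f differentiable at x" for x using f by simp
  have s: "supp (partial_deriv i f) \<subseteq> supp f" by (rule supp_partial_deriv)
  have I: "integrable lebesgue (partial_deriv i f)"
    using f(1) by (intro integrable_continuous_compact_supp compact_supp[OF f(2) s]) simp
  have *: "T (LINT x|lebesgue. partial_deriv i f x) = 0" if T: "bounded_linear T" for T :: "complex \<Rightarrow> real"
  proof -
    have "supp (\<lambda>x. T (f x)) \<subseteq> supp f"
      by (rule supp_mono) (simp add: linear_0 bounded_linear.linear[OF T])
    then have "(LINT x|lebesgue. partial_deriv i (\<lambda>x. T (f x)) x) = 0"
      by (intro integral_partial_deriv_eq_0_real Ck_bounded_linear_compose[OF T] f(1) compact_supp[OF f(2)])
    then show ?thesis
      by (simp add: partial_deriv_bounded_linear_compose[OF T d] integral_bounded_linear[OF T I])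
  qed
  show ?thesis using *[OF bounded_linear_Re] *[OF bounded_linear_Im] by (simp add: complex_eq_iff)
qed

text \<open>The indicator of a compact set is the bounded pointwise limit of cutoffs supported in
  shrinking neighbourhoods of it.\<close>

lemma integral_compact_eq_0_of_test:
  fixes h :: "real^'d::finite \<Rightarrow> real"
  assumes h: "L1_loc h" and \<Omega>: "open \<Omega>"
    and 0: "\<And>\<phi>. \<phi> \<in> test_functions \<Longrightarrow> supp \<phi> \<subseteq> \<Omega> \<Longrightarrow> (LINT x|lebesgue. \<phi> x * h x) = 0"
    and K: "compact K" "K \<subseteq> \<Omega>"
  shows "(LINT x|lebesgue. indicator K x * h x) = 0"
proof (cases "K = {}")
  case False
  define U where "U n = \<Omega> \<inter> {x. infdist x K < 1 / real (Suc n)}" for n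
  have "open (U n)" for n unfolding U_def
    by (intro open_Int \<Omega> open_Collect_less continuous_intros)
  moreover have "K \<subseteq> U n" for n unfolding U_def using K by auto
  ultimately have "\<exists>\<eta>. \<eta> \<in> test_functions \<and> supp \<eta> \<subseteq> U n \<and> (\<forall>x. 0 \<le> \<eta> x \<and> \<eta> x \<le> 1) \<and>
      (\<forall>x\<in>K. \<eta> x = (1::real))" for n
    using smooth_cutoff[OF K(1)] by metis
  then obtain \<eta> :: "nat \<Rightarrow> real^'d \<Rightarrow> real" where \<eta>: "\<And>n. \<eta> n \<in> test_functions" "\<And>n. supp (\<eta> n) \<subseteq> U n"
      "\<And>n x. 0 \<le> \<eta> n x" "\<And>n x. \<eta> n x \<le> 1" "\<And>n x. x \<in> K \<Longrightarrow> \<eta> n x = 1" by metis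
  \<comment> \<open>All cutoffs vanish outside the closed neighbourhood of radius 1, as 1/(n+1) is
    at most 1; this gives one integrable majorant.\<close>
  define K' where "K' = {x. infdist x K \<le> 1}"
  have K': "compact K'" unfolding K'_def by (rule compact_infdist_le[OF False K(1)]) simp
  have iK: "integrable lebesgue (\<lambda>x. indicator K' x * \<bar>h x\<bar>)"
    by (rule L1_loc_abs[OF h K'])
  have out: "\<eta> n x = 0" if "infdist x K \<ge> 1 / real (Suc n)" for n x
  proof (rule ccontr)
    assume "\<eta> n x \<noteq> 0"
    then have "x \<in> U n" by (intro subsetD[OF \<eta>(2)] in_supp)
    then show False using that by (simp add: U_def)
  qed
  have "(\<lambda>n. LINT x|lebesgue. \<eta> n x * h x) \<longlonglongrightarrow> (LINT x|lebesgue. indicator K x * h x)"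
  proof (rule integral_dominated_convergence[OF _ _ iK])
    show "(\<lambda>x. indicator K x * h x) \<in> borel_measurable lebesgue"
      using L1_locD[OF h K(1)] by (auto dest: borel_measurable_integrable)
    show "(\<lambda>x. \<eta> n x * h x) \<in> borel_measurable lebesgue" for n
      using L1_loc_measurable[OF h] continuous_measurable_lebesgue[OF Ck_imp_continuous[OF test_functions_Ck[OF \<eta>(1)]]]
      by (intro borel_measurable_times)
    show "AE x in lebesgue. (\<lambda>n. \<eta> n x * h x) \<longlonglongrightarrow> indicator K x * h x"
    proof (rule AE_I2, rule tendsto_eventually)
      fix x
      show "\<forall>\<^sub>F n in sequentially. \<eta> n x * h x = indicator K x * h x"
      proof (cases "x \<in> K")
        case False
        then have "infdist x K > 0"
          by (intro infdist_pos_not_in_closed compact_imp_closed K(1) \<open>K \<noteq> {}\<close>)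
        then obtain N where N: "1 / real (Suc N) < infdist x K"
          by (rule nat_approx_posE)
        have "\<forall>\<^sub>F n in sequentially. n \<ge> N" by (rule eventually_ge_at_top)
        then show ?thesis
        proof eventually_elim
          case (elim n)
          have "1 / real (Suc n) \<le> 1 / real (Suc N)" using elim by (simp add: frac_le)
          then show ?case using out[of n x] N False by simp
        qed
      qed (simp add: \<eta>(5))
    qed
    show "AE x in lebesgue. norm (\<eta> n x * h x) \<le> indicator K' x * \<bar>h x\<bar>" for n
    proof (rule AE_I2)
      fix x
      show "norm (\<eta> n x * h x) \<le> indicator K' x * \<bar>h x\<bar>"
      proof (cases "x \<in> K'")
        case True
        then show ?thesis using \<eta>(3,4)[of n x] by (simp add: abs_mult mult_left_le_one_le)
      next
        case False
        have "1 / real (Suc n) \<le> 1" by simp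
        moreover have "1 < infdist x K" using False unfolding K'_def by simp
        ultimately have "1 / real (Suc n) \<le> infdist x K" by linarith
        then have "\<eta> n x = 0" by (rule out)
        then show ?thesis by simp
      qed
    qed
  qed
  moreover have "(LINT x|lebesgue. \<eta> n x * h x) = 0" for n
    using \<eta>(1,2)[of n] by (intro 0) (auto simp: U_def)
  ultimately show ?thesis by (simp add: LIMSEQ_const_iff)
qed simp

text \<open>Up to a null set, the set where \<open>h\<close> is positive is a countable union of
  compact sets. The integral of \<open>h\<close> over each of them is 0 while \<open>h\<close> is
  positive there, so each is a null set.\<close>

lemma AE_nonpos_of_test:
  fixes h :: "real^'d::finite \<Rightarrow> real"
  assumes h: "L1_loc h" and \<Omega>: "open \<Omega>"
    and 0: "\<And>\<phi>. \<phi> \<in> test_functions \<Longrightarrow> supp \<phi> \<subseteq> \<Omega> \<Longrightarrow> (LINT x|lebesgue. \<phi> x * h x) = 0"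
  shows "AE x in lebesgue. x \<in> \<Omega> \<longrightarrow> h x \<le> 0"
proof -
  define A where "A = {x. x \<in> \<Omega> \<and> h x > 0}"
  have m: "h \<in> borel_measurable lebesgue" by (rule L1_loc_measurable[OF h])
  have "A = \<Omega> \<inter> (h -` {0<..} \<inter> space lebesgue)" by (auto simp: A_def)
  also have "\<dots> \<in> sets lebesgue"
    using m \<Omega> by (intro sets.Int measurable_sets[OF m]) auto
  finally have A: "A \<in> sets lebesgue" .
  obtain C T where CT: "fsigma C" "T \<in> null_sets lebesgue" "C \<union> T = A" "disjnt C T"
    by (rule lebesgue_set_almost_fsigma[OF A])
  obtain F :: "nat \<Rightarrow> (real^'d) set" where rF: "range F \<subseteq> Collect compact" and C: "C = (\<Union>n. F n)"
    using iffD1[OF fsigma_Union_compact CT(1)] by metis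
  then have F: "compact (F n)" for n by auto
  have null: "F n \<in> null_sets lebesgue" for n
  proof -
    define K where "K = F n"
    have K: "compact K" unfolding K_def by (rule F)
    have sub: "K \<subseteq> A" using C CT(3) unfolding K_def by blast
    have z: "(LINT x|lebesgue. indicator K x * h x) = 0"
      by (rule integral_compact_eq_0_of_test[OF h \<Omega> 0 K]) (use sub in \<open>auto simp: A_def\<close>)
    have i: "integrable lebesgue (\<lambda>x. indicator K x * h x)"
      using L1_locD[OF h K] by simp
    have nn: "AE x in lebesgue. 0 \<le> indicator K x * h x"
      using sub by (intro AE_I2) (auto simp: A_def indicator_def)
    have "AE x in lebesgue. indicator K x * h x = 0"
      using integral_nonneg_eq_0_iff_AE[OF i nn] z by simp
    then have "AE x in lebesgue. x \<notin> K"
      by eventually_elim (use sub in \<open>auto simp: A_def indicator_def\<close>)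
    moreover have "K \<in> sets lebesgue" using K by (simp add: compact_imp_closed)
    ultimately show ?thesis using AE_iff_null_sets[of K lebesgue] by (simp add: K_def)
  qed
  have "(\<Union>n. F n) \<union> T \<in> null_sets lebesgue"
    using null CT(2) by (intro null_sets.Un null_sets_UN') auto
  moreover have "A \<subseteq> (\<Union>n. F n) \<union> T" using CT(3) C by blast
  ultimately show ?thesis
    using AE_I'[of "(\<Union>n. F n) \<union> T" lebesgue "\<lambda>x. x \<in> \<Omega> \<longrightarrow> h x \<le> 0"] by (simp add: A_def not_le)
qed

lemma AE_eq_0_of_test:
  fixes h :: "real^'d::finite \<Rightarrow> real"
  assumes h: "L1_loc h" and \<Omega>: "open \<Omega>"
    and 0: "\<And>\<phi>. \<phi> \<in> test_functions \<Longrightarrow> supp \<phi> \<subseteq> \<Omega> \<Longrightarrow> (LINT x|lebesgue. \<phi> x * h x) = 0"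
  shows "AE x in lebesgue. x \<in> \<Omega> \<longrightarrow> h x = 0"
proof -
  have "L1_loc (\<lambda>x. - h x)" using h unfolding L1_loc_def set_integrable_def by auto
  then have "AE x in lebesgue. x \<in> \<Omega> \<longrightarrow> - h x \<le> 0"
    by (rule AE_nonpos_of_test[OF _ \<Omega>]) (simp add: 0)
  moreover have "AE x in lebesgue. x \<in> \<Omega> \<longrightarrow> h x \<le> 0"
    by (rule AE_nonpos_of_test[OF h \<Omega> 0])
  ultimately show ?thesis by eventually_elim auto
qed

lemma L1_loc_bounded_linear:
  fixes h :: "real^'d::finite \<Rightarrow> 'b::euclidean_space" and T :: "'b \<Rightarrow> 'c::euclidean_space"
  assumes "bounded_linear T" "L1_loc h"
  shows "L1_loc (\<lambda>x. T (h x))"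
  unfolding L1_loc_def set_integrable_def
proof safe
  fix K :: "(real^'d) set" assume "compact K"
  then have "integrable lebesgue (\<lambda>x. T (indicator K x *\<^sub>R h x))"
    by (intro integrable_bounded_linear[OF assms(1)] L1_locD assms(2))
  then show "integrable lebesgue (\<lambda>x. indicator K x *\<^sub>R T (h x))"
    by (simp add: linear_scale[OF bounded_linear.linear[OF assms(1)]])
qed

lemma AE_eq_0_of_test_complex:
  fixes h :: "real^'d::finite \<Rightarrow> complex"
  assumes h: "L1_loc h" and \<Omega>: "open \<Omega>"
    and 0: "\<And>\<phi>. (\<phi> :: real^'d \<Rightarrow> real) \<in> test_functions \<Longrightarrow> supp \<phi> \<subseteq> \<Omega> \<Longrightarrow> (LINT x|lebesgue. \<phi> x *\<^sub>R h x) = 0"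
  shows "AE x in lebesgue. x \<in> \<Omega> \<longrightarrow> h x = 0"
proof -
  have *: "AE x in lebesgue. x \<in> \<Omega> \<longrightarrow> T (h x) = 0" if T: "bounded_linear T" for T :: "complex \<Rightarrow> real"
  proof (rule AE_eq_0_of_test[OF L1_loc_bounded_linear[OF T h] \<Omega>])
    fix \<phi> :: "real^'d \<Rightarrow> real" assume \<phi>: "\<phi> \<in> test_functions" "supp \<phi> \<subseteq> \<Omega>"
    have "integrable lebesgue (\<lambda>x. \<phi> x *\<^sub>R h x)"
      by (rule integrable_bilinear_L1_loc[OF bounded_bilinear_scaleR h
            Ck_imp_continuous[OF test_functions_Ck[OF \<phi>(1)]] test_functions_compact[OF \<phi>(1)]])
    from integral_bounded_linear[OF T this] 0[OF \<phi>]
    show "(LINT x|lebesgue. \<phi> x * T (h x)) = 0"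
      by (simp add: linear_scale[OF bounded_linear.linear[OF T]] linear_0[OF bounded_linear.linear[OF T]])
  qed
  show ?thesis using *[OF bounded_linear_Re] *[OF bounded_linear_Im]
    by eventually_elim (auto simp: complex_eq_iff)
qed

text \<open>A hydrodynamic state only asserts that some gradient exists. Uniqueness allows it to be
  exchanged for the gradient obtained as a limit of test functions.\<close>

lemma weak_gradient_unique:
  assumes u: "weak_gradient u g" and v: "weak_gradient v k" and "AE x in lebesgue. u x = v x"
  shows "AE x in lebesgue. g x = k x"
proof -
  have "AE x in lebesgue. x \<in> UNIV \<longrightarrow> g x $ i - k x $ i = 0" for i
  proof (rule AE_eq_0_of_test_complex)
    have L: "L1_loc (\<lambda>x. g x $ i)" "L1_loc (\<lambda>x. k x $ i)" "L1_loc u" "L1_loc v"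
      using u v L1_loc_bounded_linear[OF bounded_linear_vec_nth] unfolding weak_gradient_def by blast+
    then show "L1_loc (\<lambda>x. g x $ i - k x $ i)"
      unfolding L1_loc_def set_integrable_def by (auto simp: scaleR_diff_right)
    fix \<phi> :: "real^'a \<Rightarrow> real" assume \<phi>: "\<phi> \<in> test_functions"
    have i: "integrable lebesgue (\<lambda>x. \<phi> x *\<^sub>R w x)" if "L1_loc w" for w :: "real^'a \<Rightarrow> complex"
      by (rule integrable_bilinear_L1_loc[OF bounded_bilinear_scaleR that
            Ck_imp_continuous[OF test_functions_Ck[OF \<phi>]] test_functions_compact[OF \<phi>]])
    have "(LINT x|lebesgue. \<phi> x *\<^sub>R (g x $ i - k x $ i))
       = (LINT x|lebesgue. \<phi> x *\<^sub>R (g x $ i)) - (LINT x|lebesgue. \<phi> x *\<^sub>R (k x $ i))"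
      using i[OF L(1)] i[OF L(2)] by (simp add: scaleR_diff_right)
    also have "\<dots> = (LINT x|lebesgue. partial_deriv i \<phi> x *\<^sub>R v x) - (LINT x|lebesgue. partial_deriv i \<phi> x *\<^sub>R u x)"
      using u v \<phi> unfolding weak_gradient_def by simp
    also have "(LINT x|lebesgue. partial_deriv i \<phi> x *\<^sub>R v x) = (LINT x|lebesgue. partial_deriv i \<phi> x *\<^sub>R u x)"
    proof (rule integral_cong_AE)
      have m: "partial_deriv i \<phi> \<in> borel_measurable lebesgue"
        by (rule continuous_measurable_lebesgue[OF Ck_imp_continuous[OF test_functions_Ck[OF test_functions_partial_deriv[OF \<phi>]]]])
      show "(\<lambda>x. partial_deriv i \<phi> x *\<^sub>R v x) \<in> borel_measurable lebesgue"
        "(\<lambda>x. partial_deriv i \<phi> x *\<^sub>R u x) \<in> borel_measurable lebesgue"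
        using m L1_loc_measurable[OF L(3)] L1_loc_measurable[OF L(4)] by (auto intro!: borel_measurable_scaleR)
      show "AE x in lebesgue. partial_deriv i \<phi> x *\<^sub>R v x = partial_deriv i \<phi> x *\<^sub>R u x"
        using assms(3) by eventually_elim simp
    qed
    finally show "(LINT x|lebesgue. \<phi> x *\<^sub>R (g x $ i - k x $ i)) = 0" by simp
  qed simp
  then have "AE x in lebesgue. \<forall>i\<in>UNIV. g x $ i - k x $ i = 0" by (intro AE_finite_allI) auto
  then show ?thesis by eventually_elim (auto simp: vec_eq_iff)
qed

section \<open>The space of square integrable functions\<close>

lemma L2_measurable: "f \<in> L2 \<Longrightarrow> f \<in> borel_measurable lebesgue"
  by (simp add: L2_def)

lemma L2_integrable: "f \<in> L2 \<Longrightarrow> integrable lebesgue (\<lambda>x. (cmod (f x))\<^sup>2)"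
  by (simp add: L2_def)

lemma L2_norm_nonneg: "L2_norm f \<ge> 0"
  by (simp add: L2_norm_def)

lemma L2_norm_sq: "(L2_norm f)\<^sup>2 = (LINT x|lebesgue. (cmod (f x))\<^sup>2)"
  by (simp add: L2_norm_def)

lemma L2_dominated:
  assumes "f \<in> borel_measurable lebesgue" "integrable lebesgue b" "AE x in lebesgue. (cmod (f x))\<^sup>2 \<le> b x"
  shows "f \<in> L2"
  unfolding L2_def using assms
  by (auto intro!: Bochner_Integration.integrable_bound[OF assms(2)])

lemma L2_mult_bounded:
  assumes "f \<in> L2" "m \<in> borel_measurable lebesgue" "\<And>x. cmod (m x) \<le> C"
  shows "(\<lambda>x. m x * f x) \<in> L2"
proof (rule L2_dominated)
  show "integrable lebesgue (\<lambda>x. C\<^sup>2 * (cmod (f x))\<^sup>2)" using L2_integrable[OF assms(1)] by simp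
  show "AE x in lebesgue. (cmod (m x * f x))\<^sup>2 \<le> C\<^sup>2 * (cmod (f x))\<^sup>2"
    using assms(3) by (intro AE_I2) (auto simp: norm_mult power_mult_distrib intro!: mult_right_mono power_mono)
qed (use assms L2_measurable[OF assms(1)] in auto)

lemma L2_cmult: "f \<in> L2 \<Longrightarrow> (\<lambda>x. c * f x) \<in> L2"
  by (rule L2_mult_bounded[where C="cmod c"]) auto

lemma L2_uminus: "f \<in> L2 \<Longrightarrow> (\<lambda>x. - f x) \<in> L2"
  using L2_cmult[of f "-1"] by simp

lemma L2_cnj:
  assumes "f \<in> L2"
  shows "(\<lambda>x. cnj (f x)) \<in> L2"
proof -
  have "cnj \<in> borel_measurable borel" by (intro borel_measurable_continuous_onI continuous_intros)
  from measurable_compose[OF L2_measurable[OF assms] this] show ?thesis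
    using L2_integrable[OF assms] by (simp add: L2_def)
qed

lemma L2_zero: "(\<lambda>x. 0) \<in> L2"
  by (auto simp: L2_def)

lemma L2_add:
  assumes f: "f \<in> L2" and g: "g \<in> L2"
  shows "(\<lambda>x. f x + g x) \<in> L2"
proof (rule L2_dominated)
  show "(\<lambda>x. f x + g x) \<in> borel_measurable lebesgue"
    using L2_measurable[OF f] L2_measurable[OF g] by (rule borel_measurable_add)
  show "integrable lebesgue (\<lambda>x. 2 * (cmod (f x))\<^sup>2 + 2 * (cmod (g x))\<^sup>2)"
    using L2_integrable[OF f] L2_integrable[OF g] by simp
  have "(cmod (a + b))\<^sup>2 \<le> 2 * (cmod a)\<^sup>2 + 2 * (cmod b)\<^sup>2" for a b :: complex
  proof -
    have "(cmod (a + b))\<^sup>2 \<le> (cmod a + cmod b)\<^sup>2" by (intro power_mono norm_triangle_ineq norm_ge_zero)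
    then show ?thesis using sum_squares_bound[of "cmod a" "cmod b"] by (simp add: power2_sum)
  qed
  then show "AE x in lebesgue. (cmod (f x + g x))\<^sup>2 \<le> 2 * (cmod (f x))\<^sup>2 + 2 * (cmod (g x))\<^sup>2" by simp
qed

lemma L2_diff: "f \<in> L2 \<Longrightarrow> g \<in> L2 \<Longrightarrow> (\<lambda>x. f x - g x) \<in> L2"
  using L2_add[OF _ L2_uminus, of f g] by simp

lemma L2_sum: "(\<And>a. a \<in> A \<Longrightarrow> f a \<in> L2) \<Longrightarrow> (\<lambda>x. \<Sum>a\<in>A. f a x) \<in> L2"
  by (induction A rule: infinite_finite_induct) (simp_all add: L2_zero L2_add)

lemma L2_prod_integrable:
  assumes f: "f \<in> L2" and g: "g \<in> L2"
  shows "integrable lebesgue (\<lambda>x. cmod (f x) * cmod (g x))" "integrable lebesgue (\<lambda>x. f x * g x)"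
proof -
  have i: "integrable lebesgue (\<lambda>x. (cmod (f x))\<^sup>2 + (cmod (g x))\<^sup>2)"
    using L2_integrable[OF f] L2_integrable[OF g] by simp
  have b: "cmod a * cmod b \<le> (cmod a)\<^sup>2 + (cmod b)\<^sup>2" for a b :: complex
    using sum_squares_bound[of "cmod a" "cmod b"] mult_nonneg_nonneg[OF norm_ge_zero[of a] norm_ge_zero[of b]]
    by linarith
  have m: "f \<in> borel_measurable lebesgue" "g \<in> borel_measurable lebesgue"
    using f g L2_measurable by auto
  show "integrable lebesgue (\<lambda>x. cmod (f x) * cmod (g x))" "integrable lebesgue (\<lambda>x. f x * g x)"
    by (rule Bochner_Integration.integrable_bound[OF i]; use m b in \<open>auto simp: norm_mult\<close>)+
qed

lemma L2_inner_integrable: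
  "f \<in> L2 \<Longrightarrow> g \<in> L2 \<Longrightarrow> integrable lebesgue (\<lambda>x. cnj (f x) * g x)"
  by (rule L2_prod_integrable(2)[OF L2_cnj])

text \<open>The discriminant argument: integrating the square of |f| - t |g| gives a quadratic
  polynomial in t without negative values. Having the absolute values inside the integral makes the
  inequality usable for L1 bounds of currents and densities.\<close>

lemma L2_norm_mult_le:
  assumes f: "f \<in> L2" and g: "g \<in> L2"
  shows "(LINT x|lebesgue. cmod (f x) * cmod (g x)) \<le> L2_norm f * L2_norm g"
proof -
  define a b c where "a = (LINT x|lebesgue. (cmod (f x))\<^sup>2)"
    and "b = (LINT x|lebesgue. cmod (f x) * cmod (g x))" and "c = (LINT x|lebesgue. (cmod (g x))\<^sup>2)"
  note ints = L2_integrable[OF f] L2_integrable[OF g] L2_prod_integrable(1)[OF f g]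
  have q: "0 \<le> a - 2 * t * b + t\<^sup>2 * c" for t
  proof -
    have "0 \<le> (LINT x|lebesgue. (cmod (f x) - t * cmod (g x))\<^sup>2)" by simp
    also have "\<dots> = (LINT x|lebesgue. (cmod (f x))\<^sup>2 - 2 * t * (cmod (f x) * cmod (g x)) + t\<^sup>2 * (cmod (g x))\<^sup>2)"
      by (simp add: power2_diff power_mult_distrib algebra_simps)
    also have "\<dots> = a - 2 * t * b + t\<^sup>2 * c"
      unfolding a_def b_def c_def using ints by simp
    finally show ?thesis .
  qed
  have nn: "0 \<le> a" "0 \<le> b" "0 \<le> c" by (auto simp: a_def b_def c_def)
  have "b\<^sup>2 \<le> a * c"
  proof (cases "c = 0")
    case True
    have "b = 0"
    proof (rule ccontr)
      assume "b \<noteq> 0"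
      \<comment> \<open>For \<open>c = 0\<close> the polynomial is linear in \<open>t\<close>, and
        this \<open>t\<close> gives it the value -1.\<close>
      then show False using q[of "(a + 1) / (2 * b)"] True by simp
    qed
    then show ?thesis using True by simp
  next
    case False
    \<comment> \<open>The minimiser of the polynomial.\<close>
    then show ?thesis using q[of "b / c"] nn by (simp add: field_simps power2_eq_square)
  qed
  then have "b \<le> sqrt (a * c)" using nn by (simp add: real_le_rsqrt)
  then show ?thesis by (simp add: L2_norm_def a_def b_def c_def real_sqrt_mult)
qed

lemma L2_Cauchy_Schwarz:
  assumes f: "f \<in> L2" and g: "g \<in> L2"
  shows "cmod (L2_inner f g) \<le> L2_norm f * L2_norm g"
proof -
  have "cmod (L2_inner f g) \<le> (LINT x|lebesgue. cmod (cnj (f x) * g x))"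
    unfolding L2_inner_def by (rule integral_norm_bound)
  also have "\<dots> = (LINT x|lebesgue. cmod (f x) * cmod (g x))" by (simp add: norm_mult)
  finally show ?thesis using L2_norm_mult_le[OF f g] by linarith
qed

lemma L2_inner_self: "f \<in> L2 \<Longrightarrow> L2_inner f f = of_real ((L2_norm f)\<^sup>2)"
proof -
  have "L2_inner f f = (LINT x|lebesgue. of_real ((cmod (f x))\<^sup>2))"
    unfolding L2_inner_def by (intro Bochner_Integration.integral_cong refl)
      (metis complex_norm_square mult.commute)
  also have "\<dots> = of_real ((L2_norm f)\<^sup>2)" by (subst integral_complex_of_real) (simp only: L2_norm_sq)
  finally show ?thesis .
qed

lemma L2_inner_cnj: "L2_inner g f = cnj (L2_inner f g)"
  unfolding L2_inner_def by (subst Bochner_Integration.integral_cnj[symmetric]) (simp add: mult.commute)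

lemma L2_inner_add_right:
  "f \<in> L2 \<Longrightarrow> g \<in> L2 \<Longrightarrow> h \<in> L2 \<Longrightarrow> L2_inner f (\<lambda>x. g x + h x) = L2_inner f g + L2_inner f h"
  by (simp add: L2_inner_def distrib_left L2_inner_integrable)

lemma L2_inner_cmult_right: "L2_inner f (\<lambda>x. c * g x) = c * L2_inner f g"
proof -
  have "L2_inner f (\<lambda>x. c * g x) = (LINT x|lebesgue. c * (cnj (f x) * g x))"
    by (simp add: L2_inner_def algebra_simps)
  then show ?thesis by (simp add: L2_inner_def)
qed

lemma L2_inner_add_left:
  "f \<in> L2 \<Longrightarrow> g \<in> L2 \<Longrightarrow> h \<in> L2 \<Longrightarrow> L2_inner (\<lambda>x. g x + h x) f = L2_inner g f + L2_inner h f"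
  using L2_inner_add_right[of f g h] by (metis L2_inner_cnj complex_cnj_add)

lemma L2_inner_cmult_left: "L2_inner (\<lambda>x. c * g x) f = cnj c * L2_inner g f"
  by (metis L2_inner_cnj L2_inner_cmult_right complex_cnj_cnj complex_cnj_mult)

lemma L2_inner_diff_right:
  "f \<in> L2 \<Longrightarrow> g \<in> L2 \<Longrightarrow> h \<in> L2 \<Longrightarrow> L2_inner f (\<lambda>x. g x - h x) = L2_inner f g - L2_inner f h"
  by (simp add: L2_inner_def right_diff_distrib L2_inner_integrable)

lemma L2_inner_diff_left:
  "f \<in> L2 \<Longrightarrow> g \<in> L2 \<Longrightarrow> h \<in> L2 \<Longrightarrow> L2_inner (\<lambda>x. g x - h x) f = L2_inner g f - L2_inner h f"
  using L2_inner_diff_right[of f g h] by (metis L2_inner_cnj complex_cnj_diff)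

lemma L2_inner_cong_AE:
  assumes "f \<in> L2" "g \<in> L2" "f' \<in> L2" "g' \<in> L2" "AE x in lebesgue. f x = f' x" "AE x in lebesgue. g x = g' x"
  shows "L2_inner f g = L2_inner f' g'"
  unfolding L2_inner_def
proof (rule integral_cong_AE)
  show "(\<lambda>x. cnj (f x) * g x) \<in> borel_measurable lebesgue" "(\<lambda>x. cnj (f' x) * g' x) \<in> borel_measurable lebesgue"
    by (intro borel_measurable_integrable L2_inner_integrable assms)+
  show "AE x in lebesgue. cnj (f x) * g x = cnj (f' x) * g' x"
    using assms(5,6) by eventually_elim simp
qed

lemma L2_norm_cong_AE:
  assumes "f \<in> L2" "f' \<in> L2" "AE x in lebesgue. f x = f' x"
  shows "L2_norm f = L2_norm f'"
proof -
  have "L2_inner f f = L2_inner f' f'" by (rule L2_inner_cong_AE) (use assms in auto)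
  then have "(L2_norm f)\<^sup>2 = (L2_norm f')\<^sup>2" using assms by (simp add: L2_inner_self flip: of_real_power)
  then show ?thesis using L2_norm_nonneg by (metis power2_eq_iff_nonneg)
qed

lemma L2_norm_eq_0_iff:
  assumes "f \<in> L2"
  shows "L2_norm f = 0 \<longleftrightarrow> (AE x in lebesgue. f x = 0)"
  using integral_nonneg_eq_0_iff_AE[OF L2_integrable[OF assms]] by (simp add: L2_norm_def)

lemma L2_norm_cmult: "L2_norm (\<lambda>x. c * f x) = cmod c * L2_norm f"
  by (simp add: L2_norm_def norm_mult power_mult_distrib real_sqrt_mult)

lemma L2_norm_minus_commute: "L2_norm (\<lambda>x. f x - g x) = L2_norm (\<lambda>x. g x - f x)"
  by (simp add: L2_norm_def norm_minus_commute)

lemma L2_norm_add_sq: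
  assumes f: "f \<in> L2" and g: "g \<in> L2"
  shows "(L2_norm (\<lambda>x. f x + g x))\<^sup>2 = (L2_norm f)\<^sup>2 + 2 * Re (L2_inner f g) + (L2_norm g)\<^sup>2"
proof -
  have "L2_inner (\<lambda>x. f x + g x) (\<lambda>x. f x + g x)
      = (L2_inner f f + L2_inner g f) + (L2_inner f g + L2_inner g g)"
    using f g by (simp add: L2_inner_add_left L2_inner_add_right L2_add)
  from arg_cong[OF this, of Re] have "(L2_norm (\<lambda>x. f x + g x))\<^sup>2
      = (L2_norm f)\<^sup>2 + Re (L2_inner g f) + (Re (L2_inner f g) + (L2_norm g)\<^sup>2)"
    using f g by (simp add: L2_inner_self L2_add)
  moreover have "Re (L2_inner g f) = Re (L2_inner f g)" by (subst L2_inner_cnj) simp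
  ultimately show ?thesis by simp
qed

lemma L2_norm_triangle:
  assumes f: "f \<in> L2" and g: "g \<in> L2"
  shows "L2_norm (\<lambda>x. f x + g x) \<le> L2_norm f + L2_norm g"
proof (rule power2_le_imp_le)
  have "Re (L2_inner f g) \<le> L2_norm f * L2_norm g"
    using L2_Cauchy_Schwarz[OF f g] complex_Re_le_cmod[of "L2_inner f g"] by linarith
  then show "(L2_norm (\<lambda>x. f x + g x))\<^sup>2 \<le> (L2_norm f + L2_norm g)\<^sup>2"
    using L2_norm_add_sq[OF f g] by (simp add: power2_sum)
qed (simp add: L2_norm_nonneg)

lemma L2_norm_triangle_diff:
  assumes "f \<in> L2" "g \<in> L2" "h \<in> L2"
  shows "L2_norm (\<lambda>x. f x - h x) \<le> L2_norm (\<lambda>x. f x - g x) + L2_norm (\<lambda>x. g x - h x)"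
  using L2_norm_triangle[OF L2_diff L2_diff, of f g g h] assms by simp

lemma L2_norm_le_add_diff:
  assumes "f \<in> L2" "g \<in> L2"
  shows "L2_norm f \<le> L2_norm g + L2_norm (\<lambda>x. f x - g x)"
  using L2_norm_triangle[OF assms(2) L2_diff[OF assms]] by simp

lemma L2_norm_tendsto:
  assumes "\<And>n. f n \<in> L2" "g \<in> L2" "((\<lambda>n. L2_norm (\<lambda>x. f n x - g x)) \<longlongrightarrow> 0) F"
  shows "((\<lambda>n. L2_norm (f n)) \<longlongrightarrow> L2_norm g) F"
proof -
  have "\<bar>L2_norm (f n) - L2_norm g\<bar> \<le> L2_norm (\<lambda>x. f n x - g x)" for n
    using L2_norm_le_add_diff[OF assms(1,2), of n] L2_norm_le_add_diff[OF assms(2,1), of n]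
    by (simp add: L2_norm_minus_commute[of g] abs_le_iff)
  then have "((\<lambda>n. L2_norm (f n) - L2_norm g) \<longlongrightarrow> 0) F"
    by (intro Lim_null_comparison[OF _ assms(3)] always_eventually allI) simp
  then show ?thesis by (simp add: LIM_zero_iff)
qed

lemma L2_inner_tendsto:
  assumes f: "\<And>n. f n \<in> L2" "f' \<in> L2" and g: "\<And>n. g n \<in> L2" "g' \<in> L2"
    and F: "((\<lambda>n. L2_norm (\<lambda>x. f n x - f' x)) \<longlongrightarrow> 0) F"
    and G: "((\<lambda>n. L2_norm (\<lambda>x. g n x - g' x)) \<longlongrightarrow> 0) F"
  shows "((\<lambda>n. L2_inner (f n) (g n)) \<longlongrightarrow> L2_inner f' g') F"
proof -
  have b: "norm (L2_inner (f n) (g n) - L2_inner f' g')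
     \<le> L2_norm (\<lambda>x. f n x - f' x) * L2_norm (g n) + L2_norm f' * L2_norm (\<lambda>x. g n x - g' x)" for n
  proof -
    have "L2_inner (f n) (g n) - L2_inner f' g'
      = L2_inner (\<lambda>x. f n x - f' x) (g n) + L2_inner f' (\<lambda>x. g n x - g' x)"
      using f g by (simp add: L2_inner_diff_left L2_inner_diff_right)
    also have "norm \<dots> \<le> L2_norm (\<lambda>x. f n x - f' x) * L2_norm (g n) + L2_norm f' * L2_norm (\<lambda>x. g n x - g' x)"
      by (rule norm_triangle_le, rule add_mono; rule L2_Cauchy_Schwarz) (use f g L2_diff in auto)
    finally show ?thesis .
  qed
  have "((\<lambda>n. L2_norm (\<lambda>x. f n x - f' x) * L2_norm (g n) + L2_norm f' * L2_norm (\<lambda>x. g n x - g' x))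
      \<longlongrightarrow> 0 * L2_norm g' + L2_norm f' * 0) F"
    by (intro tendsto_add tendsto_mult tendsto_const F G L2_norm_tendsto[OF g G])
  then have lim: "((\<lambda>n. L2_norm (\<lambda>x. f n x - f' x) * L2_norm (g n) + L2_norm f' * L2_norm (\<lambda>x. g n x - g' x))
      \<longlongrightarrow> 0) F" by simp
  have "((\<lambda>n. L2_inner (f n) (g n) - L2_inner f' g') \<longlongrightarrow> 0) F"
    by (rule Lim_null_comparison[OF always_eventually[OF allI[OF b]] lim])
  then show ?thesis by (simp add: LIM_zero_iff)
qed

lemma L2_inner_tendsto_right:
  assumes f: "f \<in> L2" and g: "\<And>n. g n \<in> L2" "g' \<in> L2"
    and G: "((\<lambda>n. L2_norm (\<lambda>x. g n x - g' x)) \<longlongrightarrow> 0) F"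
  shows "((\<lambda>n. L2_inner f (g n)) \<longlongrightarrow> L2_inner f g') F"
  by (rule L2_inner_tendsto[OF f f g _ G]) (simp add: L2_norm_def)

lemma L2_norm_tendsto_add:
  assumes f: "\<And>n. f n \<in> L2" "f' \<in> L2" and g: "\<And>n. g n \<in> L2" "g' \<in> L2"
    and F: "((\<lambda>n. L2_norm (\<lambda>x. f n x - f' x)) \<longlongrightarrow> 0) F"
    and G: "((\<lambda>n. L2_norm (\<lambda>x. g n x - g' x)) \<longlongrightarrow> 0) F"
  shows "((\<lambda>n. L2_norm (\<lambda>x. (f n x + g n x) - (f' x + g' x))) \<longlongrightarrow> 0) F"
proof (rule tendsto_sandwich[OF _ _ tendsto_const])
  show "((\<lambda>n. L2_norm (\<lambda>x. f n x - f' x) + L2_norm (\<lambda>x. g n x - g' x)) \<longlongrightarrow> 0) F"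
    using tendsto_add[OF F G] by simp
  show "\<forall>\<^sub>F n in F. L2_norm (\<lambda>x. (f n x + g n x) - (f' x + g' x))
      \<le> L2_norm (\<lambda>x. f n x - f' x) + L2_norm (\<lambda>x. g n x - g' x)"
    using L2_norm_triangle[OF L2_diff[OF f] L2_diff[OF g]] by (simp add: algebra_simps)
qed (simp add: L2_norm_nonneg)

text \<open>Used twice: for the limit in the completeness proof, and to bound the potential energy
  of a limit, where multiplication by an unbounded potential is not continuous.\<close>

lemma L2_Fatou:
  assumes f: "\<And>n. f n \<in> L2" and g: "g \<in> borel_measurable lebesgue"
    and lim: "AE x in lebesgue. (\<lambda>n. f n x) \<longlonglongrightarrow> g x" and B: "\<And>n. L2_norm (f n) \<le> B"
  shows "g \<in> L2" "L2_norm g \<le> B"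
proof -
  have B0: "B \<ge> 0" using B[of 0] L2_norm_nonneg[of "f 0"] by linarith
  have "(\<integral>\<^sup>+x. ennreal ((cmod (g x))\<^sup>2) \<partial>lebesgue) = (\<integral>\<^sup>+x. liminf (\<lambda>n. ennreal ((cmod (f n x))\<^sup>2)) \<partial>lebesgue)"
  proof (rule nn_integral_cong_AE)
    show "AE x in lebesgue. ennreal ((cmod (g x))\<^sup>2) = liminf (\<lambda>n. ennreal ((cmod (f n x))\<^sup>2))"
      using lim
    proof eventually_elim
      case (elim x)
      then have "(\<lambda>n. ennreal ((cmod (f n x))\<^sup>2)) \<longlonglongrightarrow> ennreal ((cmod (g x))\<^sup>2)"
        by (intro tendsto_intros)
      then show ?case by (metis lim_imp_Liminf sequentially_bot)
    qed
  qed
  also have "\<dots> \<le> liminf (\<lambda>n. \<integral>\<^sup>+x. ennreal ((cmod (f n x))\<^sup>2) \<partial>lebesgue)"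
    using L2_measurable[OF f] by (intro nn_integral_liminf) simp
  also have "\<dots> \<le> ennreal (B\<^sup>2)"
  proof (rule Liminf_le)
    show "\<forall>\<^sub>F n in sequentially. (\<integral>\<^sup>+x. ennreal ((cmod (f n x))\<^sup>2) \<partial>lebesgue) \<le> ennreal (B\<^sup>2)"
    proof (rule always_eventually, rule allI)
      fix n
      have "(\<integral>\<^sup>+x. ennreal ((cmod (f n x))\<^sup>2) \<partial>lebesgue) = ennreal (LINT x|lebesgue. (cmod (f n x))\<^sup>2)"
        by (rule nn_integral_eq_integral[OF L2_integrable[OF f]]) simp
      also have "\<dots> \<le> ennreal (B\<^sup>2)"
        unfolding L2_norm_sq[symmetric] by (intro ennreal_leI power_mono B L2_norm_nonneg)
      finally show "(\<integral>\<^sup>+x. ennreal ((cmod (f n x))\<^sup>2) \<partial>lebesgue) \<le> ennreal (B\<^sup>2)" .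
    qed
  qed simp
  finally have le: "(\<integral>\<^sup>+x. ennreal ((cmod (g x))\<^sup>2) \<partial>lebesgue) \<le> ennreal (B\<^sup>2)" .
  then have "integrable lebesgue (\<lambda>x. (cmod (g x))\<^sup>2)"
    using g by (intro integrableI_bounded) (auto simp: le_less_trans)
  then show "g \<in> L2" using g by (simp add: L2_def)
  have "ennreal ((L2_norm g)\<^sup>2) \<le> ennreal (B\<^sup>2)"
    using le nn_integral_eq_integral[OF \<open>integrable lebesgue (\<lambda>x. (cmod (g x))\<^sup>2)\<close>] by (simp add: L2_norm_sq)
  then have "(L2_norm g)\<^sup>2 \<le> B\<^sup>2" by simp
  then show "L2_norm g \<le> B" using B0 by (rule power2_le_imp_le)
qed

text \<open>The Riesz-Fischer theorem for sequences with geometrically decaying increments. A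
  minimising sequence can be chosen of this kind, so the general Cauchy criterion does not
  arise.\<close>

lemma L2_complete:
  assumes f: "\<And>n. f n \<in> L2" and c: "\<And>n. L2_norm (\<lambda>x. f (Suc n) x - f n x) \<le> C * (1/2) ^ n"
  obtains g where "g \<in> L2" "(\<lambda>n. L2_norm (\<lambda>x. f n x - g x)) \<longlonglongrightarrow> 0"
proof -
  define d where "d n x = f (Suc n) x - f n x" for n x
  have d: "d n \<in> L2" for n unfolding d_def by (intro L2_diff f)
  have md: "d n \<in> borel_measurable lebesgue" for n by (rule L2_measurable[OF d])
  have C: "C \<ge> 0" using c[of 0] L2_norm_nonneg[of "\<lambda>x. f (Suc 0) x - f 0 x"] by simp
  \<comment> \<open>The squared increments decay like (1/4)^n. The weight 2^n uses up half of this
    decay and leaves a summable (1/2)^n; in return it makes the increments themselves summable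
    pointwise.\<close>
  have int_d: "(\<integral>\<^sup>+x. ennreal (2 ^ n * (cmod (d n x))\<^sup>2) \<partial>lebesgue) \<le> ennreal (C\<^sup>2 * (1/2) ^ n)" for n
  proof -
    have "(\<integral>\<^sup>+x. ennreal (2 ^ n * (cmod (d n x))\<^sup>2) \<partial>lebesgue) = ennreal (LINT x|lebesgue. 2 ^ n * (cmod (d n x))\<^sup>2)"
      by (rule nn_integral_eq_integral) (use L2_integrable[OF d] in auto)
    also have "(LINT x|lebesgue. 2 ^ n * (cmod (d n x))\<^sup>2) = 2 ^ n * (L2_norm (d n))\<^sup>2"
      by (simp add: L2_norm_sq)
    also have "\<dots> \<le> 2 ^ n * (C * (1/2) ^ n)\<^sup>2"
      using c[of n] by (intro mult_left_mono power_mono) (auto simp: L2_norm_nonneg d_def[abs_def])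
    also have "\<dots> = C\<^sup>2 * (1/2) ^ n"
      by (simp add: power2_eq_square field_simps power_mult_distrib)
    finally show ?thesis by (simp add: ennreal_leI)
  qed
  have sumC: "summable (\<lambda>n. C\<^sup>2 * (1/2::real) ^ n)" by (intro summable_mult summable_geometric) simp
  have "(\<integral>\<^sup>+x. (\<Sum>n. ennreal (2 ^ n * (cmod (d n x))\<^sup>2)) \<partial>lebesgue)
      = (\<Sum>n. \<integral>\<^sup>+x. ennreal (2 ^ n * (cmod (d n x))\<^sup>2) \<partial>lebesgue)"
    using md by (intro nn_integral_suminf) simp
  also have "\<dots> \<le> (\<Sum>n. ennreal (C\<^sup>2 * (1/2) ^ n))" by (intro suminf_le int_d) auto
  also have "\<dots> = ennreal (\<Sum>n. C\<^sup>2 * (1/2) ^ n)" using sumC by (intro suminf_ennreal2) auto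
  also have "\<dots> < \<infinity>" by simp
  finally have "(\<integral>\<^sup>+x. (\<Sum>n. ennreal (2 ^ n * (cmod (d n x))\<^sup>2)) \<partial>lebesgue) \<noteq> \<infinity>"
    by (rule less_imp_neq)
  then have "AE x in lebesgue. (\<Sum>n. ennreal (2 ^ n * (cmod (d n x))\<^sup>2)) \<noteq> \<infinity>"
    using md by (intro nn_integral_PInf_AE) auto
  then have conv: "AE x in lebesgue. convergent (\<lambda>n. f n x)"
  proof eventually_elim
    case (elim x)
    then have s: "summable (\<lambda>n. 2 ^ n * (cmod (d n x))\<^sup>2)"
      by (intro summable_suminf_not_top) auto
    have "summable (\<lambda>n. 2 ^ n * (cmod (d n x))\<^sup>2 + (1/2) ^ n)"
      by (intro summable_add s summable_geometric) simp
    moreover have "norm (d n x) \<le> 2 ^ n * (cmod (d n x))\<^sup>2 + (1/2) ^ n" for n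
    proof -
      define s where "s = sqrt (2 ^ n)"
      have s: "s > 0" "s\<^sup>2 = 2 ^ n" by (auto simp: s_def)
      \<comment> \<open>Splitting the weight evenly between both factors bounds |d| by 2^n |d|^2 +
        (1/2)^n, both summable.\<close>
      have "2 * (s * cmod (d n x)) * (1 / s) \<le> (s * cmod (d n x))\<^sup>2 + (1 / s)\<^sup>2"
        by (rule sum_squares_bound)
      then have "2 * cmod (d n x) \<le> 2 ^ n * (cmod (d n x))\<^sup>2 + (1/2) ^ n"
        using s(1) by (simp add: power_mult_distrib s(2) power_divide)
      then show ?thesis using norm_ge_zero[of "d n x"] by linarith
    qed
    ultimately have "summable (\<lambda>n. d n x)" by (rule summable_comparison_test'[where N=0])
    then have "convergent (\<lambda>n. \<Sum>k<n. d k x)" by (simp add: summable_iff_convergent)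
    moreover have "(\<Sum>k<n. d k x) = f n x - f 0 x" for n
      unfolding d_def by (rule sum_lessThan_telescope)
    ultimately have "convergent (\<lambda>n. f n x - f 0 x)" by simp
    then have "convergent (\<lambda>n. (f n x - f 0 x) + f 0 x)"
      by (intro convergent_add convergent_const)
    then show ?case by simp
  qed
  define g where "g x = lim (\<lambda>n. f n x)" for x
  have mg: "g \<in> borel_measurable lebesgue"
    unfolding g_def using L2_measurable[OF f] by (rule borel_measurable_lim_metric)
  have tail: "L2_norm (\<lambda>x. f (n + m) x - f n x) \<le> C * 2 * (1/2) ^ n" for n m
  proof -
    \<comment> \<open>The factor \<open>1 - (1/2) ^ m\<close> records the geometric partial sum;
      without it the induction would not close.\<close>
    have "L2_norm (\<lambda>x. f (n + m) x - f n x) \<le> C * 2 * (1/2) ^ n * (1 - (1/2) ^ m)"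
    proof (induction m)
      case 0
      then show ?case by (simp add: L2_norm_def)
    next
      case (Suc m)
      have "L2_norm (\<lambda>x. f (n + Suc m) x - f n x)
         \<le> L2_norm (\<lambda>x. f (n + Suc m) x - f (n + m) x) + L2_norm (\<lambda>x. f (n + m) x - f n x)"
        by (rule L2_norm_triangle_diff) (rule f)+
      also have "\<dots> \<le> C * (1/2) ^ (n + m) + C * 2 * (1/2) ^ n * (1 - (1/2) ^ m)"
        using c[of "n + m"] Suc by simp
      also have "\<dots> = C * 2 * (1/2) ^ n * (1 - (1/2) ^ Suc m)"
        by (simp add: power_add field_simps)
      finally show ?case .
    qed
    also have "\<dots> \<le> C * 2 * (1/2) ^ n"
      using C by (intro mult_left_le) auto
    finally show ?thesis .
  qed
  have lim: "AE x in lebesgue. (\<lambda>n. f n x) \<longlonglongrightarrow> g x"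
    using conv by eventually_elim (simp add: g_def convergent_LIMSEQ_iff)
  have fat: "(\<lambda>x. g x - f n x) \<in> L2" "L2_norm (\<lambda>x. g x - f n x) \<le> C * 2 * (1/2) ^ n" for n
  proof -
    have m: "(\<lambda>x. g x - f n x) \<in> borel_measurable lebesgue"
      using mg L2_measurable[OF f] by (rule borel_measurable_diff)
    have l: "AE x in lebesgue. (\<lambda>m. f (n + m) x - f n x) \<longlonglongrightarrow> g x - f n x"
      using lim
    proof eventually_elim
      case (elim x)
      from LIMSEQ_ignore_initial_segment[OF this, of n]
      show ?case by (intro tendsto_intros) (simp add: add.commute)
    qed
    show "(\<lambda>x. g x - f n x) \<in> L2" "L2_norm (\<lambda>x. g x - f n x) \<le> C * 2 * (1/2) ^ n"
      using L2_Fatou[OF L2_diff[OF f f] m l tail] by blast+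
  qed
  have "g \<in> L2" using L2_add[OF fat(1)[of 0] f[of 0]] by simp
  moreover have "(\<lambda>n. L2_norm (\<lambda>x. f n x - g x)) \<longlonglongrightarrow> 0"
  proof (rule tendsto_sandwich[OF _ _ tendsto_const])
    show "(\<lambda>n. C * 2 * (1/2) ^ n) \<longlonglongrightarrow> (0::real)"
      by (intro tendsto_mult_right_zero LIMSEQ_realpow_zero) auto
    show "\<forall>\<^sub>F n in sequentially. L2_norm (\<lambda>x. f n x - g x) \<le> C * 2 * (1/2) ^ n"
      using fat(2) by (simp add: L2_norm_minus_commute[of g])
  qed (simp add: L2_norm_nonneg)
  ultimately show ?thesis using that by blast
qed

lemma L2_AE_subseq:
  assumes f: "\<And>n. f n \<in> L2" "g \<in> L2" and lim: "(\<lambda>n. L2_norm (\<lambda>x. f n x - g x)) \<longlonglongrightarrow> 0"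
  obtains r :: "nat \<Rightarrow> nat" where "strict_mono r" "AE x in lebesgue. (\<lambda>n. f (r n) x) \<longlonglongrightarrow> g x"
proof -
  have "(\<lambda>n. (L2_norm (\<lambda>x. f n x - g x))\<^sup>2) \<longlonglongrightarrow> 0\<^sup>2" by (intro tendsto_intros lim)
  then have "(\<lambda>n. LINT x|lebesgue. norm ((cmod (f n x - g x))\<^sup>2)) \<longlonglongrightarrow> 0"
    by (simp add: L2_norm_sq)
  moreover have "integrable lebesgue (\<lambda>x. (cmod (f n x - g x))\<^sup>2)" for n
    by (rule L2_integrable[OF L2_diff[OF f]])
  ultimately obtain r :: "nat \<Rightarrow> nat" where r: "strict_mono r"
      "AE x in lebesgue. (\<lambda>n. (cmod (f (r n) x - g x))\<^sup>2) \<longlonglongrightarrow> 0"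
    using tendsto_L1_AE_subseq[of lebesgue "\<lambda>n x. (cmod (f n x - g x))\<^sup>2"] by blast
  have "AE x in lebesgue. (\<lambda>n. f (r n) x) \<longlonglongrightarrow> g x"
    using r(2)
  proof eventually_elim
    case (elim x)
    from tendsto_real_sqrt[OF elim] have "(\<lambda>n. cmod (f (r n) x - g x)) \<longlonglongrightarrow> 0" by simp
    then show ?case by (simp add: tendsto_norm_zero_iff LIM_zero_iff)
  qed
  then show ?thesis using that r(1) by blast
qed

lemma test_functions_L2:
  assumes "\<phi> \<in> test_functions"
  shows "\<phi> \<in> L2"
proof -
  have c: "continuous_on UNIV \<phi>" by (rule Ck_imp_continuous[OF test_functions_Ck[OF assms]])
  have "integrable lebesgue (\<lambda>x. (cmod (\<phi> x))\<^sup>2)"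
  proof (rule integrable_continuous_compact_supp)
    show "continuous_on UNIV (\<lambda>x. (cmod (\<phi> x))\<^sup>2)" by (intro continuous_intros c)
    show "compact (supp (\<lambda>x. (cmod (\<phi> x))\<^sup>2))" using test_functions_compact[OF assms] by simp
  qed
  then show ?thesis using continuous_measurable_lebesgue[OF c] by (simp add: L2_def)
qed

lemma L2_imp_L1_loc:
  fixes f :: "real^'d::finite \<Rightarrow> complex"
  assumes f: "f \<in> L2"
  shows "L1_loc f"
  unfolding L1_loc_def set_integrable_def
proof safe
  fix K :: "(real^'d) set" assume K: "compact K"
  have "(\<lambda>x. indicator K x) \<in> L2"
  proof -
    have "integrable lebesgue (\<lambda>x. indicator K x *\<^sub>R (1::real))" by (rule L1_locD[OF L1_loc_const K])
    moreover have "(indicator K :: _ \<Rightarrow> complex) \<in> borel_measurable lebesgue"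
      using K by (simp add: borel_measurable_indicator compact_imp_closed)
    ultimately show ?thesis
      by (intro L2_dominated[of "indicator K"]) (assumption+, simp add: indicator_def)
  qed
  from L2_prod_integrable(2)[OF this f] show "integrable lebesgue (\<lambda>x. indicator K x *\<^sub>R f x)"
    by (simp add: scaleR_conv_of_real of_real_indicator)
qed

section \<open>Limits of test functions in the first Sobolev space\<close>

lemma partial_deriv_cmult:
  fixes \<phi> :: "real^'d::finite \<Rightarrow> complex"
  shows "\<phi> \<in> test_functions \<Longrightarrow> partial_deriv i (\<lambda>x. c * \<phi> x) = (\<lambda>x. c * partial_deriv i \<phi> x)"
  by (rule ext, rule partial_deriv_bounded_linear_compose[OF bounded_linear_mult_right test_functions_differentiable])

lemma partial_deriv_add_test:
  "\<phi> \<in> test_functions \<Longrightarrow> \<eta> \<in> test_functions \<Longrightarrow>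
    partial_deriv i (\<lambda>x. \<phi> x + \<eta> x) = (\<lambda>x. partial_deriv i \<phi> x + partial_deriv i \<eta> x)"
  by (rule ext, rule partial_deriv_add; rule test_functions_differentiable)

lemma test_functions_cmult:
  fixes \<phi> :: "real^'d::finite \<Rightarrow> complex"
  shows "\<phi> \<in> test_functions \<Longrightarrow> (\<lambda>x. c * \<phi> x) \<in> test_functions"
  by (rule test_functions_linear[OF bounded_linear_mult_right])

lemma test_functions_of_real:
  fixes \<phi> :: "real^'d::finite \<Rightarrow> real"
  assumes "\<phi> \<in> test_functions"
  shows "(\<lambda>x. complex_of_real (\<phi> x)) \<in> test_functions"
    and "partial_deriv i (\<lambda>x. complex_of_real (\<phi> x)) x = of_real (partial_deriv i \<phi> x)"
  by (rule test_functions_linear[OF bounded_linear_of_real assms])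
    (rule partial_deriv_bounded_linear_compose[OF bounded_linear_of_real test_functions_differentiable[OF assms]])

lemma test_functions_integrable:
  fixes \<phi> :: "real^'d::finite \<Rightarrow> 'b::euclidean_space"
  shows "\<phi> \<in> test_functions \<Longrightarrow> integrable lebesgue \<phi>"
  by (rule integrable_continuous_compact_supp[OF Ck_imp_continuous[OF test_functions_Ck] test_functions_compact])

lemma test_functions_by_parts:
  fixes \<phi> \<eta> :: "real^'d::finite \<Rightarrow> complex"
  assumes \<phi>: "\<phi> \<in> test_functions" and \<eta>: "\<eta> \<in> test_functions"
  shows "(LINT x|lebesgue. partial_deriv i \<phi> x * \<eta> x) = - (LINT x|lebesgue. \<phi> x * partial_deriv i \<eta> x)"
proof -
  have t: "(\<lambda>x. \<phi> x * \<eta> x) \<in> test_functions"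
    by (rule test_functions_bilinear_left[OF bounded_bilinear_mult \<phi> test_functions_Ck[OF \<eta>]])
  note int = L2_prod_integrable(2)[OF test_functions_L2 test_functions_L2]
  have "0 = (LINT x|lebesgue. partial_deriv i (\<lambda>x. \<phi> x * \<eta> x) x)"
    by (rule integral_partial_deriv_eq_0[symmetric]) (use t in \<open>auto simp: test_functions_def simp del: Ck.simps\<close>)
  also have "\<dots> = (LINT x|lebesgue. \<phi> x * partial_deriv i \<eta> x + partial_deriv i \<phi> x * \<eta> x)"
    by (intro Bochner_Integration.integral_cong refl partial_deriv_bilinear[OF bounded_bilinear_mult]
        test_functions_differentiable \<phi> \<eta>)
  also have "\<dots> = (LINT x|lebesgue. \<phi> x * partial_deriv i \<eta> x) + (LINT x|lebesgue. partial_deriv i \<phi> x * \<eta> x)"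
    by (intro Bochner_Integration.integral_add int test_functions_partial_deriv \<phi> \<eta>)
  finally show ?thesis by (simp add: eq_neg_iff_add_eq_0 add.commute)
qed

text \<open>Membership of \<open>u\<close> in the H1-closure of the test functions, with
  \<open>g\<close> as its gradient. The approximating sequence is an argument of the predicate
  because energy bounds are stated for its members.\<close>

definition H1_limit ::
  "(nat \<Rightarrow> real^'d::finite \<Rightarrow> complex) \<Rightarrow> (real^'d \<Rightarrow> complex) \<Rightarrow> (real^'d \<Rightarrow> complex^'d) \<Rightarrow> bool" where
  "H1_limit \<phi> u g \<longleftrightarrow> (\<forall>n. \<phi> n \<in> test_functions) \<and> u \<in> L2 \<and> (\<forall>i. (\<lambda>x. g x $ i) \<in> L2) \<and>
     (\<lambda>n. L2_norm (\<lambda>x. \<phi> n x - u x)) \<longlonglongrightarrow> 0 \<and>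
     (\<forall>i. (\<lambda>n. L2_norm (\<lambda>x. partial_deriv i (\<phi> n) x - g x $ i)) \<longlonglongrightarrow> 0)"

lemma H1_limitD:
  assumes "H1_limit \<phi> u g"
  shows "\<phi> n \<in> test_functions" "u \<in> L2" "(\<lambda>x. g x $ i) \<in> L2"
    "(\<lambda>n. L2_norm (\<lambda>x. \<phi> n x - u x)) \<longlonglongrightarrow> 0"
    "(\<lambda>n. L2_norm (\<lambda>x. partial_deriv i (\<phi> n) x - g x $ i)) \<longlonglongrightarrow> 0"
  using assms unfolding H1_limit_def by blast+

lemma integrable_vec:
  fixes f :: "'a \<Rightarrow> 'b::euclidean_space^'n"
  assumes "\<And>i. integrable M (\<lambda>x. f x $ i)"
  shows "integrable M f"
proof -
  have lin: "bounded_linear (axis i :: 'b \<Rightarrow> 'b^'n)" for i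
    by (intro linear_conv_bounded_linear[THEN iffD1] linearI) (auto simp: axis_def vec_eq_iff)
  have "integrable M (\<lambda>x. \<Sum>i\<in>UNIV. axis i (f x $ i))"
    by (intro Bochner_Integration.integrable_sum integrable_bounded_linear[OF lin] assms)
  moreover have "(\<Sum>i\<in>UNIV. axis i (f x $ i)) = f x" for x
    by (simp add: vec_eq_iff axis_def if_distrib[of "\<lambda>f. f _"] cong: if_cong)
  ultimately show ?thesis by simp
qed

lemma L1_loc_vec:
  fixes g :: "real^'d::finite \<Rightarrow> 'b::euclidean_space^'d"
  assumes "\<And>i. L1_loc (\<lambda>x. g x $ i)"
  shows "L1_loc g"
  unfolding L1_loc_def set_integrable_def
proof safe
  fix K :: "(real^'d) set" assume K: "compact K"
  show "integrable lebesgue (\<lambda>x. indicator K x *\<^sub>R g x)"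
    by (rule integrable_vec) (use L1_locD[OF assms K] in simp)
qed

lemma H1_limit_weak_gradient:
  assumes H: "H1_limit \<phi> u g"
  shows "weak_gradient u g"
  unfolding weak_gradient_def
proof (intro conjI ballI allI)
  show "L1_loc u" by (rule L2_imp_L1_loc[OF H1_limitD(2)[OF H]])
  show "L1_loc g" by (intro L1_loc_vec L2_imp_L1_loc H1_limitD(3)[OF H])
  fix \<theta> :: "real^'a \<Rightarrow> real" and i assume \<theta>: "\<theta> \<in> test_functions"
  define T where "T x = complex_of_real (\<theta> x)" for x
  have T: "T \<in> test_functions" "partial_deriv i T x = of_real (partial_deriv i \<theta> x)" for x
    using test_functions_of_real[OF \<theta>] by (auto simp: T_def[abs_def])
  note dT = test_functions_partial_deriv[OF T(1)]
  have \<phi>: "\<phi> n \<in> test_functions" for n by (rule H1_limitD(1)[OF H])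
  have "(\<lambda>n. L2_inner (partial_deriv i T) (\<phi> n)) \<longlonglongrightarrow> L2_inner (partial_deriv i T) u"
    by (intro L2_inner_tendsto_right test_functions_L2 dT \<phi> H1_limitD[OF H])
  moreover have "(\<lambda>n. - L2_inner T (partial_deriv i (\<phi> n))) \<longlonglongrightarrow> - L2_inner T (\<lambda>x. g x $ i)"
    by (intro tendsto_minus L2_inner_tendsto_right test_functions_L2 test_functions_partial_deriv T(1) \<phi> H1_limitD[OF H])
  moreover have "L2_inner (partial_deriv i T) (\<phi> n) = - L2_inner T (partial_deriv i (\<phi> n))" for n
    using test_functions_by_parts[OF T(1) \<phi>, of i n] by (simp add: L2_inner_def T(2)) (simp add: T_def)
  ultimately have "L2_inner (partial_deriv i T) u = - L2_inner T (\<lambda>x. g x $ i)"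
    by (simp add: LIMSEQ_unique)
  then show "(LINT x|lebesgue. partial_deriv i \<theta> x *\<^sub>R u x) = - (LINT x|lebesgue. \<theta> x *\<^sub>R g x $ i)"
    by (simp add: L2_inner_def T(2) scaleR_conv_of_real) (simp add: T_def)
qed

text \<open>Weak gradients are defined with real test functions, whereas the domain of the
  Hamiltonian consists of complex ones; real and imaginary parts are tested separately.\<close>

lemma weak_gradient_complex_test:
  fixes u :: "real^'d::finite \<Rightarrow> complex"
  assumes w: "weak_gradient u g" and \<phi>: "\<phi> \<in> test_functions"
  shows "L2_inner (partial_deriv i \<phi>) u = - L2_inner \<phi> (\<lambda>x. g x $ i)"
proof -
  have int: "integrable lebesgue (\<lambda>x. \<theta> x *\<^sub>R h x)" if "\<theta> \<in> test_functions" "L1_loc h"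
    for \<theta> :: "real^'d \<Rightarrow> real" and h :: "real^'d \<Rightarrow> complex"
    by (rule integrable_bilinear_L1_loc[OF bounded_bilinear_scaleR that(2)
          Ck_imp_continuous[OF test_functions_Ck[OF that(1)]] test_functions_compact[OF that(1)]])
  have L: "L1_loc u" "L1_loc (\<lambda>x. g x $ i)"
    using w L1_loc_bounded_linear[OF bounded_linear_vec_nth] unfolding weak_gradient_def by auto
  define a b where "a x = Re (\<phi> x)" and "b x = Im (\<phi> x)" for x
  have ab: "a \<in> test_functions" "b \<in> test_functions"
    unfolding a_def b_def by (rule test_functions_linear[OF bounded_linear_Re \<phi>], rule test_functions_linear[OF bounded_linear_Im \<phi>])
  have da: "partial_deriv i a x = Re (partial_deriv i \<phi> x)" "partial_deriv i b x = Im (partial_deriv i \<phi> x)" for x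
    unfolding a_def b_def using partial_deriv_bounded_linear_compose[OF bounded_linear_Re test_functions_differentiable[OF \<phi>]]
      partial_deriv_bounded_linear_compose[OF bounded_linear_Im test_functions_differentiable[OF \<phi>]] by auto
  have c: "cnj z * y = Re z *\<^sub>R y - \<i> * (Im z *\<^sub>R y)" for z y :: complex
    by (simp add: complex_eq_iff algebra_simps)
  have "L2_inner (partial_deriv i \<phi>) u
     = (LINT x|lebesgue. partial_deriv i a x *\<^sub>R u x) - \<i> * (LINT x|lebesgue. partial_deriv i b x *\<^sub>R u x)"
    unfolding L2_inner_def c da[symmetric]
    by (subst Bochner_Integration.integral_diff)
      (auto simp only: integral_mult_right_zero intro!: integrable_mult_right int test_functions_partial_deriv ab L)
  also have "\<dots> = - ((LINT x|lebesgue. a x *\<^sub>R (g x $ i)) - \<i> * (LINT x|lebesgue. b x *\<^sub>R (g x $ i)))"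
    using w ab unfolding weak_gradient_def by simp
  also have "\<dots> = - L2_inner \<phi> (\<lambda>x. g x $ i)"
    unfolding L2_inner_def c a_def[symmetric] b_def[symmetric]
    by (subst Bochner_Integration.integral_diff)
      (auto simp only: integral_mult_right_zero intro!: integrable_mult_right int ab L)
  finally show ?thesis .
qed

section \<open>Adjoints and closures of operator graphs\<close>

text \<open>The defining identity of the adjoint survives the limits that form the closure. An
  adjoint pair found by testing with test functions thereby enters the adjoint of the closure, which
  essential self-adjointness identifies with the closure itself.\<close>

lemma graph_adjoint_closure:
  assumes A: "A \<subseteq> L2 \<times> L2" and fg: "(f, g) \<in> graph_adjoint A"
  shows "(f, g) \<in> graph_adjoint (graph_closure A)"
proof -
  have fg': "f \<in> L2" "g \<in> L2" "\<And>u v. (u, v) \<in> A \<Longrightarrow> L2_inner f v = L2_inner g u"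
    using fg unfolding graph_adjoint_def by auto
  have "L2_inner f v = L2_inner g u" if uv: "(u, v) \<in> graph_closure A" for u v
  proof -
    obtain p q where pq: "\<And>n::nat. (p n, q n) \<in> A" "(\<lambda>n. L2_norm (\<lambda>x. p n x - u x)) \<longlonglongrightarrow> 0"
        "(\<lambda>n. L2_norm (\<lambda>x. q n x - v x)) \<longlonglongrightarrow> 0" "u \<in> L2" "v \<in> L2"
      using uv unfolding graph_closure_def by auto
    have L: "p n \<in> L2" "q n \<in> L2" for n using A pq(1)[of n] by auto
    have "(\<lambda>n. L2_inner f (q n)) \<longlonglongrightarrow> L2_inner f v" "(\<lambda>n. L2_inner g (p n)) \<longlonglongrightarrow> L2_inner g u"
      by (intro L2_inner_tendsto_right fg' L pq)+
    then show ?thesis using fg'(3)[OF pq(1)] by (simp add: LIMSEQ_unique)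
  qed
  then show ?thesis using fg' unfolding graph_adjoint_def by auto
qed

section \<open>The energy form of the Hamiltonian\<close>

text \<open>The shift \<open>c\<close> makes H + c at least 1 as a quadratic form, so that the
  energy norm dominates the L2 norm.\<close>

locale energy_form =
  fixes V :: "real^'d::finite \<Rightarrow> real" and c :: real
  assumes V_cont: "continuous_on UNIV V"
    and V_lower: "1 \<le> V x + c"
    and esa: "essentially_self_adjoint (hamiltonian V)"
begin

definition Ham :: "(real^'d \<Rightarrow> complex) \<Rightarrow> real^'d \<Rightarrow> complex" where
  "Ham \<phi> x = - (1/2) * laplacian \<phi> x + complex_of_real (V x) * \<phi> x"

definition Bop :: "(real^'d \<Rightarrow> complex) \<Rightarrow> real^'d \<Rightarrow> complex" where
  "Bop \<phi> x = Ham \<phi> x + of_real c * \<phi> x"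

text \<open>With the square root of the shifted potential, the potential part of the form becomes an
  L2 inner product, to which Cauchy-Schwarz applies.\<close>

definition root_W :: "real^'d \<Rightarrow> complex" where
  "root_W x = of_real (sqrt (V x + c))"

definition form :: "(real^'d \<Rightarrow> complex) \<Rightarrow> real" where
  "form \<phi> = Re (L2_inner (Bop \<phi>) \<phi>)"

lemma hamiltonian_eq: "hamiltonian V = {(\<phi>, Ham \<phi>) | \<phi>. \<phi> \<in> test_functions}"
  by (simp add: hamiltonian_def Ham_def[abs_def])

lemma laplacian_test: "\<phi> \<in> test_functions \<Longrightarrow> laplacian \<phi> \<in> test_functions"
  for \<phi> :: "real^'d \<Rightarrow> complex"
  unfolding laplacian_def[abs_def] by (intro test_functions_sum test_functions_partial_deriv)

lemma continuous_mult_test_L2: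
  fixes m :: "real^'d \<Rightarrow> complex"
  assumes m: "continuous_on UNIV m" and \<phi>: "\<phi> \<in> test_functions"
  shows "(\<lambda>x. m x * \<phi> x) \<in> L2"
proof -
  have c: "continuous_on UNIV (\<lambda>x. m x * \<phi> x)"
    by (intro continuous_intros m Ck_imp_continuous[OF test_functions_Ck[OF \<phi>]])
  have s: "compact (supp (\<lambda>x. m x * \<phi> x))"
    by (rule compact_supp[OF test_functions_compact[OF \<phi>] supp_mono]) simp
  have "supp (\<lambda>x. (cmod (m x * \<phi> x))\<^sup>2) \<subseteq> supp (\<lambda>x. m x * \<phi> x)"
    by (rule supp_mono) simp
  then have "integrable lebesgue (\<lambda>x. (cmod (m x * \<phi> x))\<^sup>2)"
    by (intro integrable_continuous_compact_supp compact_supp[OF s] continuous_intros c)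
  then show ?thesis using continuous_measurable_lebesgue[OF c] by (simp add: L2_def)
qed

lemma root_W_cont: "continuous_on UNIV root_W"
  unfolding root_W_def by (intro continuous_intros V_cont)

lemma Ham_L2: "\<phi> \<in> test_functions \<Longrightarrow> Ham \<phi> \<in> L2"
  unfolding Ham_def[abs_def]
  by (intro L2_add L2_cmult test_functions_L2[OF laplacian_test] continuous_mult_test_L2 continuous_intros V_cont)

lemma Bop_L2: "\<phi> \<in> test_functions \<Longrightarrow> Bop \<phi> \<in> L2"
  unfolding Bop_def[abs_def] by (intro L2_add L2_cmult Ham_L2 test_functions_L2)

lemma hamiltonian_L2: "hamiltonian V \<subseteq> L2 \<times> L2"
  using Ham_L2 test_functions_L2 by (auto simp: hamiltonian_eq)

lemma Bop_add: "\<phi> \<in> test_functions \<Longrightarrow> \<eta> \<in> test_functions \<Longrightarrow> Bop (\<lambda>x. \<phi> x + \<eta> x) = (\<lambda>x. Bop \<phi> x + Bop \<eta> x)"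
  unfolding Bop_def[abs_def] Ham_def[abs_def] laplacian_def[abs_def]
  by (simp add: partial_deriv_add_test test_functions_partial_deriv sum.distrib algebra_simps fun_eq_iff)

lemma Bop_cmult: "\<phi> \<in> test_functions \<Longrightarrow> Bop (\<lambda>x. a * \<phi> x) = (\<lambda>x. a * Bop \<phi> x)"
  unfolding Bop_def[abs_def] Ham_def[abs_def] laplacian_def[abs_def]
  by (simp add: partial_deriv_cmult test_functions_partial_deriv sum_distrib_left algebra_simps fun_eq_iff)

text \<open>The weak form of the operator: one derivative is moved to \<open>u\<close>, and the
  result makes sense for every \<open>u\<close> of finite energy, in or out of the operator
  domain.\<close>

lemma Bop_form:
  assumes \<phi>: "\<phi> \<in> test_functions" and u: "u \<in> L2" "weak_gradient u g"
    and g: "\<And>i. (\<lambda>x. g x $ i) \<in> L2" and Wu: "(\<lambda>x. root_W x * u x) \<in> L2"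
  shows "L2_inner (Bop \<phi>) u = (1/2) * (\<Sum>i\<in>UNIV. L2_inner (partial_deriv i \<phi>) (\<lambda>x. g x $ i))
     + L2_inner (\<lambda>x. root_W x * \<phi> x) (\<lambda>x. root_W x * u x)"
proof -
  let ?d = "\<lambda>i. partial_deriv i (partial_deriv i \<phi>)"
  note t = test_functions_partial_deriv
  have d2: "?d i \<in> L2" for i by (intro test_functions_L2 t \<phi>)
  have W\<phi>: "(\<lambda>x. root_W x * \<phi> x) \<in> L2" by (rule continuous_mult_test_L2[OF root_W_cont \<phi>])
  have rr: "cnj (root_W x) * root_W x = of_real (V x + c)" for x
    using V_lower[of x] by (simp add: root_W_def flip: of_real_mult)
  have eq: "cnj (Bop \<phi> x) * u x = - (1/2) * (\<Sum>i\<in>UNIV. cnj (?d i x) * u x)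
      + cnj (root_W x * \<phi> x) * (root_W x * u x)" for x
  proof -
    have "cnj (root_W x * \<phi> x) * (root_W x * u x) = of_real (V x + c) * (cnj (\<phi> x) * u x)"
      unfolding rr[symmetric] by simp
    then show ?thesis
      by (simp add: Bop_def Ham_def laplacian_def sum_distrib_left sum_distrib_right algebra_simps)
  qed
  have "L2_inner (Bop \<phi>) u = (LINT x|lebesgue. - (1/2) * (\<Sum>i\<in>UNIV. cnj (?d i x) * u x)
      + cnj (root_W x * \<phi> x) * (root_W x * u x))"
    unfolding L2_inner_def eq ..
  also have "\<dots> = - (1/2) * (\<Sum>i\<in>UNIV. L2_inner (?d i) u) + L2_inner (\<lambda>x. root_W x * \<phi> x) (\<lambda>x. root_W x * u x)"
    using L2_inner_integrable[OF d2 u(1)] L2_inner_integrable[OF W\<phi> Wu]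
    by (simp only: L2_inner_def Bochner_Integration.integral_add Bochner_Integration.integral_sum
        Bochner_Integration.integrable_sum integrable_mult_right integral_mult_right_zero)
  also have "(\<Sum>i\<in>UNIV. L2_inner (?d i) u) = - (\<Sum>i\<in>UNIV. L2_inner (partial_deriv i \<phi>) (\<lambda>x. g x $ i))"
    by (simp add: weak_gradient_complex_test[OF u(2) t[OF \<phi>]] sum_negf)
  finally show ?thesis by simp
qed

lemma test_weak_gradient:
  assumes "\<phi> \<in> test_functions"
  shows "weak_gradient \<phi> (\<lambda>x. \<chi> i. partial_deriv i \<phi> x)"
  by (rule H1_limit_weak_gradient[of "\<lambda>n. \<phi>"])
    (simp add: H1_limit_def assms test_functions_L2 test_functions_partial_deriv L2_norm_def)

lemma Bop_form_test:
  assumes \<phi>: "\<phi> \<in> test_functions" and \<eta>: "\<eta> \<in> test_functions"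
  shows "L2_inner (Bop \<phi>) \<eta> = (1/2) * (\<Sum>i\<in>UNIV. L2_inner (partial_deriv i \<phi>) (partial_deriv i \<eta>))
     + L2_inner (\<lambda>x. root_W x * \<phi> x) (\<lambda>x. root_W x * \<eta> x)"
  using Bop_form[OF \<phi> test_functions_L2[OF \<eta>] test_weak_gradient[OF \<eta>]]
  by (simp add: test_functions_L2 test_functions_partial_deriv \<eta> continuous_mult_test_L2[OF root_W_cont \<eta>])

lemma Bop_symmetric:
  assumes \<phi>: "\<phi> \<in> test_functions" and \<eta>: "\<eta> \<in> test_functions"
  shows "L2_inner (Bop \<phi>) \<eta> = cnj (L2_inner (Bop \<eta>) \<phi>)"
  unfolding Bop_form_test[OF \<phi> \<eta>] Bop_form_test[OF \<eta> \<phi>]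
  by (simp flip: L2_inner_cnj)

lemma form_eq:
  assumes \<phi>: "\<phi> \<in> test_functions"
  shows "form \<phi> = (1/2) * (\<Sum>i\<in>UNIV. (L2_norm (partial_deriv i \<phi>))\<^sup>2) + (L2_norm (\<lambda>x. root_W x * \<phi> x))\<^sup>2"
proof -
  have "L2_inner (Bop \<phi>) \<phi> = of_real ((1/2) * (\<Sum>i\<in>UNIV. (L2_norm (partial_deriv i \<phi>))\<^sup>2) + (L2_norm (\<lambda>x. root_W x * \<phi> x))\<^sup>2)"
    unfolding Bop_form_test[OF \<phi> \<phi>]
    by (simp add: L2_inner_self test_functions_L2 test_functions_partial_deriv \<phi> continuous_mult_test_L2[OF root_W_cont \<phi>])
  then show ?thesis by (simp add: form_def)
qed

lemma root_W_ge_1: "cmod (root_W x) \<ge> 1"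
  using V_lower[of x] by (simp add: root_W_def)

lemma L2_norm_le_root_W:
  assumes "u \<in> L2" "(\<lambda>x. root_W x * u x) \<in> L2"
  shows "L2_norm u \<le> L2_norm (\<lambda>x. root_W x * u x)"
proof -
  have "(cmod (u x))\<^sup>2 \<le> (cmod (root_W x * u x))\<^sup>2" for x
    using mult_right_mono[OF root_W_ge_1[of x] norm_ge_zero[of "u x"]]
    by (intro power_mono) (auto simp: norm_mult)
  then show ?thesis unfolding L2_norm_def
    by (intro real_sqrt_le_mono integral_mono L2_integrable assms)
qed

lemma form_bounds:
  assumes \<phi>: "\<phi> \<in> test_functions"
  shows "0 \<le> form \<phi>" "L2_norm (partial_deriv i \<phi>) \<le> sqrt (2 * form \<phi>)"
    "L2_norm (\<lambda>x. root_W x * \<phi> x) \<le> sqrt (form \<phi>)" "L2_norm \<phi> \<le> sqrt (form \<phi>)"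
proof -
  have s: "(\<Sum>i\<in>UNIV. (L2_norm (partial_deriv i \<phi>))\<^sup>2) \<ge> 0" by (intro sum_nonneg) simp
  show "0 \<le> form \<phi>" unfolding form_eq[OF \<phi>] using s by simp
  have "(L2_norm (partial_deriv i \<phi>))\<^sup>2 \<le> (\<Sum>i\<in>UNIV. (L2_norm (partial_deriv i \<phi>))\<^sup>2)"
    by (rule member_le_sum) auto
  then have "(L2_norm (partial_deriv i \<phi>))\<^sup>2 \<le> 2 * form \<phi>"
    unfolding form_eq[OF \<phi>] by (simp add: add_increasing2)
  then show "L2_norm (partial_deriv i \<phi>) \<le> sqrt (2 * form \<phi>)" by (rule real_le_rsqrt)
  have "(L2_norm (\<lambda>x. root_W x * \<phi> x))\<^sup>2 \<le> form \<phi>" unfolding form_eq[OF \<phi>] using s by simp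
  then show W: "L2_norm (\<lambda>x. root_W x * \<phi> x) \<le> sqrt (form \<phi>)" by (rule real_le_rsqrt)
  show "L2_norm \<phi> \<le> sqrt (form \<phi>)"
    using L2_norm_le_root_W[OF test_functions_L2[OF \<phi>] continuous_mult_test_L2[OF root_W_cont \<phi>]] W by linarith
qed

text \<open>Adding the integrable \<open>c\<close> |u|^2 to the potential energy density gives the
  square of |\<open>root_W\<close> u|. The same identity is read backwards in
  \<open>finite_energyI\<close>.\<close>

lemma finite_energyD:
  assumes "finite_energy V u"
  obtains g where "u \<in> L2" "weak_gradient u g" "\<And>i. (\<lambda>x. g x $ i) \<in> L2" "(\<lambda>x. root_W x * u x) \<in> L2"
proof -
  obtain g where u: "u \<in> L2" and g: "weak_gradient u g" "integrable lebesgue (\<lambda>x. (norm (g x))\<^sup>2)"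
    and Vu: "integrable lebesgue (\<lambda>x. V x * (cmod (u x))\<^sup>2)"
    using assms unfolding finite_energy_def by blast
  have "(\<lambda>x. g x $ i) \<in> L2" for i
  proof (rule L2_dominated[OF _ g(2)])
    show "(\<lambda>x. g x $ i) \<in> borel_measurable lebesgue"
      using g(1) L1_loc_measurable[OF L1_loc_bounded_linear[OF bounded_linear_vec_nth]]
      unfolding weak_gradient_def by blast
    show "AE x in lebesgue. (cmod (g x $ i))\<^sup>2 \<le> (norm (g x))\<^sup>2"
      by (intro AE_I2 power_mono Finite_Cartesian_Product.norm_nth_le norm_ge_zero)
  qed
  moreover have "(\<lambda>x. root_W x * u x) \<in> L2"
  proof (rule L2_dominated)
    show "(\<lambda>x. root_W x * u x) \<in> borel_measurable lebesgue"
      using continuous_measurable_lebesgue[OF root_W_cont] L2_measurable[OF u] by (rule borel_measurable_times)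
    show "integrable lebesgue (\<lambda>x. V x * (cmod (u x))\<^sup>2 + c * (cmod (u x))\<^sup>2)"
      using Vu L2_integrable[OF u] by simp
    have "(cmod (root_W x * u x))\<^sup>2 = V x * (cmod (u x))\<^sup>2 + c * (cmod (u x))\<^sup>2" for x
      using V_lower[of x] by (simp add: root_W_def norm_mult power_mult_distrib distrib_right)
    then show "AE x in lebesgue. (cmod (root_W x * u x))\<^sup>2 \<le> V x * (cmod (u x))\<^sup>2 + c * (cmod (u x))\<^sup>2"
      by simp
  qed
  ultimately show ?thesis using that u g(1) by blast
qed

lemma finite_energyI:
  assumes "u \<in> L2" "weak_gradient u g" "\<And>i. (\<lambda>x. g x $ i) \<in> L2" "(\<lambda>x. root_W x * u x) \<in> L2"
  shows "finite_energy V u"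
proof -
  have "integrable lebesgue (\<lambda>x. \<Sum>i\<in>UNIV. (cmod (g x $ i))\<^sup>2)"
    by (intro Bochner_Integration.integrable_sum L2_integrable assms)
  moreover have "(\<Sum>i\<in>UNIV. (cmod (g x $ i))\<^sup>2) = (norm (g x))\<^sup>2" for x
    by (simp add: norm_vec_def L2_set_def sum_nonneg)
  ultimately have "integrable lebesgue (\<lambda>x. (norm (g x))\<^sup>2)" by simp
  moreover have "integrable lebesgue (\<lambda>x. V x * (cmod (u x))\<^sup>2)"
  proof -
    have "(cmod (root_W x * u x))\<^sup>2 - c * (cmod (u x))\<^sup>2 = V x * (cmod (u x))\<^sup>2" for x
      using V_lower[of x] by (simp add: root_W_def norm_mult power_mult_distrib algebra_simps)
    then show ?thesis
      using Bochner_Integration.integrable_diff[OF L2_integrable[OF assms(4)] integrable_mult_right[OF L2_integrable[OF assms(1)], of c]]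
      by simp
  qed
  ultimately show ?thesis using assms unfolding finite_energy_def by blast
qed

text \<open>The easy half of the description of the form domain, from the weak form and
  Cauchy-Schwarz. This bound, not the energy itself, is what gets transported in time.\<close>

lemma finite_energy_functional_bound:
  assumes "finite_energy V u"
  obtains M where "M \<ge> 0" "\<And>\<phi>. \<phi> \<in> test_functions \<Longrightarrow> cmod (L2_inner (Bop \<phi>) u) \<le> M * sqrt (form \<phi>)"
proof -
  obtain g where u: "u \<in> L2" "weak_gradient u g" "\<And>i. (\<lambda>x. g x $ i) \<in> L2" "(\<lambda>x. root_W x * u x) \<in> L2"
    using finite_energyD[OF assms] by blast
  define M where "M = (\<Sum>i\<in>UNIV. L2_norm (\<lambda>x. g x $ i)) + L2_norm (\<lambda>x. root_W x * u x)"
  have "cmod (L2_inner (Bop \<phi>) u) \<le> M * sqrt (form \<phi>)" if \<phi>: "\<phi> \<in> test_functions" for \<phi>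
  proof -
    note b = form_bounds[OF \<phi>]
    have "cmod ((1/2) * (\<Sum>i\<in>UNIV. L2_inner (partial_deriv i \<phi>) (\<lambda>x. g x $ i)))
       = (1/2) * cmod (\<Sum>i\<in>UNIV. L2_inner (partial_deriv i \<phi>) (\<lambda>x. g x $ i))" by (simp add: norm_mult)
    also have "\<dots> \<le> (1/2) * (\<Sum>i\<in>UNIV. cmod (L2_inner (partial_deriv i \<phi>) (\<lambda>x. g x $ i)))"
      by (intro mult_left_mono norm_sum) auto
    also have "\<dots> \<le> (1/2) * (\<Sum>i\<in>UNIV. sqrt (2 * form \<phi>) * L2_norm (\<lambda>x. g x $ i))"
      by (intro mult_left_mono sum_mono order_trans[OF L2_Cauchy_Schwarz] mult_right_mono b L2_norm_nonneg
          test_functions_L2 test_functions_partial_deriv \<phi> u) auto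
    also have "\<dots> \<le> (\<Sum>i\<in>UNIV. L2_norm (\<lambda>x. g x $ i)) * sqrt (form \<phi>)"
    proof -
      have "sqrt 2 \<le> 2" using real_sqrt_le_mono[of 2 4] by simp
      then have "1 / 2 * sqrt 2 * ((\<Sum>i\<in>UNIV. L2_norm (\<lambda>x. g x $ i)) * sqrt (form \<phi>))
         \<le> 1 * ((\<Sum>i\<in>UNIV. L2_norm (\<lambda>x. g x $ i)) * sqrt (form \<phi>))"
        by (intro mult_right_mono mult_nonneg_nonneg sum_nonneg L2_norm_nonneg) (use b(1) in auto)
      then show ?thesis by (simp add: real_sqrt_mult mult_ac flip: sum_distrib_left)
    qed
    finally have 1: "cmod ((1/2) * (\<Sum>i\<in>UNIV. L2_inner (partial_deriv i \<phi>) (\<lambda>x. g x $ i)))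
       \<le> (\<Sum>i\<in>UNIV. L2_norm (\<lambda>x. g x $ i)) * sqrt (form \<phi>)" .
    have "cmod (L2_inner (\<lambda>x. root_W x * \<phi> x) (\<lambda>x. root_W x * u x))
       \<le> L2_norm (\<lambda>x. root_W x * \<phi> x) * L2_norm (\<lambda>x. root_W x * u x)"
      by (intro L2_Cauchy_Schwarz continuous_mult_test_L2 root_W_cont \<phi> u)
    also have "\<dots> \<le> sqrt (form \<phi>) * L2_norm (\<lambda>x. root_W x * u x)"
      by (intro mult_right_mono b L2_norm_nonneg)
    finally have 2: "cmod (L2_inner (\<lambda>x. root_W x * \<phi> x) (\<lambda>x. root_W x * u x))
       \<le> sqrt (form \<phi>) * L2_norm (\<lambda>x. root_W x * u x)" .
    show ?thesis unfolding Bop_form[OF \<phi> u] M_def distrib_right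
      by (rule order_trans[OF norm_triangle_ineq]) (use 1 2 in \<open>simp add: mult.commute\<close>)
  qed
  moreover have "M \<ge> 0" unfolding M_def by (intro add_nonneg_nonneg sum_nonneg L2_norm_nonneg)
  ultimately show ?thesis using that by blast
qed

lemma closure_approx:
  assumes "(f, h) \<in> graph_closure (hamiltonian V)"
  obtains \<phi> where "\<And>n::nat. \<phi> n \<in> test_functions" "f \<in> L2" "h \<in> L2"
    "(\<lambda>n. L2_norm (\<lambda>x. \<phi> n x - f x)) \<longlonglongrightarrow> 0"
    "(\<lambda>n. L2_norm (\<lambda>x. Bop (\<phi> n) x - (h x + of_real c * f x))) \<longlonglongrightarrow> 0"
proof -
  obtain p q where pq: "\<And>n::nat. (p n, q n) \<in> hamiltonian V" "(\<lambda>n. L2_norm (\<lambda>x. p n x - f x)) \<longlonglongrightarrow> 0"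
      "(\<lambda>n. L2_norm (\<lambda>x. q n x - h x)) \<longlonglongrightarrow> 0" "f \<in> L2" "h \<in> L2"
    using assms unfolding graph_closure_def by auto
  have p: "p n \<in> test_functions" "q n = Ham (p n)" for n
    using pq(1)[of n] by (auto simp: hamiltonian_eq)
  have "(\<lambda>n. cmod (of_real c) * L2_norm (\<lambda>x. p n x - f x)) \<longlonglongrightarrow> 0"
    using tendsto_mult_left[OF pq(2)] by simp
  then have "(\<lambda>n. L2_norm (\<lambda>x. of_real c * p n x - of_real c * f x)) \<longlonglongrightarrow> 0"
    by (simp only: L2_norm_cmult[symmetric] right_diff_distrib)
  from L2_norm_tendsto_add[OF _ _ _ _ pq(3) this]
  have "(\<lambda>n. L2_norm (\<lambda>x. (q n x + of_real c * p n x) - (h x + of_real c * f x))) \<longlonglongrightarrow> 0"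
    using p pq(4,5) by (simp add: Ham_L2 L2_cmult test_functions_L2)
  then have "(\<lambda>n. L2_norm (\<lambda>x. Bop (p n) x - (h x + of_real c * f x))) \<longlonglongrightarrow> 0"
    by (simp add: Bop_def p(2))
  then show ?thesis using that p(1) pq by blast
qed

text \<open>Along an approximation in the graph norm the quadratic forms converge, so inequalities
  for test functions extend to the domain of the closure. This extension is essential: the evolution
  does not preserve the space of test functions, but it does preserve that domain.\<close>

lemma closure_bounds:
  assumes fh: "(f, h) \<in> graph_closure (hamiltonian V)"
  shows "(L2_norm f)\<^sup>2 \<le> Re (L2_inner (\<lambda>x. h x + of_real c * f x) f)"
    and "u \<in> L2 \<Longrightarrow> (\<And>\<phi>. \<phi> \<in> test_functions \<Longrightarrow> cmod (L2_inner (Bop \<phi>) u) \<le> M * sqrt (form \<phi>)) \<Longrightarrow>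
      cmod (L2_inner (\<lambda>x. h x + of_real c * f x) u) \<le> M * sqrt (Re (L2_inner (\<lambda>x. h x + of_real c * f x) f))"
proof -
  obtain \<phi> where \<phi>: "\<And>n::nat. \<phi> n \<in> test_functions" "f \<in> L2" "h \<in> L2"
    and l: "(\<lambda>n. L2_norm (\<lambda>x. \<phi> n x - f x)) \<longlonglongrightarrow> 0"
    "(\<lambda>n. L2_norm (\<lambda>x. Bop (\<phi> n) x - (h x + of_real c * f x))) \<longlonglongrightarrow> 0"
    using closure_approx[OF fh] by blast
  have B: "(\<lambda>x. h x + of_real c * f x) \<in> L2" using \<phi> by (intro L2_add L2_cmult)
  have q: "(\<lambda>n. form (\<phi> n)) \<longlonglongrightarrow> Re (L2_inner (\<lambda>x. h x + of_real c * f x) f)"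
    unfolding form_def by (intro tendsto_Re L2_inner_tendsto Bop_L2 test_functions_L2 \<phi> B l)
  have n: "(\<lambda>n. (L2_norm (\<phi> n))\<^sup>2) \<longlonglongrightarrow> (L2_norm f)\<^sup>2"
    by (intro tendsto_power L2_norm_tendsto test_functions_L2 \<phi> l)
  have "(L2_norm (\<phi> n))\<^sup>2 \<le> form (\<phi> n)" for n
    using power_mono[OF form_bounds(4)[OF \<phi>(1)] L2_norm_nonneg, of n 2] form_bounds(1)[OF \<phi>(1), of n] by simp
  then show "(L2_norm f)\<^sup>2 \<le> Re (L2_inner (\<lambda>x. h x + of_real c * f x) f)"
    by (intro LIMSEQ_le[OF n q]) auto
  assume u: "u \<in> L2" and M: "\<And>\<phi>. \<phi> \<in> test_functions \<Longrightarrow> cmod (L2_inner (Bop \<phi>) u) \<le> M * sqrt (form \<phi>)"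
  have "(\<lambda>n. L2_inner (Bop (\<phi> n)) u) \<longlonglongrightarrow> L2_inner (\<lambda>x. h x + of_real c * f x) u"
    by (rule L2_inner_tendsto[OF _ B _ u l(2)]) (auto simp: Bop_L2 \<phi> u L2_norm_def)
  then have "(\<lambda>n. cmod (L2_inner (Bop (\<phi> n)) u)) \<longlonglongrightarrow> cmod (L2_inner (\<lambda>x. h x + of_real c * f x) u)"
    by (rule tendsto_norm)
  moreover have "(\<lambda>n. M * sqrt (form (\<phi> n))) \<longlonglongrightarrow> M * sqrt (Re (L2_inner (\<lambda>x. h x + of_real c * f x) f))"
    by (intro tendsto_intros q)
  ultimately show "cmod (L2_inner (\<lambda>x. h x + of_real c * f x) u) \<le> M * sqrt (Re (L2_inner (\<lambda>x. h x + of_real c * f x) f))"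
    by (rule LIMSEQ_le) (use M[OF \<phi>(1)] in auto)
qed

end

section \<open>The variational problem for the energy\<close>

context energy_form
begin

lemma form_add:
  assumes \<phi>: "\<phi> \<in> test_functions" and \<eta>: "\<eta> \<in> test_functions"
  shows "form (\<lambda>x. \<phi> x + \<eta> x) = form \<phi> + 2 * Re (L2_inner (Bop \<phi>) \<eta>) + form \<eta>"
proof -
  have "L2_inner (Bop (\<lambda>x. \<phi> x + \<eta> x)) (\<lambda>x. \<phi> x + \<eta> x)
     = (L2_inner (Bop \<phi>) \<phi> + L2_inner (Bop \<phi>) \<eta>) + (L2_inner (Bop \<eta>) \<phi> + L2_inner (Bop \<eta>) \<eta>)"
    unfolding Bop_add[OF \<phi> \<eta>]
    by (simp add: L2_inner_add_left L2_inner_add_right L2_add Bop_L2 test_functions_L2 \<phi> \<eta>)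
  moreover have "Re (L2_inner (Bop \<eta>) \<phi>) = Re (L2_inner (Bop \<phi>) \<eta>)"
    by (subst Bop_symmetric[OF \<eta> \<phi>]) simp
  ultimately show ?thesis by (simp add: form_def)
qed

lemma form_cmult: "\<phi> \<in> test_functions \<Longrightarrow> form (\<lambda>x. a * \<phi> x) = (cmod a)\<^sup>2 * form \<phi>"
proof -
  assume \<phi>: "\<phi> \<in> test_functions"
  have "L2_inner (Bop (\<lambda>x. a * \<phi> x)) (\<lambda>x. a * \<phi> x) = of_real ((cmod a)\<^sup>2) * L2_inner (Bop \<phi>) \<phi>"
    unfolding Bop_cmult[OF \<phi>] L2_inner_cmult_left L2_inner_cmult_right
    by (simp only: complex_norm_square mult_ac)
  then show ?thesis by (simp add: form_def)
qed

text \<open>A function orthogonal to the range of H + c on test functions satisfies the eigenvalue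
  equation for -c in the adjoint sense. By essential self-adjointness it lies in the domain of the
  closure, where H + c \<ge> 1 forces it to vanish.\<close>

lemma orthogonal_Bop_range_imp_0:
  assumes z: "z \<in> L2" and 0: "\<And>\<phi>. \<phi> \<in> test_functions \<Longrightarrow> L2_inner (Bop \<phi>) z = 0"
  shows "AE x in lebesgue. z x = 0"
proof -
  let ?h = "\<lambda>x. of_real (- c) * z x"
  have "L2_inner z (Ham \<phi>) = L2_inner ?h \<phi>" if \<phi>: "\<phi> \<in> test_functions" for \<phi>
  proof -
    have "L2_inner z (Bop \<phi>) = 0" using 0[OF \<phi>] by (subst L2_inner_cnj) simp
    then have "L2_inner z (Ham \<phi>) + of_real c * L2_inner z \<phi> = 0"
      unfolding Bop_def
      by (simp add: L2_inner_add_right L2_inner_cmult_right z Ham_L2 \<phi> L2_cmult test_functions_L2)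
    then show ?thesis by (simp add: L2_inner_cmult_left eq_neg_iff_add_eq_0 del: of_real_minus)
      (simp add: eq_neg_iff_add_eq_0)
  qed
  then have "(z, ?h) \<in> graph_adjoint (hamiltonian V)"
    using z L2_cmult[OF z, of "of_real (- c)"] by (auto simp: graph_adjoint_def hamiltonian_eq)
  then have "(z, ?h) \<in> graph_adjoint (graph_closure (hamiltonian V))"
    by (rule graph_adjoint_closure[OF hamiltonian_L2])
  then have "(z, ?h) \<in> graph_closure (hamiltonian V)"
    using esa by (simp add: essentially_self_adjoint_def self_adjoint_def)
  from closure_bounds(1)[OF this] have "(L2_norm z)\<^sup>2 \<le> Re (L2_inner (\<lambda>x. 0) z)" by simp
  then have "L2_norm z = 0" by (simp add: L2_inner_def)
  then show ?thesis using L2_norm_eq_0_iff[OF z] by simp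
qed

text \<open>Minimising \<open>form \<phi> - 2 Re \<langle>Bop \<phi>, w\<rangle>\<close> over test functions yields a Cauchy sequence in the
  energy norm; by essential self-adjointness its limit can only be \<open>w\<close>.\<close>

lemma energy_approximation:
  assumes w: "w \<in> L2" and M0: "M \<ge> 0"
    and M: "\<And>\<phi>. \<phi> \<in> test_functions \<Longrightarrow> cmod (L2_inner (Bop \<phi>) w) \<le> M * sqrt (form \<phi>)"
  obtains \<phi> g where "H1_limit \<phi> w g" "\<And>n. form (\<phi> n) \<le> (2 * M + 1)\<^sup>2"
proof -
  define F where "F \<phi> = form \<phi> - 2 * Re (L2_inner (Bop \<phi>) w)" for \<phi>
  have ReM: "\<bar>Re (L2_inner (Bop \<phi>) w)\<bar> \<le> M * sqrt (form \<phi>)" if "\<phi> \<in> test_functions" for \<phi>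
    using M[OF that] abs_Re_le_cmod[of "L2_inner (Bop \<phi>) w"] by linarith
  have F_lower: "form \<phi> - 2 * M * sqrt (form \<phi>) \<le> F \<phi>" if "\<phi> \<in> test_functions" for \<phi>
    using ReM[OF that] by (simp add: F_def)
  \<comment> \<open>Completing the square shows that the functional is bounded below, so the infimum
    \<open>I\<close> is meaningful.\<close>
  have bdd: "- M\<^sup>2 \<le> F \<phi>" if "\<phi> \<in> test_functions" for \<phi>
  proof -
    have "0 \<le> (sqrt (form \<phi>) - M)\<^sup>2" by simp
    also have "\<dots> = form \<phi> - 2 * M * sqrt (form \<phi>) + M\<^sup>2"
      using form_bounds(1)[OF that] by (simp add: power2_diff)
    finally show ?thesis using F_lower[OF that] by linarith
  qed
  define I where "I = Inf (F ` test_functions)"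
  have bb: "bdd_below (F ` test_functions)" using bdd by (intro bdd_belowI2[where m="- M\<^sup>2"])
  have I_le: "I \<le> F \<phi>" if "\<phi> \<in> test_functions" for \<phi>
    unfolding I_def using that by (intro cInf_lower bb) auto
  \<comment> \<open>The tolerance (1/4)^n becomes an energy-norm distance of order (1/2)^n after
    taking roots, which is the decay that \<open>L2_complete\<close> asks for.\<close>
  have "\<exists>\<phi>\<in>test_functions. F \<phi> < I + (1/4) ^ n" for n :: nat
  proof -
    have "F ` test_functions \<noteq> {}" using test_functions_zero by blast
    then obtain y where "y \<in> F ` test_functions" "y < I + (1/4) ^ n"
      using cInf_less_iff[OF _ bb, of "I + (1/4) ^ n"] unfolding I_def by auto
    then show ?thesis by auto
  qed
  then obtain \<phi> where \<phi>: "\<And>n::nat. \<phi> n \<in> test_functions" and F\<phi>: "\<And>n. F (\<phi> n) < I + (1/4) ^ n"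
    by metis
  \<comment> \<open>The functional vanishes at 0, so \<open>I \<le> 0\<close> and its value at
    \<open>\<phi> n\<close> is at most 1. With s the energy norm this gives s (s - 2 M) \<le> 1,
    impossible for s > 2 M + 1.\<close>
  have form_\<phi>: "form (\<phi> n) \<le> (2 * M + 1)\<^sup>2" for n
  proof -
    define s where "s = sqrt (form (\<phi> n))"
    have s: "s \<ge> 0" "form (\<phi> n) = s\<^sup>2" using form_bounds(1)[OF \<phi>] by (auto simp: s_def)
    have "Bop (\<lambda>x. 0) = (\<lambda>x. 0)"
      by (rule ext) (simp add: Bop_def Ham_def laplacian_def partial_deriv_const)
    then have Fz: "F (\<lambda>x. 0) = 0" by (simp add: F_def form_def L2_inner_def)
    have "form (\<phi> n) - 2 * M * s \<le> F (\<phi> n)" unfolding s_def by (rule F_lower[OF \<phi>])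
    then have "s\<^sup>2 - 2 * M * s \<le> F (\<phi> n)" by (simp only: s(2))
    also have "\<dots> \<le> 1"
      using F\<phi>[of n] I_le[OF test_functions_zero] power_le_one[of "1/4::real" n] by (simp add: Fz)
    finally have "s * (s - 2 * M) \<le> 1" by (simp add: power2_eq_square algebra_simps)
    have "s \<le> 2 * M + 1"
    proof (rule ccontr)
      assume "\<not> s \<le> 2 * M + 1"
      then have "s > 2 * M + 1" "s > 1" "s - 2 * M > 1" using M0 by auto
      then have "1 * 1 < s * (s - 2 * M)" by (intro mult_strict_mono) auto
      then show False using \<open>s * (s - 2 * M) \<le> 1\<close> by simp
    qed
    then show ?thesis unfolding s(2) using s(1) by (rule power_mono)
  qed
  \<comment> \<open>The parallelogram law expresses the distance of two almost minimisers by their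
    values and the value at their midpoint \<open>m\<close>; the latter is at least
    \<open>I\<close>.\<close>
  have diff: "form (\<lambda>x. \<phi> (Suc n) x - \<phi> n x) \<le> 4 * (1/4) ^ n" for n
  proof -
    define \<alpha> \<beta> where "\<alpha> = \<phi> (Suc n)" and "\<beta> = \<phi> n"
    have t: "\<alpha> \<in> test_functions" "\<beta> \<in> test_functions" "(\<lambda>x. - 1 * \<beta> x) \<in> test_functions"
      "(\<lambda>x. \<alpha> x + \<beta> x) \<in> test_functions"
      unfolding \<alpha>_def \<beta>_def by (intro test_functions_add test_functions_cmult \<phi>)+
    define m where "m x = (1/2) * (\<alpha> x + \<beta> x)" for x
    have m: "m \<in> test_functions" unfolding m_def by (intro test_functions_cmult t)
    have "form (\<lambda>x. \<alpha> x - \<beta> x) = form \<alpha> - 2 * Re (L2_inner (Bop \<alpha>) \<beta>) + form \<beta>"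
      using form_add[OF t(1,3)] form_cmult[OF t(2), of "-1"] L2_inner_cmult_right[of "Bop \<alpha>" "-1" \<beta>] by simp
    also have "\<dots> = 2 * form \<alpha> + 2 * form \<beta> - form (\<lambda>x. \<alpha> x + \<beta> x)"
      using form_add[OF t(1,2)] by simp
    also have "\<dots> = 2 * F \<alpha> + 2 * F \<beta> - 4 * F m"
    proof -
      have "form (\<lambda>x. (1/2) * (\<alpha> x + \<beta> x)) = (1/4) * form (\<lambda>x. \<alpha> x + \<beta> x)"
        using form_cmult[OF t(4), of "1/2"] by (simp add: power2_eq_square)
      moreover
      have "L2_inner (Bop (\<lambda>x. (1/2) * (\<alpha> x + \<beta> x))) w
          = (1/2) * (L2_inner (Bop \<alpha>) w + L2_inner (Bop \<beta>) w)"
        unfolding Bop_cmult[OF t(4)] Bop_add[OF t(1,2)] L2_inner_cmult_left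
        using L2_inner_add_left[OF w Bop_L2[OF t(1)] Bop_L2[OF t(2)]] by simp
      then have "Re (L2_inner (Bop (\<lambda>x. (1/2) * (\<alpha> x + \<beta> x))) w)
          = (1/2) * (Re (L2_inner (Bop \<alpha>) w) + Re (L2_inner (Bop \<beta>) w))" by (simp only:) simp
      ultimately have "form m = (1/4) * form (\<lambda>x. \<alpha> x + \<beta> x)"
        "Re (L2_inner (Bop m) w) = (1/2) * (Re (L2_inner (Bop \<alpha>) w) + Re (L2_inner (Bop \<beta>) w))"
        unfolding m_def by blast+
      then show ?thesis unfolding F_def by (simp add: distrib_left)
    qed
    also have "\<dots> \<le> 2 * (1/4) ^ Suc n + 2 * (1/4) ^ n"
      using I_le[OF m] F\<phi>[of n] F\<phi>[of "Suc n"] by (simp add: \<alpha>_def \<beta>_def)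
    also have "\<dots> \<le> 4 * (1/4) ^ n" by simp
    finally show ?thesis by (simp add: \<alpha>_def \<beta>_def)
  qed
  have td: "(\<lambda>x. \<phi> (Suc n) x - \<phi> n x) \<in> test_functions" for n
    using test_functions_add[OF \<phi> test_functions_cmult[OF \<phi>, of "-1"], of "Suc n" n] by simp
  have pow: "sqrt (k * (1/4) ^ n) = sqrt k * (1/2) ^ n" for k :: real and n :: nat
  proof -
    have "(1/4::real) ^ n = ((1/2) ^ n)\<^sup>2" by (simp add: power2_eq_square flip: power_mult_distrib)
    then show ?thesis by (simp add: real_sqrt_mult)
  qed
  have "L2_norm (\<lambda>x. \<phi> (Suc n) x - \<phi> n x) \<le> sqrt 4 * (1/2) ^ n" for n
    using form_bounds(4)[OF td, of n] real_sqrt_le_mono[OF diff, of n] unfolding pow by linarith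
  then obtain v where v: "v \<in> L2" "(\<lambda>n. L2_norm (\<lambda>x. \<phi> n x - v x)) \<longlonglongrightarrow> 0"
    using L2_complete[of \<phi>, OF test_functions_L2[OF \<phi>]] by blast
  have "\<exists>G\<in>L2. (\<lambda>n. L2_norm (\<lambda>x. partial_deriv i (\<phi> n) x - G x)) \<longlonglongrightarrow> 0" for i
  proof -
    have eq: "partial_deriv i (\<lambda>x. \<phi> (Suc n) x - \<phi> n x) = (\<lambda>x. partial_deriv i (\<phi> (Suc n)) x - partial_deriv i (\<phi> n) x)" for n
      using partial_deriv_add_test[OF \<phi> test_functions_cmult[OF \<phi>, of "-1"], of i "Suc n" n]
        partial_deriv_cmult[OF \<phi>, of i "-1" n] by simp
    have b: "L2_norm (\<lambda>x. partial_deriv i (\<phi> (Suc n)) x - partial_deriv i (\<phi> n) x) \<le> sqrt 8 * (1/2) ^ n" for n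
    proof -
      have "2 * form (\<lambda>x. \<phi> (Suc n) x - \<phi> n x) \<le> 8 * (1/4) ^ n" using diff[of n] by simp
      then show ?thesis
        using form_bounds(2)[OF td, of i n] real_sqrt_le_mono[of "2 * form (\<lambda>x. \<phi> (Suc n) x - \<phi> n x)" "8 * (1/4) ^ n"]
        unfolding pow eq by linarith
    qed
    show ?thesis
      using L2_complete[of "\<lambda>n. partial_deriv i (\<phi> n)", OF test_functions_L2[OF test_functions_partial_deriv[OF \<phi>]] b] by blast
  qed
  then have "\<forall>i. \<exists>G. G \<in> L2 \<and> (\<lambda>n. L2_norm (\<lambda>x. partial_deriv i (\<phi> n) x - G x)) \<longlonglongrightarrow> 0" by blast
  from choice[OF this] obtain G where G: "\<And>i. G i \<in> L2"
    "\<And>i. (\<lambda>n. L2_norm (\<lambda>x. partial_deriv i (\<phi> n) x - G i x)) \<longlonglongrightarrow> 0" by blast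
  \<comment> \<open>The Euler-Lagrange equation. Perturbing \<open>\<phi> n\<close> by a multiple s
    of \<open>\<eta>\<close> cannot lower the functional below \<open>I\<close>; in the limit this
    is a quadratic inequality in s for all s, so its linear coefficient vanishes.\<close>
  have Re0: "Re (L2_inner (Bop \<eta>) (\<lambda>x. v x - w x)) = 0" if \<eta>: "\<eta> \<in> test_functions" for \<eta>
  proof -
    define y where "y = Re (L2_inner (Bop \<eta>) (\<lambda>x. v x - w x))"
    have lim: "(\<lambda>n. Re (L2_inner (Bop \<eta>) (\<phi> n)) - Re (L2_inner (Bop \<eta>) w)) \<longlonglongrightarrow> y"
      unfolding y_def L2_inner_diff_right[OF Bop_L2[OF \<eta>] v(1) w] minus_complex.sel
      by (intro tendsto_diff tendsto_Re tendsto_const L2_inner_tendsto_right Bop_L2 test_functions_L2 \<eta> \<phi> v)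
    have ineq: "0 \<le> 2 * s * y + s\<^sup>2 * form \<eta>" for s :: real
    proof (rule LIMSEQ_le)
      have "(\<lambda>n. (1/4::real) ^ n) \<longlonglongrightarrow> 0" by (rule LIMSEQ_realpow_zero) auto
      from tendsto_minus[OF this] show "(\<lambda>n. - ((1/4::real) ^ n)) \<longlonglongrightarrow> 0" by simp
      show "(\<lambda>n. 2 * s * (Re (L2_inner (Bop \<eta>) (\<phi> n)) - Re (L2_inner (Bop \<eta>) w)) + s\<^sup>2 * form \<eta>)
          \<longlonglongrightarrow> 2 * s * y + s\<^sup>2 * form \<eta>"
        by (intro tendsto_intros lim)
      have "- ((1/4) ^ n) \<le> 2 * s * (Re (L2_inner (Bop \<eta>) (\<phi> n)) - Re (L2_inner (Bop \<eta>) w)) + s\<^sup>2 * form \<eta>" for n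
      proof -
        have s\<eta>: "(\<lambda>x. of_real s * \<eta> x) \<in> test_functions" by (rule test_functions_cmult[OF \<eta>])
        have "I \<le> F (\<lambda>x. of_real s * \<eta> x + \<phi> n x)" by (intro I_le test_functions_add s\<eta> \<phi>)
        also have "\<dots> = F (\<phi> n) + 2 * s * (Re (L2_inner (Bop \<eta>) (\<phi> n)) - Re (L2_inner (Bop \<eta>) w)) + s\<^sup>2 * form \<eta>"
          unfolding F_def form_add[OF s\<eta> \<phi>] Bop_add[OF s\<eta> \<phi>] form_cmult[OF \<eta>] Bop_cmult[OF \<eta>]
          by (simp add: L2_inner_add_left L2_cmult Bop_L2 \<eta> \<phi> w L2_inner_cmult_left algebra_simps)
        finally show ?thesis using F\<phi>[of n] by linarith
      qed
      then show "\<exists>N. \<forall>n\<ge>N. - ((1 / 4) ^ n) \<le> 2 * s * (Re (L2_inner (Bop \<eta>) (\<phi> n)) - Re (L2_inner (Bop \<eta>) w)) + s\<^sup>2 * form \<eta>"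
        by simp
    qed
    show "y = 0"
    proof (rule ccontr)
      assume "y \<noteq> 0"
      \<comment> \<open>Adding 1 keeps the step size \<open>- y / q\<close> defined when the form of
        \<open>\<eta>\<close> is 0.\<close>
      define q where "q = form \<eta> + 1"
      have q: "q > 0" "form \<eta> < q" using form_bounds(1)[OF \<eta>] by (auto simp: q_def)
      have "0 \<le> 2 * (- y / q) * y + (- y / q)\<^sup>2 * form \<eta>" by (rule ineq)
      also have "\<dots> = (y\<^sup>2 / q) * (form \<eta> / q - 2)" using q by (simp add: power2_eq_square field_simps)
      also have "\<dots> < 0"
        using q \<open>y \<noteq> 0\<close> by (intro mult_pos_neg) (auto simp: divide_less_eq)
      finally show False by simp
    qed
  qed
  have "AE x in lebesgue. v x - w x = 0"
  proof (rule orthogonal_Bop_range_imp_0)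
    show "(\<lambda>x. v x - w x) \<in> L2" by (intro L2_diff v w)
    fix \<eta> :: "real^'d \<Rightarrow> complex" assume \<eta>: "\<eta> \<in> test_functions"
    \<comment> \<open>Testing with \<open>\<i> * \<eta>\<close> turns the identity for real parts
      into the one for imaginary parts.\<close>
    have "Re (L2_inner (Bop (\<lambda>x. \<i> * \<eta> x)) (\<lambda>x. v x - w x)) = 0"
      by (intro Re0 test_functions_cmult \<eta>)
    then have "Im (L2_inner (Bop \<eta>) (\<lambda>x. v x - w x)) = 0"
      unfolding Bop_cmult[OF \<eta>] L2_inner_cmult_left by simp
    then show "L2_inner (Bop \<eta>) (\<lambda>x. v x - w x) = 0" using Re0[OF \<eta>] by (simp add: complex_eq_iff)
  qed
  then have "AE x in lebesgue. v x = w x" by eventually_elim simp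
  then have "L2_norm (\<lambda>x. \<phi> n x - v x) = L2_norm (\<lambda>x. \<phi> n x - w x)" for n
    by (intro L2_norm_cong_AE L2_diff test_functions_L2 \<phi> v w) auto
  then have "H1_limit \<phi> w (\<lambda>x. \<chi> i. G i x)"
    using \<phi> w G v(2) by (simp add: H1_limit_def)
  then show ?thesis using that form_\<phi> by blast
qed

text \<open>Convergence in H1 does not control the potential energy, as the potential may be
  unbounded. The uniform form bound is carried over by Fatou's lemma along an almost everywhere
  convergent subsequence.\<close>

lemma H1_limit_finite_energy:
  assumes H: "H1_limit \<phi> w g" and M: "\<And>n. form (\<phi> n) \<le> M"
  shows "finite_energy V w" "L2_norm (\<lambda>x. g x $ i) \<le> sqrt (2 * M)" "L2_norm w \<le> sqrt M"
proof -
  note \<phi> = H1_limitD(1)[OF H]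
  obtain r :: "nat \<Rightarrow> nat" where r: "strict_mono r" "AE x in lebesgue. (\<lambda>n. \<phi> (r n) x) \<longlonglongrightarrow> w x"
    using L2_AE_subseq[OF test_functions_L2[OF \<phi>] H1_limitD(2,4)[OF H]] by blast
  have "(\<lambda>x. root_W x * w x) \<in> L2"
  proof (rule L2_Fatou(1))
    show "(\<lambda>x. root_W x * \<phi> (r n) x) \<in> L2" for n by (rule continuous_mult_test_L2[OF root_W_cont \<phi>])
    show "(\<lambda>x. root_W x * w x) \<in> borel_measurable lebesgue"
      using continuous_measurable_lebesgue[OF root_W_cont] L2_measurable[OF H1_limitD(2)[OF H]]
      by (rule borel_measurable_times)
    show "AE x in lebesgue. (\<lambda>n. root_W x * \<phi> (r n) x) \<longlonglongrightarrow> root_W x * w x"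
      using r(2) by eventually_elim (intro tendsto_intros)
    show "L2_norm (\<lambda>x. root_W x * \<phi> (r n) x) \<le> sqrt M" for n
      using form_bounds(3)[OF \<phi>, of "r n"] real_sqrt_le_mono[OF M, of "r n"] by linarith
  qed
  then show "finite_energy V w"
    by (intro finite_energyI[OF H1_limitD(2)[OF H] H1_limit_weak_gradient[OF H] H1_limitD(3)[OF H]])
  have "L2_norm (partial_deriv i (\<phi> n)) \<le> sqrt (2 * M)" for n
    using form_bounds(2)[OF \<phi>, of i n] M[of n] real_sqrt_le_mono[of "2 * form (\<phi> n)" "2 * M"] by linarith
  moreover have "(\<lambda>n. L2_norm (partial_deriv i (\<phi> n))) \<longlonglongrightarrow> L2_norm (\<lambda>x. g x $ i)"
    by (intro L2_norm_tendsto test_functions_L2 test_functions_partial_deriv \<phi> H1_limitD[OF H])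
  ultimately show "L2_norm (\<lambda>x. g x $ i) \<le> sqrt (2 * M)" by (intro LIMSEQ_le_const2) auto
  have "L2_norm (\<phi> n) \<le> sqrt M" for n
    using form_bounds(4)[OF \<phi>, of n] real_sqrt_le_mono[OF M, of n] by linarith
  moreover have "(\<lambda>n. L2_norm (\<phi> n)) \<longlonglongrightarrow> L2_norm w"
    by (intro L2_norm_tendsto test_functions_L2 \<phi> H1_limitD[OF H])
  ultimately show "L2_norm w \<le> sqrt M" by (intro LIMSEQ_le_const2) auto
qed

end

section \<open>Unitary groups\<close>

lemma unitary_groupD:
  assumes "unitary_group U"
  shows "f \<in> L2 \<Longrightarrow> U t f \<in> L2" "f \<in> L2 \<Longrightarrow> L2_norm (U t f) = L2_norm f"
    "f \<in> L2 \<Longrightarrow> g \<in> L2 \<Longrightarrow> AE x in lebesgue. U t (\<lambda>y. a * f y + b * g y) x = a * U t f x + b * U t g x"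
    "f \<in> L2 \<Longrightarrow> AE x in lebesgue. U 0 f x = f x"
    "f \<in> L2 \<Longrightarrow> AE x in lebesgue. U (s + t) f x = U s (U t f) x"
    "f \<in> L2 \<Longrightarrow> ((\<lambda>t. L2_norm (\<lambda>x. U t f x - U s f x)) \<longlongrightarrow> 0) (at s)"
  using assms unfolding unitary_group_def by blast+

lemma unitary_group_diff_norm:
  assumes U: "unitary_group U" and f: "f \<in> L2" and g: "g \<in> L2"
  shows "L2_norm (\<lambda>x. U t f x - U t g x) = L2_norm (\<lambda>x. f x - g x)"
proof -
  have d: "(\<lambda>y. 1 * f y + (- 1) * g y) \<in> L2" using L2_diff[OF f g] by simp
  have "L2_norm (\<lambda>x. U t f x - U t g x) = L2_norm (U t (\<lambda>y. 1 * f y + (- 1) * g y))"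
  proof (rule L2_norm_cong_AE)
    show "AE x in lebesgue. U t f x - U t g x = U t (\<lambda>y. 1 * f y + (- 1) * g y) x"
      using unitary_groupD(3)[OF U f g, of t 1 "-1"] by eventually_elim simp
  qed (intro L2_diff unitary_groupD(1)[OF U] f g d)+
  also have "\<dots> = L2_norm (\<lambda>y. 1 * f y + (- 1) * g y)" by (rule unitary_groupD(2)[OF U d])
  finally show ?thesis by simp
qed

lemma unitary_group_cong_AE:
  assumes U: "unitary_group U" and f: "f \<in> L2" and g: "g \<in> L2" and eq: "AE x in lebesgue. f x = g x"
  shows "AE x in lebesgue. U t f x = U t g x"
proof -
  have "L2_norm (\<lambda>x. U t f x - U t g x) = 0"
    unfolding unitary_group_diff_norm[OF U f g] using eq L2_norm_eq_0_iff[OF L2_diff[OF f g]] by simp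
  then have "AE x in lebesgue. U t f x - U t g x = 0"
    using L2_norm_eq_0_iff[OF L2_diff[OF unitary_groupD(1)[OF U f] unitary_groupD(1)[OF U g]]] by blast
  then show ?thesis by eventually_elim simp
qed

text \<open>Polarisation: the norm of a sum determines the real part of the inner product, and
  replacing \<open>g\<close> by \<open>\<i> * g\<close> gives the imaginary part.\<close>

lemma unitary_group_inner:
  assumes U: "unitary_group U" and f: "f \<in> L2" and g: "g \<in> L2"
  shows "L2_inner (U t f) (U t g) = L2_inner f g"
proof -
  have Re_eq: "Re (L2_inner (U t f) (U t h)) = Re (L2_inner f h)" if h: "h \<in> L2" for h
  proof -
    have s: "(\<lambda>y. 1 * f y + 1 * h y) \<in> L2" using L2_add[OF f h] by simp
    have "L2_norm (\<lambda>x. U t f x + U t h x) = L2_norm (U t (\<lambda>y. 1 * f y + 1 * h y))"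
    proof (rule L2_norm_cong_AE)
      show "AE x in lebesgue. U t f x + U t h x = U t (\<lambda>y. 1 * f y + 1 * h y) x"
        using unitary_groupD(3)[OF U f h, of t 1 1] by eventually_elim simp
    qed (intro L2_add unitary_groupD(1)[OF U] f h s)+
    also have "\<dots> = L2_norm (\<lambda>x. f x + h x)" using unitary_groupD(2)[OF U s] by simp
    finally have "(L2_norm (\<lambda>x. U t f x + U t h x))\<^sup>2 = (L2_norm (\<lambda>x. f x + h x))\<^sup>2" by simp
    then show ?thesis
      by (simp add: L2_norm_add_sq f h unitary_groupD(1,2)[OF U])
  qed
  have ig: "(\<lambda>x. \<i> * g x) \<in> L2" by (rule L2_cmult[OF g])
  have "L2_inner (U t f) (U t (\<lambda>x. \<i> * g x)) = L2_inner (U t f) (\<lambda>x. \<i> * U t g x)"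
  proof (rule L2_inner_cong_AE)
    show "AE x in lebesgue. U t (\<lambda>x. \<i> * g x) x = \<i> * U t g x"
      using unitary_groupD(3)[OF U g g, of t \<i> 0] by simp
  qed (auto intro: L2_cmult unitary_groupD(1)[OF U] f g)
  then have "Re (\<i> * L2_inner (U t f) (U t g)) = Re (\<i> * L2_inner f g)"
    using Re_eq[OF ig] by (simp only: L2_inner_cmult_right)
  then show ?thesis using Re_eq[OF g] by (simp add: complex_eq_iff)
qed

lemma unitary_group_inverse:
  assumes U: "unitary_group U" and f: "f \<in> L2"
  shows "AE x in lebesgue. U s (U (- s) f) x = f x"
  using unitary_groupD(5)[OF U f, of s "- s"] unitary_groupD(4)[OF U f] by eventually_elim simp

lemma unitary_group_inner_adjoint:
  assumes U: "unitary_group U" and f: "f \<in> L2" and g: "g \<in> L2"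
  shows "L2_inner f (U t g) = L2_inner (U (- t) f) g"
proof -
  have "L2_inner f (U t g) = L2_inner (U t (U (- t) f)) (U t g)"
    by (rule L2_inner_cong_AE)
      (use unitary_group_inverse[OF U f, of t] in \<open>auto intro: unitary_groupD(1)[OF U] f g\<close>)
  also have "\<dots> = L2_inner (U (- t) f) g" by (intro unitary_group_inner[OF U] unitary_groupD(1)[OF U] f g)
  finally show ?thesis .
qed

text \<open>The group is commutative and isometric, so the difference quotients at
  \<open>U s f\<close> are as far from \<open>U s g\<close> as those at \<open>f\<close> are from
  \<open>g\<close>.\<close>

lemma group_generator_invariant:
  assumes U: "unitary_group U" and fg: "(f, g) \<in> group_generator U"
  shows "(U s f, U s g) \<in> group_generator U"
proof -
  have f: "f \<in> L2" and g: "g \<in> L2"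
    and lim: "((\<lambda>t. L2_norm (\<lambda>x. \<i> / complex_of_real t * (U t f x - f x) - g x)) \<longlongrightarrow> 0) (at 0)"
    using fg unfolding group_generator_def by auto
  note UL = unitary_groupD(1)[OF U]
  have "L2_norm (\<lambda>x. \<i> / complex_of_real t * (U t (U s f) x - U s f x) - U s g x)
      = L2_norm (\<lambda>x. \<i> / complex_of_real t * (U t f x - f x) - g x)" for t
  proof -
    define k where "k = \<i> / complex_of_real t"
    note Utf = UL[OF f, where t=t]
    have d: "(\<lambda>x. 1 * U t f x + (- 1) * f x) \<in> L2" using L2_diff[OF UL[OF f] f] by simp
    have e: "(\<lambda>x. k * (1 * U t f x + (- 1) * f x) + (- 1) * g x) \<in> L2"
      using L2_diff[OF L2_cmult[OF d] g] by simp
    have "AE x in lebesgue. k * (U t (U s f) x - U s f x) - U s g x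
        = U s (\<lambda>x. k * (1 * U t f x + (- 1) * f x) + (- 1) * g x) x"
      using unitary_groupD(3)[OF U d g, of s k "-1"] unitary_groupD(3)[OF U Utf f, of s 1 "-1"]
        unitary_groupD(5)[OF U f, of s t] unitary_groupD(5)[OF U f, of t s]
      by eventually_elim (simp add: add.commute[of s t])
    then have "L2_norm (\<lambda>x. k * (U t (U s f) x - U s f x) - U s g x)
       = L2_norm (U s (\<lambda>x. k * (1 * U t f x + (- 1) * f x) + (- 1) * g x))"
      by (intro L2_norm_cong_AE L2_diff L2_cmult UL f g e)
    also have "\<dots> = L2_norm (\<lambda>x. k * (1 * U t f x + (- 1) * f x) + (- 1) * g x)"
      by (rule unitary_groupD(2)[OF U e])
    finally show ?thesis by (simp add: k_def)
  qed
  then show ?thesis using lim by (simp add: group_generator_def UL f g)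
qed

section \<open>Finite energy is preserved by the evolution\<close>

context energy_form
begin

text \<open>The group is moved to the other side of the inner product with
  \<open>Bop \<phi>\<close>. It commutes with the closed operator and preserves inner products, so
  U(-t) \<open>\<phi>\<close> has the same form as \<open>\<phi>\<close>, and the functional bound
  holds with a constant independent of \<open>t\<close>. This uniformity later bounds the currents
  in time. The function \<open>w\<close> stands for any representative of the evolved state.\<close>

lemma evolution_finite_energy:
  assumes U: "unitary_group U" and gen: "group_generator U = graph_closure (hamiltonian V)"
    and u: "finite_energy V u"
  obtains M where "\<And>t w. w \<in> L2 \<Longrightarrow> AE x in lebesgue. w x = U t u x \<Longrightarrow>
    \<exists>\<phi> g. H1_limit \<phi> w g \<and> (\<forall>n. form (\<phi> n) \<le> M)"
proof -
  have uL: "u \<in> L2" using u by (simp add: finite_energy_def)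
  obtain M where M: "M \<ge> 0" "\<And>\<phi>. \<phi> \<in> test_functions \<Longrightarrow> cmod (L2_inner (Bop \<phi>) u) \<le> M * sqrt (form \<phi>)"
    using finite_energy_functional_bound[OF u] by blast
  note UL = unitary_groupD(1)[OF U]
  have "\<exists>\<phi> g. H1_limit \<phi> w g \<and> (\<forall>n. form (\<phi> n) \<le> (2 * M + 1)\<^sup>2)"
    if w: "w \<in> L2" and eq: "AE x in lebesgue. w x = U t u x" for t w
  proof -
    have "cmod (L2_inner (Bop \<phi>) w) \<le> M * sqrt (form \<phi>)" if \<phi>: "\<phi> \<in> test_functions" for \<phi>
    proof -
      define f h where "f = U (- t) \<phi>" and "h = U (- t) (Ham \<phi>)"
      note \<phi>L = test_functions_L2[OF \<phi>] and HL = Ham_L2[OF \<phi>]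
      have "(\<phi>, Ham \<phi>) \<in> graph_closure (hamiltonian V)"
        unfolding graph_closure_def mem_Collect_eq prod.case
        by (intro conjI \<phi>L HL, rule exI[of _ "\<lambda>n. \<phi>"], rule exI[of _ "\<lambda>n. Ham \<phi>"])
          (use \<phi> in \<open>auto simp: hamiltonian_eq L2_norm_def\<close>)
      then have fh: "(f, h) \<in> graph_closure (hamiltonian V)"
        using group_generator_invariant[OF U] unfolding gen[symmetric] f_def h_def by blast
      have UB: "AE x in lebesgue. U (- t) (Bop \<phi>) x = h x + of_real c * f x"
        using unitary_groupD(3)[OF U HL \<phi>L, of "- t" 1 "of_real c"]
        by (simp add: f_def h_def Bop_def[abs_def])
      have fL: "f \<in> L2" "h \<in> L2" unfolding f_def h_def by (intro UL \<phi>L HL)+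
      have hL: "(\<lambda>x. h x + of_real c * f x) \<in> L2" by (intro L2_add L2_cmult fL)
      have "L2_inner (Bop \<phi>) w = L2_inner (Bop \<phi>) (U t u)"
        by (rule L2_inner_cong_AE) (auto intro: UL uL w eq Bop_L2 \<phi>)
      also have "\<dots> = L2_inner (U (- t) (Bop \<phi>)) u"
        by (rule unitary_group_inner_adjoint[OF U Bop_L2[OF \<phi>] uL])
      also have "\<dots> = L2_inner (\<lambda>x. h x + of_real c * f x) u"
        by (rule L2_inner_cong_AE[OF _ uL hL uL UB]) (auto intro: UL Bop_L2 \<phi>)
      finally have 1: "cmod (L2_inner (Bop \<phi>) w) = cmod (L2_inner (\<lambda>x. h x + of_real c * f x) u)" by simp
      have "L2_inner (\<lambda>x. h x + of_real c * f x) f = L2_inner (U (- t) (Bop \<phi>)) (U (- t) \<phi>)"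
        by (rule L2_inner_cong_AE[OF hL fL(1)]) (use UB in \<open>auto simp: f_def intro: UL Bop_L2 \<phi> \<phi>L\<close>)
      also have "\<dots> = L2_inner (Bop \<phi>) \<phi>" by (rule unitary_group_inner[OF U Bop_L2[OF \<phi>] \<phi>L])
      finally have 2: "Re (L2_inner (\<lambda>x. h x + of_real c * f x) f) = form \<phi>" by (simp add: form_def)
      show ?thesis using closure_bounds(2)[OF fh uL M(2)] unfolding 1 2 by blast
    qed
    then show ?thesis using energy_approximation[OF w M(1)] by metis
  qed
  then show ?thesis using that by blast
qed

end

section \<open>Chain rule and restriction to components\<close>

lemma H1_limit_subseq:
  assumes "H1_limit \<phi> u g" "strict_mono r"
  shows "H1_limit (\<lambda>n. \<phi> (r n)) u g"
  using assms LIMSEQ_subseq_LIMSEQ[OF _ assms(2)] unfolding H1_limit_def o_def by blast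

lemma H1_limit_AE_subseq:
  assumes u: "H1_limit \<phi> u g" and v: "H1_limit \<eta> v k"
  obtains \<phi>' \<eta>' where "H1_limit \<phi>' u g" "H1_limit \<eta>' v k"
    "AE x in lebesgue. (\<lambda>n. \<phi>' n x) \<longlonglongrightarrow> u x" "AE x in lebesgue. (\<lambda>n. \<eta>' n x) \<longlonglongrightarrow> v x"
proof -
  obtain r :: "nat \<Rightarrow> nat" where r: "strict_mono r" "AE x in lebesgue. (\<lambda>n. \<phi> (r n) x) \<longlonglongrightarrow> u x"
    using L2_AE_subseq[OF test_functions_L2[OF H1_limitD(1)[OF u]] H1_limitD(2,4)[OF u]] by blast
  have v': "H1_limit (\<lambda>n. \<eta> (r n)) v k" by (rule H1_limit_subseq[OF v r(1)])
  obtain s :: "nat \<Rightarrow> nat" where s: "strict_mono s" "AE x in lebesgue. (\<lambda>n. \<eta> (r (s n)) x) \<longlonglongrightarrow> v x"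
    using L2_AE_subseq[OF test_functions_L2[OF H1_limitD(1)[OF v']] H1_limitD(2,4)[OF v']] by blast
  have "AE x in lebesgue. (\<lambda>n. \<phi> (r (s n)) x) \<longlonglongrightarrow> u x"
    using r(2) by eventually_elim (use LIMSEQ_subseq_LIMSEQ[OF _ s(1)] in \<open>simp add: o_def\<close>)
  then show ?thesis
    using that[OF H1_limit_subseq[OF H1_limit_subseq[OF u r(1)] s(1)] H1_limit_subseq[OF v' s(1)]] s(2) by blast
qed

lemma integral_tendsto_of_bound:
  fixes a :: "nat \<Rightarrow> 'a \<Rightarrow> 'b::{banach, second_countable_topology}"
  assumes a: "\<And>n. integrable M (a n)" "integrable M a'"
    and b: "\<And>n. integrable M (b n)" "\<And>n. AE x in M. norm (a n x - a' x) \<le> b n x" "\<And>n. integral\<^sup>L M (b n) \<le> c n"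
    and c: "c \<longlonglongrightarrow> 0"
  shows "(\<lambda>n. integral\<^sup>L M (a n)) \<longlonglongrightarrow> integral\<^sup>L M a'"
proof -
  have "norm (integral\<^sup>L M (a n) - integral\<^sup>L M a') \<le> c n" for n
  proof -
    have "norm (integral\<^sup>L M (a n) - integral\<^sup>L M a') = norm (LINT x|M. a n x - a' x)" using a by simp
    also have "\<dots> \<le> (LINT x|M. norm (a n x - a' x))" by (rule integral_norm_bound)
    also have "\<dots> \<le> integral\<^sup>L M (b n)" using a b by (intro integral_mono_AE) auto
    finally show ?thesis using b(3)[of n] by linarith
  qed
  then have "(\<lambda>n. integral\<^sup>L M (a n) - integral\<^sup>L M a') \<longlonglongrightarrow> 0"
    by (intro Lim_null_comparison[OF always_eventually c] allI)
  then show ?thesis by (simp add: LIM_zero_iff)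
qed

text \<open>The maps are differentiable in the real sense only, since they involve moduli and
  conjugates. Two complex arguments are needed to compare two states; functions of a single state
  are applied to the pair (u, u).\<close>

locale C1_bounded =
  fixes F :: "complex \<times> complex \<Rightarrow> complex" and F' :: "complex \<times> complex \<Rightarrow> complex \<times> complex \<Rightarrow> complex" and C :: real
  assumes deriv: "(F has_derivative F' p) (at p)"
    and cont: "continuous_on UNIV (\<lambda>p. F' p h)"
    and bound: "cmod (F' p h) \<le> C * (cmod (fst h) + cmod (snd h))"
begin

lemma C_nonneg: "C \<ge> 0"
  using order_trans[OF norm_ge_zero bound[of "(0,0)" "(1,0)"]] by simp

lemma F'_linear: "linear (F' p)"
  by (rule has_derivative_linear[OF deriv])

text \<open>Reduces continuity and measurability for a varying direction to the fixed basis
  directions, for which the locale assumes continuity.\<close>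

lemma F'_representation: "F' p h = (\<Sum>b\<in>Basis. (h \<bullet> b) *\<^sub>R F' p b)"
proof -
  have "F' p h = F' p (\<Sum>b\<in>Basis. (h \<bullet> b) *\<^sub>R b)" by (simp add: euclidean_representation)
  then show ?thesis by (simp add: linear_sum[OF F'_linear] linear_scale[OF F'_linear])
qed

lemma continuous_F': "continuous_on S P \<Longrightarrow> continuous_on S H \<Longrightarrow> continuous_on S (\<lambda>x. F' (P x) (H x))"
  by (subst F'_representation)
    (intro continuous_intros continuous_on_compose2[OF cont], auto)

lemma measurable_F':
  assumes "P \<in> borel_measurable M" "H \<in> borel_measurable M"
  shows "(\<lambda>x. F' (P x) (H x)) \<in> borel_measurable M"
proof -
  have "(\<lambda>x. F' (P x) b) \<in> borel_measurable M" for b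
    using measurable_compose[OF assms(1) borel_measurable_continuous_onI[OF cont]] .
  then show ?thesis
    by (subst F'_representation) (intro borel_measurable_sum borel_measurable_scaleR borel_measurable_inner assms borel_measurable_const)
qed

lemma F_lipschitz: "cmod (F p - F q) \<le> 2 * C * (cmod (fst p - fst q) + cmod (snd p - snd q))"
proof -
  have "norm (F p - F q) \<le> 2 * C * norm (p - q)"
  proof (rule differentiable_bound[of UNIV])
    fix x show "(F has_derivative F' x) (at x within UNIV)" using deriv by simp
    show "onorm (F' x) \<le> 2 * C"
    proof (rule onorm_bound)
      fix h :: "complex \<times> complex"
      have "cmod (fst h) + cmod (snd h) \<le> 2 * norm h"
        using norm_fst_le[of "fst h" "snd h"] norm_snd_le[of "snd h" "fst h"] by simp
      from mult_left_mono[OF this C_nonneg] show "norm (F' x h) \<le> 2 * C * norm h"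
        using bound[of x h] by linarith
    qed (use C_nonneg in simp)
  qed auto
  also have "\<dots> \<le> 2 * C * (cmod (fst p - fst q) + cmod (snd p - snd q))"
  proof (rule mult_left_mono)
    show "norm (p - q) \<le> cmod (fst p - fst q) + cmod (snd p - snd q)"
      unfolding minus_prod_def by (rule norm_Pair_le)
  qed (use C_nonneg in simp)
  finally show ?thesis .
qed

lemma F_continuous: "continuous_on UNIV F"
  by (intro continuous_at_imp_continuous_on ballI has_derivative_continuous[OF deriv])

lemma smooth_chain:
  assumes \<phi>: "\<phi> \<in> test_functions" and \<eta>: "\<eta> \<in> test_functions"
  shows "partial_deriv i (\<lambda>x. F (\<phi> x, \<eta> x)) x = F' (\<phi> x, \<eta> x) (partial_deriv i \<phi> x, partial_deriv i \<eta> x)"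
    and "Ck 1 (\<lambda>x. F (\<phi> x, \<eta> x))"
proof -
  have d: "((\<lambda>x. F (\<phi> x, \<eta> x)) has_derivative
     (\<lambda>h. F' (\<phi> x, \<eta> x) (frechet_derivative \<phi> (at x) h, frechet_derivative \<eta> (at x) h))) (at x)" for x
  proof -
    have "((\<lambda>x. (\<phi> x, \<eta> x)) has_derivative
     (\<lambda>h. (frechet_derivative \<phi> (at x) h, frechet_derivative \<eta> (at x) h))) (at x)"
      using test_functions_differentiable[OF \<phi>] test_functions_differentiable[OF \<eta>]
      by (intro has_derivative_Pair) (auto simp: frechet_derivative_works)
    from diff_chain_at[OF this deriv] show ?thesis by (simp add: o_def)
  qed
  show p: "partial_deriv i (\<lambda>x. F (\<phi> x, \<eta> x)) x = F' (\<phi> x, \<eta> x) (partial_deriv i \<phi> x, partial_deriv i \<eta> x)" for i x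
    using partial_deriv_eq[OF d] by (simp add: partial_deriv_def)
  have c: "continuous_on UNIV \<theta>" if "\<theta> \<in> test_functions" for \<theta> :: "real^'a \<Rightarrow> complex"
    by (rule Ck_imp_continuous[OF test_functions_Ck[OF that]])
  have "continuous_on UNIV (\<lambda>x. F' (\<phi> x, \<eta> x) (partial_deriv i \<phi> x, partial_deriv i \<eta> x))" for i
    by (intro continuous_F' continuous_on_Pair c test_functions_partial_deriv \<phi> \<eta>)
  then show "Ck 1 (\<lambda>x. F (\<phi> x, \<eta> x))"
    using d unfolding One_nat_def by (auto simp: p[abs_def] differentiable_def)
qed

text \<open>The composite with \<open>F\<close> is merely C1 and equals F(0,0) at infinity, so it
  need not be a test function; compact support comes from \<open>\<theta>\<close> alone.\<close>

lemma smooth_chain_by_parts: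
  fixes \<theta> :: "real^'d::finite \<Rightarrow> real"
  assumes \<phi>: "\<phi> \<in> test_functions" and \<eta>: "\<eta> \<in> test_functions" and \<theta>: "\<theta> \<in> test_functions"
  shows "integrable lebesgue (\<lambda>x. partial_deriv i \<theta> x *\<^sub>R F (\<phi> x, \<eta> x))"
    and "integrable lebesgue (\<lambda>x. \<theta> x *\<^sub>R F' (\<phi> x, \<eta> x) (partial_deriv i \<phi> x, partial_deriv i \<eta> x))"
    and "(LINT x|lebesgue. partial_deriv i \<theta> x *\<^sub>R F (\<phi> x, \<eta> x))
      = - (LINT x|lebesgue. \<theta> x *\<^sub>R F' (\<phi> x, \<eta> x) (partial_deriv i \<phi> x, partial_deriv i \<eta> x))"
proof -
  let ?G = "\<lambda>x. F (\<phi> x, \<eta> x)" and ?D = "\<lambda>x. F' (\<phi> x, \<eta> x) (partial_deriv i \<phi> x, partial_deriv i \<eta> x)"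
  have C1: "Ck 1 ?G" and pG: "partial_deriv i ?G = ?D"
    using smooth_chain[OF \<phi> \<eta>] by (blast, blast)
  have cG: "continuous_on UNIV ?G" by (rule Ck_imp_continuous[OF C1])
  have cD: "continuous_on UNIV ?D" using C1 unfolding pG[symmetric] by simp
  have int: "integrable lebesgue (\<lambda>x. \<tau> x *\<^sub>R h x)" if "\<tau> \<in> test_functions" "continuous_on UNIV h"
    for \<tau> :: "real^'d \<Rightarrow> real" and h :: "real^'d \<Rightarrow> complex"
    by (rule integrable_continuous_compact_supp,
        rule continuous_on_scaleR[OF Ck_imp_continuous[OF test_functions_Ck[OF that(1)]] that(2)],
        rule compact_supp[OF test_functions_compact[OF that(1)] supp_mono]) simp
  show i1: "integrable lebesgue (\<lambda>x. partial_deriv i \<theta> x *\<^sub>R ?G x)"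
    and i2: "integrable lebesgue (\<lambda>x. \<theta> x *\<^sub>R ?D x)"
    by (intro int test_functions_partial_deriv \<theta> cG cD)+
  have dG: "?G differentiable at x" for x using C1 by simp
  have "(LINT x|lebesgue. partial_deriv i (\<lambda>x. \<theta> x *\<^sub>R ?G x) x) = 0"
  proof (rule integral_partial_deriv_eq_0)
    show "Ck 1 (\<lambda>x. \<theta> x *\<^sub>R ?G x)" by (intro Ck_scaleR test_functions_Ck \<theta> C1)
    show "compact (supp (\<lambda>x. \<theta> x *\<^sub>R ?G x))"
      by (rule compact_supp[OF test_functions_compact[OF \<theta>] supp_mono]) simp
  qed
  also have "(\<lambda>x. partial_deriv i (\<lambda>x. \<theta> x *\<^sub>R ?G x) x) = (\<lambda>x. \<theta> x *\<^sub>R ?D x + partial_deriv i \<theta> x *\<^sub>R ?G x)"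
    by (rule ext, subst partial_deriv_bilinear[OF bounded_bilinear_scaleR test_functions_differentiable[OF \<theta>] dG])
      (simp only: pG)
  finally show "(LINT x|lebesgue. partial_deriv i \<theta> x *\<^sub>R ?G x) = - (LINT x|lebesgue. \<theta> x *\<^sub>R ?D x)"
    using i1 i2 by (simp add: eq_neg_iff_add_eq_0 add.commute)
qed

lemma L2_F'_integrable:
  fixes \<theta> :: "real^'d::finite \<Rightarrow> real"
  assumes "P \<in> borel_measurable lebesgue" and a: "a \<in> L2" and b: "b \<in> L2" and \<theta>: "\<theta> \<in> test_functions"
  shows "integrable lebesgue (\<lambda>x. \<theta> x *\<^sub>R F' (P x) (a x, b x))"
    and "integrable lebesgue (\<lambda>x. C * (\<bar>\<theta> x\<bar> * cmod (a x) + \<bar>\<theta> x\<bar> * cmod (b x)))"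
    and "cmod (\<theta> x *\<^sub>R F' (P x) (a x, b x)) \<le> C * (\<bar>\<theta> x\<bar> * cmod (a x) + \<bar>\<theta> x\<bar> * cmod (b x))"
proof -
  have T: "(\<lambda>x. complex_of_real (\<theta> x)) \<in> L2" by (rule test_functions_L2[OF test_functions_of_real(1)[OF \<theta>]])
  show i: "integrable lebesgue (\<lambda>x. C * (\<bar>\<theta> x\<bar> * cmod (a x) + \<bar>\<theta> x\<bar> * cmod (b x)))"
    using L2_prod_integrable(1)[OF T a] L2_prod_integrable(1)[OF T b] by simp
  show le: "cmod (\<theta> x *\<^sub>R F' (P x) (a x, b x)) \<le> C * (\<bar>\<theta> x\<bar> * cmod (a x) + \<bar>\<theta> x\<bar> * cmod (b x))" for x
    using mult_left_mono[OF bound[of "P x" "(a x, b x)"] abs_ge_zero[of "\<theta> x"]] by (simp add: algebra_simps)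
  have "(\<lambda>x. \<theta> x *\<^sub>R F' (P x) (a x, b x)) \<in> borel_measurable lebesgue"
    by (intro borel_measurable_scaleR measurable_F' assms(1) borel_measurable_Pair L2_measurable a b
        borel_measurable_integrable test_functions_integrable \<theta>)
  then show "integrable lebesgue (\<lambda>x. \<theta> x *\<^sub>R F' (P x) (a x, b x))"
    by (rule Bochner_Integration.integrable_bound[OF i]) (use le C_nonneg in \<open>auto intro!: AE_I2 simp: abs_of_nonneg\<close>)
qed

lemma L2_F_integrable:
  fixes \<theta> :: "real^'d::finite \<Rightarrow> real"
  assumes u: "u \<in> L2" and v: "v \<in> L2" and \<theta>: "\<theta> \<in> test_functions"
  shows "integrable lebesgue (\<lambda>x. \<theta> x *\<^sub>R F (u x, v x))"
proof -
  have T: "(\<lambda>x. complex_of_real (\<theta> x)) \<in> L2" by (rule test_functions_L2[OF test_functions_of_real(1)[OF \<theta>]])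
  have i: "integrable lebesgue (\<lambda>x. cmod (F (0,0)) * \<bar>\<theta> x\<bar> + 2 * C * (\<bar>\<theta> x\<bar> * cmod (u x) + \<bar>\<theta> x\<bar> * cmod (v x)))"
    using L2_prod_integrable(1)[OF T u] L2_prod_integrable(1)[OF T v] test_functions_integrable[OF \<theta>] by simp
  have m: "(\<lambda>x. \<theta> x *\<^sub>R F (u x, v x)) \<in> borel_measurable lebesgue"
    by (intro borel_measurable_scaleR measurable_compose[OF _ borel_measurable_continuous_onI[OF F_continuous]]
        borel_measurable_Pair L2_measurable u v borel_measurable_integrable test_functions_integrable \<theta>)
  show ?thesis
  proof (rule Bochner_Integration.integrable_bound[OF i m], rule AE_I2)
    fix x
    have "cmod (F (u x, v x)) \<le> cmod (F (0,0)) + 2 * C * (cmod (u x) + cmod (v x))"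
      using F_lipschitz[of "(u x, v x)" "(0,0)"] norm_triangle_sub[of "F (u x, v x)" "F (0,0)"] by simp
    from mult_left_mono[OF this abs_ge_zero[of "\<theta> x"]]
    have "cmod (\<theta> x *\<^sub>R F (u x, v x)) \<le> cmod (F (0,0)) * \<bar>\<theta> x\<bar> + 2 * C * (\<bar>\<theta> x\<bar> * cmod (u x) + \<bar>\<theta> x\<bar> * cmod (v x))"
      by (simp add: algebra_simps)
    then show "cmod (\<theta> x *\<^sub>R F (u x, v x))
       \<le> norm (cmod (F (0,0)) * \<bar>\<theta> x\<bar> + 2 * C * (\<bar>\<theta> x\<bar> * cmod (u x) + \<bar>\<theta> x\<bar> * cmod (v x)))"
      by (rule order_trans) simp
  qed
qed

text \<open>By linearity of \<open>F' p\<close> the approximate gradient splits into the limit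
  gradient plus an error. The error term tends to 0 by the uniform bound on \<open>F'\<close> and L2
  convergence; the other term converges by dominated convergence, which is why the sequences are
  first made to converge almost everywhere.\<close>

lemma weak_chain_rule:
  fixes \<theta> :: "real^'d::finite \<Rightarrow> real"
  assumes "H1_limit \<phi>0 u g" "H1_limit \<eta>0 v k" and \<theta>: "\<theta> \<in> test_functions"
  shows "(LINT x|lebesgue. partial_deriv i \<theta> x *\<^sub>R F (u x, v x))
      = - (LINT x|lebesgue. \<theta> x *\<^sub>R F' (u x, v x) (g x $ i, k x $ i))"
proof -
  obtain \<phi> \<eta> where H: "H1_limit \<phi> u g" "H1_limit \<eta> v k"
    and ae: "AE x in lebesgue. (\<lambda>n. \<phi> n x) \<longlonglongrightarrow> u x" "AE x in lebesgue. (\<lambda>n. \<eta> n x) \<longlonglongrightarrow> v x"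
    using H1_limit_AE_subseq[OF assms(1,2)] by blast
  note t = H1_limitD(1)[OF H(1)] H1_limitD(1)[OF H(2)]
  note L = H1_limitD(2,3)[OF H(1)] H1_limitD(2,3)[OF H(2)]
  note tL = test_functions_L2[OF t(1)] test_functions_L2[OF t(2)]
  note dL = test_functions_L2[OF test_functions_partial_deriv[OF t(1)]] test_functions_L2[OF test_functions_partial_deriv[OF t(2)]]
  have d\<theta>: "partial_deriv i \<theta> \<in> test_functions" by (rule test_functions_partial_deriv[OF \<theta>])
  have T: "(\<lambda>x. complex_of_real (\<tau> x)) \<in> L2" if "\<tau> \<in> test_functions" for \<tau> :: "real^'d \<Rightarrow> real"
    by (rule test_functions_L2[OF test_functions_of_real(1)[OF that]])
  have pair: "integrable lebesgue (\<lambda>x. \<bar>\<tau> x\<bar> * cmod (f x))"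
    "(LINT x|lebesgue. \<bar>\<tau> x\<bar> * cmod (f x)) \<le> L2_norm (\<lambda>x. complex_of_real (\<tau> x)) * L2_norm f"
    if "\<tau> \<in> test_functions" "f \<in> L2" for \<tau> :: "real^'d \<Rightarrow> real" and f
    using L2_prod_integrable(1)[OF T[OF that(1)] that(2)] L2_norm_mult_le[OF T[OF that(1)] that(2)] by simp_all
  have lim1: "(\<lambda>n. LINT x|lebesgue. partial_deriv i \<theta> x *\<^sub>R F (\<phi> n x, \<eta> n x))
      \<longlonglongrightarrow> (LINT x|lebesgue. partial_deriv i \<theta> x *\<^sub>R F (u x, v x))"
  proof (rule integral_tendsto_of_bound)
    let ?b = "\<lambda>n x. 2 * C * (\<bar>partial_deriv i \<theta> x\<bar> * cmod (\<phi> n x - u x) + \<bar>partial_deriv i \<theta> x\<bar> * cmod (\<eta> n x - v x))"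
    let ?N = "L2_norm (\<lambda>x. complex_of_real (partial_deriv i \<theta> x))"
    let ?c = "\<lambda>n. 2 * C * (?N * L2_norm (\<lambda>x. \<phi> n x - u x) + ?N * L2_norm (\<lambda>x. \<eta> n x - v x))"
    note p = pair[OF d\<theta> L2_diff[OF tL(1) L(1)]] pair[OF d\<theta> L2_diff[OF tL(2) L(3)]]
    show "integrable lebesgue (?b n)" for n using p by simp
    show "integral\<^sup>L lebesgue (?b n) \<le> ?c n" for n
      using mult_left_mono[OF add_mono[OF p(2)[of n] p(4)[of n]], of "2 * C"] C_nonneg p(1,3) by simp
    show "AE x in lebesgue. norm (partial_deriv i \<theta> x *\<^sub>R F (\<phi> n x, \<eta> n x) - partial_deriv i \<theta> x *\<^sub>R F (u x, v x)) \<le> ?b n x" for n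
    proof (rule AE_I2)
      fix x
      show "norm (partial_deriv i \<theta> x *\<^sub>R F (\<phi> n x, \<eta> n x) - partial_deriv i \<theta> x *\<^sub>R F (u x, v x)) \<le> ?b n x"
        using mult_left_mono[OF F_lipschitz[of "(\<phi> n x, \<eta> n x)" "(u x, v x)"] abs_ge_zero[of "partial_deriv i \<theta> x"]]
        by (simp add: algebra_simps flip: scaleR_diff_right)
    qed
    have "?c \<longlonglongrightarrow> 2 * C * (?N * 0 + ?N * 0)"
      by (intro tendsto_intros H1_limitD(4)[OF H(1)] H1_limitD(4)[OF H(2)])
    then show "?c \<longlonglongrightarrow> 0" by simp
    show "integrable lebesgue (\<lambda>x. partial_deriv i \<theta> x *\<^sub>R F (\<phi> n x, \<eta> n x))" for n
      by (rule smooth_chain_by_parts(1)[OF t \<theta>])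
    show "integrable lebesgue (\<lambda>x. partial_deriv i \<theta> x *\<^sub>R F (u x, v x))"
      by (rule L2_F_integrable[OF L(1,3) d\<theta>])
  qed
  define Pn where "Pn n x = (\<phi> n x, \<eta> n x)" for n x
  have mP: "Pn n \<in> borel_measurable lebesgue" for n
    unfolding Pn_def by (intro borel_measurable_Pair L2_measurable tL)
  have mP': "(\<lambda>x. (u x, v x)) \<in> borel_measurable lebesgue"
    by (intro borel_measurable_Pair L2_measurable L)
  note I = L2_F'_integrable[OF mP L(2,4) \<theta>]
  have lim2: "(\<lambda>n. LINT x|lebesgue. \<theta> x *\<^sub>R F' (Pn n x) (g x $ i, k x $ i))
      \<longlonglongrightarrow> (LINT x|lebesgue. \<theta> x *\<^sub>R F' (u x, v x) (g x $ i, k x $ i))"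
  proof (rule integral_dominated_convergence[OF _ _ I(2)])
    show "AE x in lebesgue. (\<lambda>n. \<theta> x *\<^sub>R F' (Pn n x) (g x $ i, k x $ i)) \<longlonglongrightarrow> \<theta> x *\<^sub>R F' (u x, v x) (g x $ i, k x $ i)"
      using ae
    proof eventually_elim
      case (elim x)
      have l: "(\<lambda>n. Pn n x) \<longlonglongrightarrow> (u x, v x)" unfolding Pn_def by (intro tendsto_Pair elim)
      have "isCont (\<lambda>p. F' p (g x $ i, k x $ i)) (u x, v x)"
        using cont[of "(g x $ i, k x $ i)"] by (simp add: continuous_on_eq_continuous_at)
      from tendsto_scaleR[OF tendsto_const isCont_tendsto_compose[OF this l]] show ?case .
    qed
    show "AE x in lebesgue. cmod (\<theta> x *\<^sub>R F' (Pn n x) (g x $ i, k x $ i)) \<le> C * (\<bar>\<theta> x\<bar> * cmod (g x $ i) + \<bar>\<theta> x\<bar> * cmod (k x $ i))" for n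
      using I(3) by blast
    show "(\<lambda>x. \<theta> x *\<^sub>R F' (Pn n x) (g x $ i, k x $ i)) \<in> borel_measurable lebesgue" for n
      by (rule borel_measurable_integrable[OF I(1)])
    show "(\<lambda>x. \<theta> x *\<^sub>R F' (u x, v x) (g x $ i, k x $ i)) \<in> borel_measurable lebesgue"
      by (rule borel_measurable_integrable[OF L2_F'_integrable(1)[OF mP' L(2,4) \<theta>]])
  qed
  define a b where "a n x = partial_deriv i (\<phi> n) x - g x $ i" and "b n x = partial_deriv i (\<eta> n) x - k x $ i" for n x
  have ab: "a n \<in> L2" "b n \<in> L2" for n unfolding a_def b_def by (intro L2_diff dL L)+
  have lim3: "(\<lambda>n. LINT x|lebesgue. \<theta> x *\<^sub>R F' (Pn n x) (a n x, b n x)) \<longlonglongrightarrow> (LINT x|(lebesgue::(real^'d) measure). 0)"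
  proof (rule integral_tendsto_of_bound)
    note J = L2_F'_integrable[OF mP ab \<theta>]
    let ?N = "L2_norm (\<lambda>x. complex_of_real (\<theta> x))"
    let ?c = "\<lambda>n. C * (?N * L2_norm (a n) + ?N * L2_norm (b n))"
    note p = pair[OF \<theta> ab(1)] pair[OF \<theta> ab(2)]
    show "integrable lebesgue (\<lambda>x. \<theta> x *\<^sub>R F' (Pn n x) (a n x, b n x))" for n by (rule J(1))
    show "integrable lebesgue (\<lambda>x. C * (\<bar>\<theta> x\<bar> * cmod (a n x) + \<bar>\<theta> x\<bar> * cmod (b n x)))" for n by (rule J(2))
    show "AE x in lebesgue. cmod (\<theta> x *\<^sub>R F' (Pn n x) (a n x, b n x) - 0) \<le> C * (\<bar>\<theta> x\<bar> * cmod (a n x) + \<bar>\<theta> x\<bar> * cmod (b n x))" for n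
      using J(3) by simp
    show "(LINT x|lebesgue. C * (\<bar>\<theta> x\<bar> * cmod (a n x) + \<bar>\<theta> x\<bar> * cmod (b n x))) \<le> ?c n" for n
      using mult_left_mono[OF add_mono[OF p(2)[of n] p(4)[of n]] C_nonneg] p(1,3) by simp
    have "?c \<longlonglongrightarrow> C * (?N * 0 + ?N * 0)"
      unfolding a_def b_def by (intro tendsto_intros H1_limitD(5)[OF H(1)] H1_limitD(5)[OF H(2)])
    then show "?c \<longlonglongrightarrow> 0" by simp
  qed simp
  have "(LINT x|lebesgue. \<theta> x *\<^sub>R F' (\<phi> n x, \<eta> n x) (partial_deriv i (\<phi> n) x, partial_deriv i (\<eta> n) x))
     = (LINT x|lebesgue. \<theta> x *\<^sub>R F' (Pn n x) (a n x, b n x)) + (LINT x|lebesgue. \<theta> x *\<^sub>R F' (Pn n x) (g x $ i, k x $ i))" for n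
  proof -
    have "\<theta> x *\<^sub>R F' (\<phi> n x, \<eta> n x) (partial_deriv i (\<phi> n) x, partial_deriv i (\<eta> n) x)
       = \<theta> x *\<^sub>R F' (Pn n x) (a n x, b n x) + \<theta> x *\<^sub>R F' (Pn n x) (g x $ i, k x $ i)" for x
      using linear_add[OF F'_linear[of "Pn n x"], of "(a n x, b n x)" "(g x $ i, k x $ i)"]
      by (simp add: a_def b_def Pn_def flip: scaleR_add_right)
    then show ?thesis using L2_F'_integrable(1)[OF mP ab \<theta>] I(1) by simp
  qed
  then have "(\<lambda>n. LINT x|lebesgue. \<theta> x *\<^sub>R F' (\<phi> n x, \<eta> n x) (partial_deriv i (\<phi> n) x, partial_deriv i (\<eta> n) x))
      \<longlonglongrightarrow> (LINT x|lebesgue. \<theta> x *\<^sub>R F' (u x, v x) (g x $ i, k x $ i))"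
    using tendsto_add[OF lim3 lim2] by simp
  from tendsto_minus[OF this] have "(\<lambda>n. LINT x|lebesgue. partial_deriv i \<theta> x *\<^sub>R F (\<phi> n x, \<eta> n x))
      \<longlonglongrightarrow> - (LINT x|lebesgue. \<theta> x *\<^sub>R F' (u x, v x) (g x $ i, k x $ i))"
    unfolding smooth_chain_by_parts(3)[OF t \<theta>] .
  with lim1 show ?thesis by (rule LIMSEQ_unique)
qed

end

section \<open>Truncation of small values\<close>

lemma flat_exp_nonneg: "0 \<le> flat_exp k s"
  by (simp add: flat_exp_def)

lemma flat_exp_0_le_1: "flat_exp 0 s \<le> 1"
  by (simp add: flat_exp_def)

text \<open>With y = 1/s the claim reads y + y^2 \<le> 3 exp y, a consequence of the quadratic
  Taylor bound. It keeps the differential of the truncation bounded uniformly in the truncation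
  level.\<close>

lemma flat_exp_2_bound: "(s + 1) * flat_exp 2 s \<le> 3"
proof (cases "s > 0")
  case True
  define y where "y = 1 / s"
  have y: "y > 0" using True by (simp add: y_def)
  have "y + y\<^sup>2 \<le> 3 * exp y"
    using exp_lower_Taylor_quadratic[of y] y zero_le_power2[of y] by linarith
  then have "(y + y\<^sup>2) * exp (- y) \<le> 3" by (simp add: exp_minus divide_simps)
  moreover have "(s + 1) * flat_exp 2 s = (y + y\<^sup>2) * exp (- y)"
    using True by (simp add: flat_exp_def y_def field_simps power2_eq_square)
  ultimately show ?thesis by simp
qed (simp add: flat_exp_def)

lemma flat_exp_0_at_top: "(flat_exp 0 \<longlongrightarrow> 1) at_top"
proof (rule Lim_transform_eventually)
  have "((\<lambda>s::real. exp (- 1 / s)) \<longlongrightarrow> exp 0) at_top"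
    by (intro tendsto_exp real_tendsto_divide_at_top[OF tendsto_const filterlim_ident])
  then show "((\<lambda>s::real. exp (- 1 / s)) \<longlongrightarrow> 1) at_top" by simp
  show "\<forall>\<^sub>F s in at_top. exp (- 1 / s) = flat_exp 0 s"
    using eventually_gt_at_top[of 0] by eventually_elim (simp add: flat_exp_def)
qed

lemma flat_exp_2_at_top: "((\<lambda>s. (s + 1) * flat_exp 2 s) \<longlongrightarrow> 0) at_top"
proof (rule tendsto_sandwich[OF _ _ tendsto_const])
  show "((\<lambda>s::real. 2 / s) \<longlongrightarrow> 0) at_top"
    by (rule real_tendsto_divide_at_top[OF tendsto_const filterlim_ident])
  show "\<forall>\<^sub>F s in at_top. (s + 1) * flat_exp 2 s \<le> 2 / s"
    using eventually_ge_at_top[of 1]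
  proof eventually_elim
    case (elim s)
    have "(s + 1) * flat_exp 2 s \<le> (s + 1) * (1 / s\<^sup>2)"
      using elim by (intro mult_left_mono) (auto simp: flat_exp_def divide_simps)
    also have "\<dots> \<le> (2 * s) * (1 / s\<^sup>2)" using elim by (intro mult_right_mono) auto
    also have "\<dots> = 2 / s" using elim by (simp add: power2_eq_square)
    finally show ?case .
  qed
  show "\<forall>\<^sub>F s in at_top. 0 \<le> (s + 1) * flat_exp 2 s"
    using eventually_ge_at_top[of 0] by eventually_elim (simp add: flat_exp_nonneg)
qed

text \<open>After truncation the state vanishes near the boundary of a component, so that only compact
  subsets of the component matter, where a smooth cutoff is available.\<close>

definition trunc :: "real \<Rightarrow> complex \<times> complex \<Rightarrow> complex" where
  "trunc l p = flat_exp 0 (l * (fst p \<bullet> fst p) - 1) *\<^sub>R fst p"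

definition trunc' :: "real \<Rightarrow> complex \<times> complex \<Rightarrow> complex \<times> complex \<Rightarrow> complex" where
  "trunc' l p h = (flat_exp 2 (l * (fst p \<bullet> fst p) - 1) * (2 * l * (fst p \<bullet> fst h))) *\<^sub>R fst p
     + flat_exp 0 (l * (fst p \<bullet> fst p) - 1) *\<^sub>R fst h"

text \<open>Differentiating the cutoff factor produces l |z|^2, which is s + 1 for the argument s of
  the flat functions; hence the shape of the right-hand side.\<close>

lemma trunc'_first_bound:
  assumes "l \<ge> 0"
  shows "cmod ((flat_exp 2 (l * (z \<bullet> z) - 1) * (2 * l * (z \<bullet> h))) *\<^sub>R z)
     \<le> 2 * ((l * (z \<bullet> z) - 1 + 1) * flat_exp 2 (l * (z \<bullet> z) - 1)) * cmod h"
proof -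
  define s where "s = flat_exp 2 (l * (z \<bullet> z) - 1)"
  have s: "s \<ge> 0" by (simp add: s_def flat_exp_nonneg)
  have "cmod ((s * (2 * l * (z \<bullet> h))) *\<^sub>R z) = 2 * s * l * (\<bar>z \<bullet> h\<bar> * cmod z)"
    using s assms by (simp add: abs_mult)
  also have "\<dots> \<le> 2 * s * l * ((cmod z * cmod h) * cmod z)"
    using s assms by (intro mult_left_mono mult_right_mono Cauchy_Schwarz_ineq2) auto
  also have "\<dots> = 2 * (l * (z \<bullet> z) * s) * cmod h"
    by (simp add: power2_norm_eq_inner[symmetric] power2_eq_square)
  finally show ?thesis by (simp add: s_def)
qed

text \<open>The constant is 7 = 2 * 3 + 1. Its independence of \<open>l\<close> allows dominated
  convergence when the truncation is removed.\<close>

lemma trunc_C1_bounded: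
  assumes l: "l \<ge> 0"
  shows "C1_bounded (trunc l) (trunc' l) 7"
proof
  fix p h
  let ?s = "\<lambda>p::complex \<times> complex. l * (fst p \<bullet> fst p) - 1"
  have "(?s has_derivative (\<lambda>h. 2 * l * (fst p \<bullet> fst h))) (at p)"
    by (auto intro!: derivative_eq_intros simp: inner_commute)
  from DERIV_compose_FDERIV[OF DERIV_flat_exp[of 0] this]
  have "((\<lambda>p. flat_exp 0 (?s p)) has_derivative (\<lambda>h. 2 * l * (fst p \<bullet> fst h) * flat_exp 2 (?s p))) (at p)"
    by (simp add: numeral_2_eq_2)
  from has_derivative_scaleR[OF this has_derivative_fst[OF has_derivative_ident]]
  show "(trunc l has_derivative trunc' l p) (at p)"
    unfolding trunc_def[abs_def] trunc'_def by (simp add: add.commute mult_ac)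
  show "continuous_on UNIV (\<lambda>p. trunc' l p h)"
    unfolding trunc'_def by (intro continuous_intros continuous_flat_exp)
  have "cmod (trunc' l p h) \<le> 2 * ((?s p + 1) * flat_exp 2 (?s p)) * cmod (fst h) + flat_exp 0 (?s p) * cmod (fst h)"
    unfolding trunc'_def using trunc'_first_bound[OF l, of "fst p" "fst h"]
    by (intro order_trans[OF norm_triangle_ineq] add_mono) (auto simp: flat_exp_nonneg)
  also have "\<dots> \<le> 2 * 3 * cmod (fst h) + 1 * cmod (fst h)"
    by (intro add_mono mult_right_mono mult_left_mono flat_exp_2_bound flat_exp_0_le_1) auto
  also have "\<dots> \<le> 7 * (cmod (fst h) + cmod (snd h))" by simp
  finally show "cmod (trunc' l p h) \<le> 7 * (cmod (fst h) + cmod (snd h))" .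
qed

lemma scaled_at_top:
  fixes z :: complex
  assumes "z \<noteq> 0"
  shows "filterlim (\<lambda>n. real n * (z \<bullet> z) - 1) at_top sequentially"
proof -
  have "filterlim (\<lambda>n. - 1 + (z \<bullet> z) * real n) at_top sequentially"
    using assms by (intro filterlim_tendsto_add_at_top[OF tendsto_const]
        filterlim_tendsto_pos_mult_at_top[OF tendsto_const _ filterlim_real_sequentially]) auto
  then show ?thesis by (simp add: algebra_simps)
qed

lemma trunc_tendsto: "(\<lambda>n. trunc (real n) (z, w)) \<longlonglongrightarrow> z"
proof (cases "z = 0")
  case False
  have "(\<lambda>n. flat_exp 0 (real n * (z \<bullet> z) - 1) *\<^sub>R z) \<longlonglongrightarrow> 1 *\<^sub>R z"
    by (intro tendsto_scaleR tendsto_const filterlim_compose[OF flat_exp_0_at_top scaled_at_top[OF False]])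
  then show ?thesis by (simp add: trunc_def)
qed (simp add: trunc_def)

text \<open>At z = 0 the limit would be 0 instead of \<open>h\<close>. On a component of the set of
  positive density this case does not occur.\<close>

lemma trunc'_tendsto:
  assumes "z \<noteq> 0"
  shows "(\<lambda>n. trunc' (real n) (z, w) (h, k)) \<longlonglongrightarrow> h"
proof -
  note top = scaled_at_top[OF assms]
  have "(\<lambda>n. (flat_exp 2 (real n * (z \<bullet> z) - 1) * (2 * real n * (z \<bullet> h))) *\<^sub>R z) \<longlonglongrightarrow> 0"
  proof (rule Lim_null_comparison)
    show "\<forall>\<^sub>F n in sequentially. cmod ((flat_exp 2 (real n * (z \<bullet> z) - 1) * (2 * real n * (z \<bullet> h))) *\<^sub>R z)
      \<le> 2 * ((real n * (z \<bullet> z) - 1 + 1) * flat_exp 2 (real n * (z \<bullet> z) - 1)) * cmod h"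
      by (intro always_eventually allI trunc'_first_bound) simp
    have "(\<lambda>n. 2 * ((real n * (z \<bullet> z) - 1 + 1) * flat_exp 2 (real n * (z \<bullet> z) - 1)) * cmod h) \<longlonglongrightarrow> 2 * 0 * cmod h"
      by (intro tendsto_mult tendsto_const filterlim_compose[OF flat_exp_2_at_top top])
    then show "(\<lambda>n. 2 * ((real n * (z \<bullet> z) - 1 + 1) * flat_exp 2 (real n * (z \<bullet> z) - 1)) * cmod h) \<longlonglongrightarrow> 0"
      by simp
  qed
  moreover have "(\<lambda>n. flat_exp 0 (real n * (z \<bullet> z) - 1) *\<^sub>R h) \<longlonglongrightarrow> 1 *\<^sub>R h"
    by (intro tendsto_scaleR tendsto_const filterlim_compose[OF flat_exp_0_at_top top])
  ultimately show ?thesis using tendsto_add unfolding trunc'_def by force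
qed

lemma trunc_eq_0: "l * (cmod z)\<^sup>2 \<le> 1 \<Longrightarrow> trunc l (z, w) = 0" "l * (cmod z)\<^sup>2 \<le> 1 \<Longrightarrow> trunc' l (z, w) h = 0"
  by (auto simp: trunc_def trunc'_def flat_exp_def power2_norm_eq_inner)

text \<open>A component is relatively closed in the set where \<open>r\<close> is nonzero, and a
  superlevel set is closed and contained in that set. So the intersection is closed in the whole
  space, however closely the component approaches others.\<close>

lemma closed_component_superlevel:
  fixes r :: "'a::real_normed_vector \<Rightarrow> real"
  assumes r: "continuous_on UNIV r" and \<Omega>: "\<Omega> \<in> components {x. r x \<noteq> 0}" and "\<epsilon> > 0"
  shows "closed (\<Omega> \<inter> {x. \<epsilon> \<le> r x})"
proof -
  let ?O = "{x. r x \<noteq> 0}" and ?S = "{x. \<epsilon> \<le> r x}"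
  have S: "closed ?S" by (intro closed_Collect_le continuous_on_const r)
  obtain T where T: "closed T" "\<Omega> = ?O \<inter> T"
    using closedin_component[OF \<Omega>] unfolding closedin_closed by blast
  have "\<Omega> \<inter> ?S = T \<inter> ?S" using T(2) \<open>\<epsilon> > 0\<close> by auto
  then show ?thesis using T(1) S by auto
qed

text \<open>The restriction of \<open>u\<close> to a component has the restricted gradient: no
  boundary term appears because the density vanishes on the boundary. For the truncated state the
  indicator of the component may be replaced by a smooth cutoff, which is absorbed into the test
  function; then the truncation is removed.\<close>

lemma weak_gradient_component:
  fixes r :: "real^'d::finite \<Rightarrow> real"
  assumes H: "H1_limit \<phi> u g" and r: "continuous_on UNIV r" and ur: "AE x in lebesgue. (cmod (u x))\<^sup>2 = r x"
    and \<Omega>: "\<Omega> \<in> components {x. r x \<noteq> 0}" and \<theta>: "\<theta> \<in> test_functions"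
  shows "(LINT x|lebesgue. partial_deriv i \<theta> x *\<^sub>R (indicator \<Omega> x *\<^sub>R u x))
     = - (LINT x|lebesgue. \<theta> x *\<^sub>R (indicator \<Omega> x *\<^sub>R g x $ i))"
proof -
  have "open {x. r x \<noteq> 0}" by (intro open_Collect_neq r continuous_on_const)
  then have op: "open \<Omega>" using open_components \<Omega> by blast
  have \<Omega>m: "\<Omega> \<in> sets lebesgue" using op by simp
  have sub: "\<Omega> \<subseteq> {x. r x \<noteq> 0}" by (rule in_components_subset[OF \<Omega>])
  note uL = H1_limitD(2)[OF H] and gL = H1_limitD(3)[OF H, of i]
  have m: "u \<in> borel_measurable lebesgue" "(\<lambda>x. g x $ i) \<in> borel_measurable lebesgue"
    by (rule L2_measurable[OF uL], rule L2_measurable[OF gL])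
  have mP: "(\<lambda>x. (u x, u x)) \<in> borel_measurable lebesgue" by (intro borel_measurable_Pair m)
  have \<theta>m: "\<theta> \<in> borel_measurable lebesgue" "partial_deriv i \<theta> \<in> borel_measurable lebesgue"
    by (intro borel_measurable_integrable test_functions_integrable test_functions_partial_deriv \<theta>)+
  have T: "(\<lambda>x. complex_of_real (\<tau> x)) \<in> L2" if "\<tau> \<in> test_functions" for \<tau> :: "real^'d \<Rightarrow> real"
    by (rule test_functions_L2[OF test_functions_of_real(1)[OF that]])
  have pair: "integrable lebesgue (\<lambda>x. \<bar>\<tau> x\<bar> * cmod (f x))"
    if "\<tau> \<in> test_functions" "f \<in> L2" for \<tau> :: "real^'d \<Rightarrow> real" and f
    using L2_prod_integrable(1)[OF T[OF that(1)] that(2)] by simp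
  have ms: "(\<lambda>x. trunc (real n) (u x, u x)) \<in> borel_measurable lebesgue"
    "(\<lambda>x. trunc' (real n) (u x, u x) (g x $ i, g x $ i)) \<in> borel_measurable lebesgue" for n
  proof -
    interpret C1_bounded "trunc (real n)" "trunc' (real n)" 7 by (rule trunc_C1_bounded) simp
    show "(\<lambda>x. trunc (real n) (u x, u x)) \<in> borel_measurable lebesgue"
      by (rule measurable_compose[OF mP borel_measurable_continuous_onI[OF F_continuous]])
    show "(\<lambda>x. trunc' (real n) (u x, u x) (g x $ i, g x $ i)) \<in> borel_measurable lebesgue"
      by (intro measurable_F' borel_measurable_Pair m)
  qed
  have "(LINT x|lebesgue. partial_deriv i \<theta> x *\<^sub>R (indicator \<Omega> x *\<^sub>R trunc (real n) (u x, u x)))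
      = - (LINT x|lebesgue. \<theta> x *\<^sub>R (indicator \<Omega> x *\<^sub>R trunc' (real n) (u x, u x) (g x $ i, g x $ i)))" for n
  proof (cases "n = 0")
    case True
    then show ?thesis by (simp add: trunc_def trunc'_def flat_exp_def)
  next
    case False
    interpret C1_bounded "trunc (real n)" "trunc' (real n)" 7 by (rule trunc_C1_bounded) simp
    \<comment> \<open>Within the support of \<open>\<theta>\<close>, the only points of the
      component where the truncated state can be nonzero.\<close>
    define K where "K = supp \<theta> \<inter> (\<Omega> \<inter> {x. 1 / real n \<le> r x})"
    have K: "compact K" "K \<subseteq> \<Omega>"
      unfolding K_def using False
      by (auto intro!: compact_Int_closed test_functions_compact \<theta> closed_component_superlevel[OF r \<Omega>] simp del: compact_closure)
    obtain \<eta> :: "real^'d \<Rightarrow> real" where \<eta>: "\<eta> \<in> test_functions" "supp \<eta> \<subseteq> \<Omega>"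
      and \<eta>K: "\<And>x. x \<in> K \<Longrightarrow> \<eta> x = 1" "\<And>x i. x \<in> K \<Longrightarrow> partial_deriv i \<eta> x = 0"
      using smooth_cutoff[OF K(1) op K(2)] by metis
    define \<tau> where "\<tau> x = \<theta> x * \<eta> x" for x
    have \<tau>: "\<tau> \<in> test_functions" unfolding \<tau>_def
      by (rule test_functions_bilinear_left[OF bounded_bilinear_mult \<theta> test_functions_Ck[OF \<eta>(1)]])
    have d\<tau>: "partial_deriv i \<tau> x = \<theta> x * partial_deriv i \<eta> x + partial_deriv i \<theta> x * \<eta> x" for x
      unfolding \<tau>_def by (rule partial_deriv_bilinear[OF bounded_bilinear_mult]; rule test_functions_differentiable) (rule \<theta> \<eta>)+
    have \<tau>m: "\<tau> \<in> borel_measurable lebesgue" "partial_deriv i \<tau> \<in> borel_measurable lebesgue"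
      by (intro borel_measurable_integrable test_functions_integrable test_functions_partial_deriv \<tau>)+
    \<comment> \<open>At almost every point either the truncation removes the state together with
      its derivative, or the cut-off test function agrees to first order with
      \<open>\<theta>\<close> restricted to the component.\<close>
    have key: "(trunc (real n) (u x, u x) = 0 \<and> trunc' (real n) (u x, u x) (g x $ i, g x $ i) = 0)
       \<or> (\<tau> x = \<theta> x * indicator \<Omega> x \<and> partial_deriv i \<tau> x = partial_deriv i \<theta> x * indicator \<Omega> x)"
      if "(cmod (u x))\<^sup>2 = r x" for x
    proof (cases "1 / real n \<le> r x")
      case True
      show ?thesis
      proof (cases "x \<in> supp \<theta>")
        case xs: True
        show ?thesis
        proof (cases "x \<in> \<Omega>")
          case True
          then have "x \<in> K" using xs \<open>1 / real n \<le> r x\<close> by (simp add: K_def)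
          then show ?thesis using True \<eta>K by (simp add: \<tau>_def d\<tau>)
        next
          case False
          then have "x \<notin> supp \<eta>" using \<eta>(2) by blast
          then have "\<eta> x = 0" "partial_deriv i \<eta> x = 0"
            using in_supp[of \<eta> x] partial_deriv_outside_supp[of x \<eta> i] by argo+
          then show ?thesis using False by (simp add: \<tau>_def d\<tau>)
        qed
      next
        case False
        then have "\<theta> x = 0" "partial_deriv i \<theta> x = 0"
          using in_supp[of \<theta> x] partial_deriv_outside_supp[of x \<theta> i] by argo+
        then show ?thesis by (simp add: \<tau>_def d\<tau>)
      qed
    next
      case False
      then have "real n * (cmod (u x))\<^sup>2 \<le> 1" using \<open>n \<noteq> 0\<close> that by (simp add: field_simps)
      then show ?thesis using trunc_eq_0 by blast
    qed
    have "(LINT x|lebesgue. partial_deriv i \<theta> x *\<^sub>R (indicator \<Omega> x *\<^sub>R trunc (real n) (u x, u x)))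
       = (LINT x|lebesgue. partial_deriv i \<tau> x *\<^sub>R trunc (real n) (u x, u x))"
    proof (rule integral_cong_AE)
      show "AE x in lebesgue. partial_deriv i \<theta> x *\<^sub>R (indicator \<Omega> x *\<^sub>R trunc (real n) (u x, u x))
         = partial_deriv i \<tau> x *\<^sub>R trunc (real n) (u x, u x)"
        using ur by eventually_elim (use key in fastforce)
    qed (intro borel_measurable_scaleR \<theta>m ms \<tau>m borel_measurable_indicator \<Omega>m)+
    also have "\<dots> = - (LINT x|lebesgue. \<tau> x *\<^sub>R trunc' (real n) (u x, u x) (g x $ i, g x $ i))"
      by (rule weak_chain_rule[OF H H \<tau>])
    also have "(LINT x|lebesgue. \<tau> x *\<^sub>R trunc' (real n) (u x, u x) (g x $ i, g x $ i))
      = (LINT x|lebesgue. \<theta> x *\<^sub>R (indicator \<Omega> x *\<^sub>R trunc' (real n) (u x, u x) (g x $ i, g x $ i)))"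
    proof (rule integral_cong_AE)
      show "AE x in lebesgue. \<tau> x *\<^sub>R trunc' (real n) (u x, u x) (g x $ i, g x $ i)
         = \<theta> x *\<^sub>R (indicator \<Omega> x *\<^sub>R trunc' (real n) (u x, u x) (g x $ i, g x $ i))"
        using ur by eventually_elim (use key in fastforce)
    qed (intro borel_measurable_scaleR \<theta>m ms \<tau>m borel_measurable_indicator \<Omega>m)+
    finally show ?thesis .
  qed
  note eq = this
  have lim1: "(\<lambda>n. LINT x|lebesgue. partial_deriv i \<theta> x *\<^sub>R (indicator \<Omega> x *\<^sub>R trunc (real n) (u x, u x)))
      \<longlonglongrightarrow> (LINT x|lebesgue. partial_deriv i \<theta> x *\<^sub>R (indicator \<Omega> x *\<^sub>R u x))"
  proof (rule integral_dominated_convergence[OF _ _ pair[OF test_functions_partial_deriv[OF \<theta>, of i] uL]])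
    show "AE x in lebesgue. (\<lambda>n. partial_deriv i \<theta> x *\<^sub>R (indicator \<Omega> x *\<^sub>R trunc (real n) (u x, u x)))
        \<longlonglongrightarrow> partial_deriv i \<theta> x *\<^sub>R (indicator \<Omega> x *\<^sub>R u x)"
      by (intro AE_I2 tendsto_scaleR tendsto_const trunc_tendsto)
    have "cmod (trunc (real n) (z, z)) \<le> cmod z" for n z
      unfolding trunc_def using mult_right_mono[OF flat_exp_0_le_1 norm_ge_zero[of z]] by (simp add: flat_exp_nonneg)
    then show "AE x in lebesgue. norm (partial_deriv i \<theta> x *\<^sub>R (indicator \<Omega> x *\<^sub>R trunc (real n) (u x, u x)))
        \<le> \<bar>partial_deriv i \<theta> x\<bar> * cmod (u x)" for n
      by (intro AE_I2) (auto simp: indicator_def intro!: mult_left_mono)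
  qed (intro borel_measurable_scaleR \<theta>m ms m borel_measurable_indicator \<Omega>m)+
  have lim2: "(\<lambda>n. LINT x|lebesgue. \<theta> x *\<^sub>R (indicator \<Omega> x *\<^sub>R trunc' (real n) (u x, u x) (g x $ i, g x $ i)))
      \<longlonglongrightarrow> (LINT x|lebesgue. \<theta> x *\<^sub>R (indicator \<Omega> x *\<^sub>R g x $ i))"
  proof (rule integral_dominated_convergence[OF _ _ integrable_mult_right[OF pair[OF \<theta> gL], of 14]])
    show "AE x in lebesgue. (\<lambda>n. \<theta> x *\<^sub>R (indicator \<Omega> x *\<^sub>R trunc' (real n) (u x, u x) (g x $ i, g x $ i)))
        \<longlonglongrightarrow> \<theta> x *\<^sub>R (indicator \<Omega> x *\<^sub>R g x $ i)"
      using ur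
    proof eventually_elim
      case (elim x)
      show ?case
      proof (cases "x \<in> \<Omega>")
        case True
        then have "u x \<noteq> 0" using sub elim by auto
        then show ?thesis by (intro tendsto_scaleR tendsto_const trunc'_tendsto)
      qed simp
    qed
    \<comment> \<open>The bound 7 counts the direction \<open>h\<close> in both arguments, hence
      14.\<close>
    have "cmod (trunc' (real n) p (h, h)) \<le> 14 * cmod h" for n p h
    proof -
      interpret C1_bounded "trunc (real n)" "trunc' (real n)" 7 by (rule trunc_C1_bounded) simp
      show ?thesis using bound[of p "(h, h)"] by simp
    qed
    then show "AE x in lebesgue. norm (\<theta> x *\<^sub>R (indicator \<Omega> x *\<^sub>R trunc' (real n) (u x, u x) (g x $ i, g x $ i)))
        \<le> 14 * (\<bar>\<theta> x\<bar> * cmod (g x $ i))" for n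
      by (intro AE_I2) (auto simp: indicator_def mult.left_commute[of 14] intro!: mult_left_mono)
  qed (intro borel_measurable_scaleR \<theta>m ms m borel_measurable_indicator \<Omega>m)+
  show ?thesis using LIMSEQ_unique[OF lim1[unfolded eq] tendsto_minus[OF lim2]] .
qed

section \<open>Functions with vanishing weak gradient\<close>

lemma AE_open_nonempty:
  fixes S :: "(real^'d::finite) set"
  assumes "open S" "S \<noteq> {}"
  shows "\<not> (AE x in lebesgue. x \<notin> S)"
proof
  assume "AE x in lebesgue. x \<notin> S"
  then have "S \<in> null_sets lebesgue" using assms(1) AE_iff_null_sets[of S lebesgue] by simp
  then show False using open_not_negligible[OF assms] by (simp add: negligible_iff_null_sets)
qed

lemma sigma_finite_lebesgue: "sigma_finite_measure (lebesgue :: (real^'d::finite) measure)"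
proof
  show "\<exists>A. countable A \<and> A \<subseteq> sets (lebesgue :: (real^'d) measure) \<and> \<Union> A = space (lebesgue :: (real^'d) measure) \<and>
      (\<forall>a\<in>A. emeasure (lebesgue :: (real^'d) measure) a \<noteq> \<infinity>)"
  proof (intro exI[of _ "range (\<lambda>n. cball (0::real^'d) (real n))"] conjI)
    show "\<Union> (range (\<lambda>n. cball (0::real^'d) (real n))) = space lebesgue"
      using real_arch_simple by auto
    show "\<forall>a\<in>range (\<lambda>n. cball (0::real^'d) (real n)). emeasure lebesgue a \<noteq> \<infinity>"
    proof safe
      fix n :: nat assume "emeasure lebesgue (cball (0::real^'d) (real n)) = \<infinity>"
      then show False using emeasure_lborel_cball_finite[of "0::real^'d" "real n"] by simp
    qed
  qed auto
qed

text \<open>The derivative in t of the integral against the translate by t a is a combination of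
  integrals that vanish by hypothesis, as long as the moving support stays in
  \<open>B\<close>.\<close>

lemma zero_gradient_translation:
  fixes e \<Psi> :: "real^'d::finite \<Rightarrow> real"
  assumes e: "L1_loc e"
    and zero: "\<And>\<psi> i. \<psi> \<in> test_functions \<Longrightarrow> supp \<psi> \<subseteq> B \<Longrightarrow> (LINT x|lebesgue. partial_deriv i \<psi> x * e x) = 0"
    and \<Psi>: "\<Psi> \<in> test_functions" "\<And>t. 0 \<le> t \<Longrightarrow> t \<le> 1 \<Longrightarrow> supp (\<lambda>x. \<Psi> (x + t *\<^sub>R a)) \<subseteq> B"
  shows "(LINT x|lebesgue. \<Psi> (x + a) * e x) = (LINT x|lebesgue. \<Psi> x * e x)"
proof -
  define \<tau> where "\<tau> t = (LINT x|lebesgue. \<Psi> (x + t *\<^sub>R a) * e x)" for t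
  define \<Phi> where "\<Phi> t x = \<Psi> (x + t *\<^sub>R a)" for t x
  have t: "\<Phi> t \<in> test_functions" for t unfolding \<Phi>_def by (rule test_functions_translate[OF \<Psi>(1)])
  have d: "(\<tau> has_real_derivative (LINT x|lebesgue. (\<Sum>i\<in>UNIV. a $ i * partial_deriv i (\<Phi> t) x) * e x)) (at t)" for t
  proof -
    have "((\<lambda>h. LINT x|lebesgue. \<Phi> t (x + h *\<^sub>R a) * e x) has_real_derivative
       (LINT x|lebesgue. (\<Sum>i\<in>UNIV. a $ i * partial_deriv i (\<Phi> t) x) * e x)) (at 0)"
      by (rule DERIV_integral_translate_0[OF e test_functions_Ck[OF t] test_functions_compact[OF t]])
    moreover have "(\<lambda>h. LINT x|lebesgue. \<Phi> t (x + h *\<^sub>R a) * e x) = (\<lambda>h. \<tau> (h + t))"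
      by (simp add: \<Phi>_def \<tau>_def algebra_simps)
    ultimately show ?thesis using DERIV_shift[of \<tau> _ 0 t] by simp
  qed
  have 0: "(LINT x|lebesgue. (\<Sum>i\<in>UNIV. a $ i * partial_deriv i (\<Phi> t) x) * e x) = 0" if "0 \<le> t" "t \<le> 1" for t
  proof -
    have i: "integrable lebesgue (\<lambda>x. a $ i * (partial_deriv i (\<Phi> t) x * e x))" for i
      using test_functions_partial_deriv[OF t]
      by (intro integrable_mult_right integrable_bilinear_L1_loc[OF bounded_bilinear_mult e]
          Ck_imp_continuous[OF test_functions_Ck] test_functions_compact) auto
    have "(LINT x|lebesgue. (\<Sum>i\<in>UNIV. a $ i * partial_deriv i (\<Phi> t) x) * e x)
       = (LINT x|lebesgue. (\<Sum>i\<in>UNIV. a $ i * (partial_deriv i (\<Phi> t) x * e x)))"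
      by (simp add: sum_distrib_right mult.assoc)
    also have "\<dots> = (\<Sum>i\<in>UNIV. a $ i * (LINT x|lebesgue. partial_deriv i (\<Phi> t) x * e x))"
      by (subst Bochner_Integration.integral_sum[OF i]) simp
    also have "\<dots> = 0"
      using zero[OF t] \<Psi>(2)[OF that] by (simp add: \<Phi>_def[abs_def])
    finally show ?thesis .
  qed
  have "\<tau> 1 = \<tau> 0"
  proof (rule DERIV_isconst_end[of 0 1])
    show "continuous_on {0..1} \<tau>" using d by (intro DERIV_continuous_on) (auto intro: has_field_derivative_at_within)
    show "(\<tau> has_real_derivative 0) (at t)" if "0 < t" "t < 1" for t
      using d[of t] 0[of t] that by simp
  qed simp
  then show ?thesis by (simp add: \<tau>_def)
qed

text \<open>Translation invariance, averaged over all translations by Fubini, gives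
  \<open>(\<integral> e \<psi>\<^sub>0) (\<integral> \<psi>) = \<kappa> (\<integral> e \<psi>)\<close> with a positive \<open>\<kappa>\<close>.\<close>

lemma zero_gradient_ball:
  fixes e :: "real^'d::finite \<Rightarrow> real"
  assumes e: "L1_loc e" and \<rho>: "\<rho> > 0"
    and zero: "\<And>\<psi> i. \<psi> \<in> test_functions \<Longrightarrow> supp \<psi> \<subseteq> ball a \<rho> \<Longrightarrow> (LINT x|lebesgue. partial_deriv i \<psi> x * e x) = 0"
  obtains c where "AE x in lebesgue. x \<in> ball a \<rho> \<longrightarrow> e x = c"
proof -
  interpret S: sigma_finite_measure "lebesgue :: (real^'d) measure" by (rule sigma_finite_lebesgue)
  interpret P: pair_sigma_finite "lebesgue :: (real^'d) measure" "lebesgue :: (real^'d) measure" ..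
  \<comment> \<open>Half the radius keeps the closed support of the bump inside the open
    ball.\<close>
  define \<beta> where "\<beta> = bump a (\<rho>/2)"
  have \<beta>: "\<beta> \<in> test_functions" unfolding \<beta>_def using \<rho> by (intro bump_test) simp
  have s\<beta>: "supp \<beta> \<subseteq> ball a \<rho>" using supp_bump[of "\<rho>/2" a] \<rho> unfolding \<beta>_def by (auto simp: subset_iff)
  define \<kappa> where "\<kappa> = (LINT h|lebesgue. \<beta> (- h))"
  have idm: "(\<lambda>x::real^'d. x) \<in> borel_measurable lebesgue"
    using id_borel_measurable_lebesgue by (simp add: id_def)
  have cont: "continuous_on UNIV \<psi>" if "\<psi> \<in> test_functions" for \<psi> :: "real^'d \<Rightarrow> real"
    by (rule Ck_imp_continuous[OF test_functions_Ck[OF that]])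
  have e\<psi>: "integrable lebesgue (\<lambda>x. e x * \<psi> x)" if "\<psi> \<in> test_functions" for \<psi> :: "real^'d \<Rightarrow> real"
    using integrable_bilinear_L1_loc[OF bounded_bilinear_mult e cont[OF that] test_functions_compact[OF that]]
    by (simp add: mult.commute)
  \<comment> \<open>Integrating over all shifts first decouples the two factors, as the inner
    integral does not depend on \<open>x\<close>. It is used with \<open>L\<close> the identity and
    with \<open>L\<close> the reflection, because the shift changes sign when it passes from one
    factor to the other.\<close>
  have fubini: "(LINT h|lebesgue. LINT x|lebesgue. f x * \<gamma> (L x + h))
      = (LINT x|lebesgue. f x) * K"
    if f: "integrable lebesgue f" and \<gamma>: "continuous_on UNIV \<gamma>" "compact (supp \<gamma>)"
      and L: "L \<in> borel_measurable lebesgue" and K: "K = (LINT h|lebesgue. \<gamma> h)"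
    for f \<gamma> :: "real^'d \<Rightarrow> real" and L :: "real^'d \<Rightarrow> real^'d" and K
  proof -
    have i\<gamma>: "integrable lebesgue (\<lambda>h. \<gamma> (h + y))" for y
    proof (rule integrable_continuous_compact_supp)
      show "continuous_on UNIV (\<lambda>h. \<gamma> (h + y))"
        by (rule continuous_on_compose2[OF \<gamma>(1)]) (auto intro!: continuous_intros)
      have c: "compact ((\<lambda>x. x - y) ` supp \<gamma>)" by (intro compact_continuous_image \<gamma>(2) continuous_intros)
      show "compact (supp (\<lambda>h. \<gamma> (h + y)))"
      proof (rule compact_supp[OF c], rule supp_subset_closed)
        show "closed ((\<lambda>x. x - y) ` supp \<gamma>)" by (rule compact_imp_closed[OF c])
        fix x assume "x \<notin> (\<lambda>x. x - y) ` supp \<gamma>"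
        then have "x + y \<notin> supp \<gamma>" by (metis add_diff_cancel_right' image_eqI)
        then show "\<gamma> (x + y) = 0" using in_supp[of \<gamma> "x + y"] by argo
      qed
    qed
    have c\<gamma>: "(LINT h|lebesgue. \<gamma> (L x + h)) = K" for x
      using lebesgue_integral_translate[OF \<gamma>(1), of "L x"] by (simp add: K add.commute)
    have ca: "continuous_on UNIV (\<lambda>h. \<bar>\<gamma> h\<bar>)" by (intro continuous_intros \<gamma>(1))
    have ca\<gamma>: "(LINT h|lebesgue. \<bar>\<gamma> (L x + h)\<bar>) = (LINT h|lebesgue. \<bar>\<gamma> h\<bar>)" for x
      using lebesgue_integral_translate[OF ca, of "L x"] by (simp add: add.commute)
    define G where "G = (\<lambda>(x, h). f x * \<gamma> (L x + h))"
    have "(\<lambda>p. \<gamma> (L (fst p) + snd p)) \<in> borel_measurable (lebesgue \<Otimes>\<^sub>M lebesgue)"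
      by (rule measurable_compose[OF _ borel_measurable_continuous_onI[OF \<gamma>(1)]])
        (intro borel_measurable_add measurable_compose[OF measurable_fst L] measurable_compose[OF measurable_snd idm])
    then have mG: "G \<in> borel_measurable (lebesgue \<Otimes>\<^sub>M lebesgue)"
      unfolding G_def split_def
      by (intro borel_measurable_times measurable_compose[OF measurable_fst borel_measurable_integrable[OF f]])
    have "integrable (lebesgue \<Otimes>\<^sub>M lebesgue) G"
    proof (rule P.Fubini_integrable[OF mG])
      have "integrable lebesgue (\<lambda>x. \<bar>f x\<bar> * (LINT h|lebesgue. \<bar>\<gamma> h\<bar>))"
        using f by (intro integrable_mult_left integrable_abs)
      then show "integrable lebesgue (\<lambda>x. LINT y|lebesgue. norm (G (x, y)))"
        by (simp add: G_def abs_mult ca\<gamma>)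
      show "AE x in lebesgue. integrable lebesgue (\<lambda>y. G (x, y))"
        by (intro AE_I2) (simp add: G_def i\<gamma> add.commute[of "L _"])
    qed
    then have "integrable (lebesgue \<Otimes>\<^sub>M lebesgue) (\<lambda>(x, h). f x * \<gamma> (L x + h))" by (simp add: G_def)
    from P.Fubini_integral[OF this] show ?thesis by (simp add: c\<gamma>)
  qed
  have identity: "(LINT x|lebesgue. e x * \<beta> x) * (LINT x|lebesgue. \<psi> x) = (LINT x|lebesgue. e x * \<psi> x) * \<kappa>"
    if \<psi>: "\<psi> \<in> test_functions" "supp \<psi> \<subseteq> ball a \<rho>" for \<psi>
  proof -
    \<comment> \<open>Translation moves the shift from \<open>\<psi>\<close> to
      \<open>\<beta>\<close>. While \<open>\<beta> x * \<psi> (x + h)\<close> is translated, its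
      support stays among the convex combinations of points of the two supports, hence in the ball
      by convexity.\<close>
    have inv: "(LINT x|lebesgue. (e x * \<beta> x) * \<psi> (x + h)) = (LINT x|lebesgue. (e x * \<psi> x) * \<beta> (x - h))" for h
    proof -
      define \<Psi> where "\<Psi> x = \<beta> x * \<psi> (x + h)" for x
      have "(\<lambda>x. \<psi> (x + h)) \<in> test_functions" by (rule test_functions_translate[OF \<psi>(1)])
      then have \<Psi>: "\<Psi> \<in> test_functions"
        unfolding \<Psi>_def by (intro test_functions_bilinear_left[OF bounded_bilinear_mult \<beta>] test_functions_Ck)
      have "(LINT x|lebesgue. \<Psi> (x + (- h)) * e x) = (LINT x|lebesgue. \<Psi> x * e x)"
      proof (rule zero_gradient_translation[OF e zero \<Psi>])
        fix t :: real assume t: "0 \<le> t" "t \<le> 1"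
        define K where "K = (\<lambda>(p, q). (1 - t) *\<^sub>R p + t *\<^sub>R q) ` (supp \<beta> \<times> supp \<psi>)"
        have K: "compact K" unfolding K_def split_def
          by (intro compact_continuous_image compact_Times test_functions_compact \<beta> \<psi> continuous_intros)
        have "supp (\<lambda>x. \<Psi> (x + t *\<^sub>R (- h))) \<subseteq> K"
        proof (rule supp_subset_closed[OF compact_imp_closed[OF K]], rule ccontr)
          fix x assume x: "x \<notin> K" "\<Psi> (x + t *\<^sub>R (- h)) \<noteq> 0"
          define p q where "p = x - t *\<^sub>R h" and "q = x - t *\<^sub>R h + h"
          have "\<beta> p \<noteq> 0" "\<psi> q \<noteq> 0" using x(2) by (auto simp: \<Psi>_def p_def q_def)
          then have "p \<in> supp \<beta>" "q \<in> supp \<psi>" using in_supp[of \<beta> p] in_supp[of \<psi> q] by argo+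
          moreover have "x = (1 - t) *\<^sub>R p + t *\<^sub>R q" by (simp add: p_def q_def algebra_simps)
          ultimately have "x \<in> K" unfolding K_def by force
          then show False using x(1) by simp
        qed
        also have "K \<subseteq> ball a \<rho>"
        proof
          fix y assume "y \<in> K"
          then obtain p q where pq: "p \<in> supp \<beta>" "q \<in> supp \<psi>" "y = (1 - t) *\<^sub>R p + t *\<^sub>R q"
            unfolding K_def by (elim imageE SigmaE) simp
          show "y \<in> ball a \<rho>" unfolding pq(3)
            by (rule convexD[OF convex_ball subsetD[OF s\<beta> pq(1)] subsetD[OF \<psi>(2) pq(2)]]) (use t in auto)
        qed
        finally show "supp (\<lambda>x. \<Psi> (x + t *\<^sub>R (- h))) \<subseteq> ball a \<rho>" .
      qed
      then show ?thesis by (simp add: \<Psi>_def mult_ac)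
    qed
    have "(LINT x|lebesgue. e x * \<beta> x) * (LINT x|lebesgue. \<psi> x)
       = (LINT h|lebesgue. LINT x|lebesgue. (e x * \<beta> x) * \<psi> (x + h))"
      by (rule fubini[symmetric]) (use e\<psi>[OF \<beta>] cont[OF \<psi>(1)] test_functions_compact[OF \<psi>(1)] idm in auto)
    also have "\<dots> = (LINT h|lebesgue. LINT x|lebesgue. (e x * \<psi> x) * \<beta> (- (- x + h)))"
      unfolding inv by simp
    also have "\<dots> = (LINT x|lebesgue. e x * \<psi> x) * \<kappa>"
    proof (rule fubini)
      show "continuous_on UNIV (\<lambda>y. \<beta> (- y))"
        by (rule continuous_on_compose2[OF cont[OF \<beta>]]) (auto intro!: continuous_intros)
      have "supp (\<lambda>y. \<beta> (- y)) \<subseteq> cball (- a) (\<rho>/2)"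
        by (rule supp_subset_closed) (use \<rho> in \<open>auto simp: \<beta>_def bump_eq_0_iff dist_norm norm_minus_commute add.commute\<close>)
      then show "compact (supp (\<lambda>y. \<beta> (- y)))" by (rule compact_supp[OF compact_cball])
      show "(uminus :: real^'d \<Rightarrow> real^'d) \<in> borel_measurable lebesgue"
        by (rule borel_measurable_uminus[OF idm])
    qed (auto simp: e\<psi>[OF \<psi>(1)] \<kappa>_def)
    finally show ?thesis .
  qed
  have "\<kappa> > 0"
  proof -
    have eq: "(\<lambda>h. \<beta> (- h)) = bump (- a) (\<rho>/2)"
      by (simp add: \<beta>_def bump_def fun_eq_iff inner_diff algebra_simps inner_commute)
    have i: "integrable lebesgue (bump (- a) (\<rho>/2))" using \<rho> by (intro test_functions_integrable bump_test) simp
    have "\<not> (AE x in lebesgue. x \<notin> ball (- a) (\<rho>/2))" using \<rho> by (intro AE_open_nonempty) auto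
    then have "\<not> (AE x in lebesgue. bump (- a) (\<rho>/2) x = 0)" using \<rho> by (simp add: bump_eq_0_iff)
    then have "(LINT x|lebesgue. bump (- a) (\<rho>/2) x) \<noteq> 0"
      using integral_nonneg_eq_0_iff_AE[OF i AE_I2[OF bump_nonneg]] by simp
    moreover have "0 \<le> (LINT x|lebesgue. bump (- a) (\<rho>/2) x)" by (intro Bochner_Integration.integral_nonneg bump_nonneg)
    ultimately show ?thesis unfolding \<kappa>_def eq by simp
  qed
  define c where "c = (LINT x|lebesgue. e x * \<beta> x) / \<kappa>"
  have "AE x in lebesgue. x \<in> ball a \<rho> \<longrightarrow> e x - c = 0"
  proof (rule AE_eq_0_of_test)
    show "L1_loc (\<lambda>x. e x - c)"
      using e L1_loc_const[of c] unfolding L1_loc_def set_integrable_def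
      by (auto simp: right_diff_distrib)
    fix \<psi> :: "real^'d \<Rightarrow> real" assume \<psi>: "\<psi> \<in> test_functions" "supp \<psi> \<subseteq> ball a \<rho>"
    have "(LINT x|lebesgue. \<psi> x * (e x - c)) = (LINT x|lebesgue. e x * \<psi> x) - (LINT x|lebesgue. \<psi> x) * c"
      using e\<psi>[OF \<psi>(1)] test_functions_integrable[OF \<psi>(1)] by (simp add: right_diff_distrib mult.commute)
    also have "\<dots> = 0" using identity[OF \<psi>] \<open>\<kappa> > 0\<close> by (simp add: c_def field_simps)
    finally show "(LINT x|lebesgue. \<psi> x * (e x - c)) = 0" .
  qed simp
  then show ?thesis using that[of c] by simp
qed

text \<open>The constants of overlapping balls agree because the overlap is open and not a null set.
  So the constant is locally constant in the centre, and connectedness makes it global. A countable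
  subcover is needed to collect the exceptional null sets.\<close>

lemma zero_gradient_connected_real:
  fixes e :: "real^'d::finite \<Rightarrow> real"
  assumes e: "L1_loc e" and \<Omega>: "open \<Omega>" "connected \<Omega>"
    and zero: "\<And>\<psi> i. \<psi> \<in> test_functions \<Longrightarrow> supp \<psi> \<subseteq> \<Omega> \<Longrightarrow> (LINT x|lebesgue. partial_deriv i \<psi> x * e x) = 0"
  obtains c where "AE x in lebesgue. x \<in> \<Omega> \<longrightarrow> e x = c"
proof -
  have "\<exists>\<rho> c. \<rho> > 0 \<and> ball a \<rho> \<subseteq> \<Omega> \<and> (AE x in lebesgue. x \<in> ball a \<rho> \<longrightarrow> e x = c)" if "a \<in> \<Omega>" for a
  proof -
    obtain \<rho> where \<rho>: "\<rho> > 0" "ball a \<rho> \<subseteq> \<Omega>" by (rule openE[OF \<Omega>(1) \<open>a \<in> \<Omega>\<close>])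
    obtain c where "AE x in lebesgue. x \<in> ball a \<rho> \<longrightarrow> e x = c"
      by (rule zero_gradient_ball[OF e \<rho>(1)]) (use zero \<rho>(2) in blast)+
    then show ?thesis using \<rho> by blast
  qed
  then have "\<forall>a\<in>\<Omega>. \<exists>\<rho> c. \<rho> > 0 \<and> ball a \<rho> \<subseteq> \<Omega> \<and> (AE x in lebesgue. x \<in> ball a \<rho> \<longrightarrow> e x = c)" by blast
  from bchoice[OF this] obtain R where
    "\<forall>a\<in>\<Omega>. \<exists>c. R a > 0 \<and> ball a (R a) \<subseteq> \<Omega> \<and> (AE x in lebesgue. x \<in> ball a (R a) \<longrightarrow> e x = c)" by blast
  from bchoice[OF this] obtain c where
    Rc: "\<forall>a\<in>\<Omega>. R a > 0 \<and> ball a (R a) \<subseteq> \<Omega> \<and> (AE x in lebesgue. x \<in> ball a (R a) \<longrightarrow> e x = c a)" by blast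
  then have R: "\<And>a. a \<in> \<Omega> \<Longrightarrow> R a > 0" "\<And>a. a \<in> \<Omega> \<Longrightarrow> ball a (R a) \<subseteq> \<Omega>"
    and c: "\<And>a. a \<in> \<Omega> \<Longrightarrow> AE x in lebesgue. x \<in> ball a (R a) \<longrightarrow> e x = c a"
    by blast+
  have loc: "c a = c b" if "a \<in> \<Omega>" "b \<in> ball a (R a)" for a b
  proof (rule ccontr)
    assume ne: "c a \<noteq> c b"
    have b: "b \<in> \<Omega>" using R(2) that by blast
    have "AE x in lebesgue. x \<notin> ball a (R a) \<inter> ball b (R b)"
      using c[OF that(1)] c[OF b] by eventually_elim (use ne in auto)
    moreover have "b \<in> ball a (R a) \<inter> ball b (R b)" using that(2) R(1)[OF b] by simp
    ultimately show False using AE_open_nonempty[of "ball a (R a) \<inter> ball b (R b)"] by blast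
  qed
  have const: "c a = c b" if "a \<in> \<Omega>" "b \<in> \<Omega>" for a b
  proof (rule connected_local_const[OF \<Omega>(2) that])
    show "\<forall>a\<in>\<Omega>. \<forall>\<^sub>F b in at a within \<Omega>. c a = c b"
    proof
      fix a assume a: "a \<in> \<Omega>"
      have "\<forall>\<^sub>F b in at a within \<Omega>. b \<in> ball a (R a)"
        using R(1)[OF a] by (intro eventually_at_topological[THEN iffD2] exI[of _ "ball a (R a)"]) auto
      then show "\<forall>\<^sub>F b in at a within \<Omega>. c a = c b" by eventually_elim (rule loc[OF a])
    qed
  qed
  obtain \<F> where \<F>: "\<F> \<subseteq> (\<lambda>a. ball a (R a)) ` \<Omega>" "countable \<F>" "\<Union>\<F> = (\<Union>a\<in>\<Omega>. ball a (R a))"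
    by (rule Lindelof[of "(\<lambda>a. ball a (R a)) ` \<Omega>"]) auto
  show ?thesis
  proof (cases "\<Omega> = {}")
    case False
    then obtain a where a: "a \<in> \<Omega>" by blast
    have "AE x in lebesgue. \<forall>B\<in>\<F>. x \<in> B \<longrightarrow> e x = c a"
    proof (subst AE_ball_countable[OF \<F>(2)], rule ballI)
      fix B assume "B \<in> \<F>"
      then obtain b where "b \<in> \<Omega>" "B = ball b (R b)" using \<F>(1) by blast
      then show "AE x in lebesgue. x \<in> B \<longrightarrow> e x = c a" using c[of b] const[OF a, of b] by simp
    qed
    then have "AE x in lebesgue. x \<in> \<Omega> \<longrightarrow> e x = c a"
    proof eventually_elim
      case (elim x)
      show ?case
      proof
        assume x: "x \<in> \<Omega>"
        then have "x \<in> \<Union>\<F>" unfolding \<F>(3) using R(1)[OF x] by (intro UN_I[OF x]) simp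
        then show "e x = c a" using elim by blast
      qed
    qed
    then show ?thesis by (rule that)
  qed (use that[of 0] in simp)
qed

lemma zero_gradient_connected:
  fixes e :: "real^'d::finite \<Rightarrow> complex"
  assumes e: "L1_loc e" and \<Omega>: "open \<Omega>" "connected \<Omega>"
    and zero: "\<And>\<psi> i. (\<psi> :: real^'d \<Rightarrow> real) \<in> test_functions \<Longrightarrow> supp \<psi> \<subseteq> \<Omega> \<Longrightarrow>
      (LINT x|lebesgue. partial_deriv i \<psi> x *\<^sub>R e x) = 0"
  obtains c where "AE x in lebesgue. x \<in> \<Omega> \<longrightarrow> e x = c"
proof -
  have "\<exists>c. AE x in lebesgue. x \<in> \<Omega> \<longrightarrow> T (e x) = c" if T: "bounded_linear T" for T :: "complex \<Rightarrow> real"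
  proof -
    have "(LINT x|lebesgue. partial_deriv i \<psi> x * T (e x)) = 0"
      if \<psi>: "\<psi> \<in> test_functions" "supp \<psi> \<subseteq> \<Omega>" for \<psi> :: "real^'d \<Rightarrow> real" and i
    proof -
      have "integrable lebesgue (\<lambda>x. partial_deriv i \<psi> x *\<^sub>R e x)"
        using test_functions_partial_deriv[OF \<psi>(1), of i]
        by (intro integrable_bilinear_L1_loc[OF bounded_bilinear_scaleR e]
            Ck_imp_continuous[OF test_functions_Ck] test_functions_compact)
      from integral_bounded_linear[OF T this] zero[OF \<psi>, of i]
      show ?thesis by (simp add: linear_scale[OF bounded_linear.linear[OF T]] linear_0[OF bounded_linear.linear[OF T]])
    qed
    then obtain c where "AE x in lebesgue. x \<in> \<Omega> \<longrightarrow> T (e x) = c"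
      by (rule zero_gradient_connected_real[OF L1_loc_bounded_linear[OF T e] \<Omega>])
    then show ?thesis by blast
  qed
  from this[OF bounded_linear_Re] this[OF bounded_linear_Im] obtain c1 c2 where
    c: "AE x in lebesgue. x \<in> \<Omega> \<longrightarrow> Re (e x) = c1" "AE x in lebesgue. x \<in> \<Omega> \<longrightarrow> Im (e x) = c2" by blast
  have "AE x in lebesgue. x \<in> \<Omega> \<longrightarrow> e x = Complex c1 c2"
    using c by eventually_elim (auto simp: complex_eq_iff)
  then show ?thesis by (rule that)
qed

section \<open>Density and current determine the function up to a phase on each component\<close>

lemma Re_cnj_mult: "Re (cnj z * w) = z \<bullet> w"
  by (simp add: inner_complex_def)

lemma has_derivative_inner_self:
  "((\<lambda>p::complex \<times> complex. fst p \<bullet> fst p) has_derivative (\<lambda>h. 2 * (fst p \<bullet> fst h))) (at p)"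
  "((\<lambda>p::complex \<times> complex. snd p \<bullet> snd p) has_derivative (\<lambda>h. 2 * (snd p \<bullet> snd h))) (at p)"
  by (auto intro!: derivative_eq_intros simp: inner_commute)

text \<open>A substitute for the density |u|^2, whose differential is unbounded: a strictly
  increasing C1 function of it with bounded differential.\<close>

definition squash :: "complex \<times> complex \<Rightarrow> complex" where
  "squash p = of_real ((fst p \<bullet> fst p) / (1 + fst p \<bullet> fst p))"

definition squash' :: "complex \<times> complex \<Rightarrow> complex \<times> complex \<Rightarrow> complex" where
  "squash' p h = of_real (2 * (fst p \<bullet> fst h) * (1 / (1 + fst p \<bullet> fst p)\<^sup>2))"

lemma squash_C1_bounded: "C1_bounded squash squash' 1"
proof
  fix p h :: "complex \<times> complex"
  define z where "z = fst p"
  have "0 \<le> z \<bullet> z" by simp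
  then have s: "1 + z \<bullet> z \<noteq> 0" by linarith
  have "((\<lambda>s::real. s / (1 + s)) has_real_derivative 1 / (1 + z \<bullet> z)\<^sup>2) (at (z \<bullet> z))"
    using s by (auto intro!: derivative_eq_intros simp: power2_eq_square field_simps)
  from DERIV_compose_FDERIV[OF this[unfolded z_def] has_derivative_inner_self(1)]
  show "(squash has_derivative squash' p) (at p)"
    unfolding squash_def[abs_def] squash'_def[abs_def]
    by (intro bounded_linear.has_derivative[OF bounded_linear_of_real])
  show "continuous_on UNIV (\<lambda>p. squash' p h)"
    unfolding squash'_def
    by (intro continuous_intros) (auto simp: add_nonneg_eq_0_iff)
  have "cmod (squash' p h) = 2 * \<bar>z \<bullet> fst h\<bar> / (1 + z \<bullet> z)\<^sup>2"
    by (simp only: squash'_def norm_of_real z_def) (simp add: abs_mult)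
  also have "\<dots> \<le> 2 * (cmod z * cmod (fst h)) / (1 + z \<bullet> z)\<^sup>2"
    by (intro divide_right_mono mult_left_mono Cauchy_Schwarz_ineq2) auto
  also have "\<dots> = (2 * cmod z / (1 + z \<bullet> z)\<^sup>2) * cmod (fst h)" by simp
  also have "\<dots> \<le> 1 * cmod (fst h)"
  proof (rule mult_right_mono)
    have "2 * cmod z \<le> 1 + z \<bullet> z"
      using sum_squares_bound[of 1 "cmod z"] by (simp add: power2_norm_eq_inner)
    also have "\<dots> \<le> (1 + z \<bullet> z)\<^sup>2" by (rule self_le_power) auto
    finally show "2 * cmod z / (1 + z \<bullet> z)\<^sup>2 \<le> 1" using s by (subst divide_le_eq_1_pos) auto
  qed simp
  finally show "cmod (squash' p h) \<le> 1 * (cmod (fst h) + cmod (snd h))" by (simp add: add_increasing2)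
qed

text \<open>Both states have the same squashed density, hence the same weak gradient of it. On each
  side this gradient is the real part of cnj u times the gradient of u, multiplied by a positive
  factor depending on the density alone, which cancels. Equal currents supply the imaginary
  part.\<close>

lemma equal_density_Re:
  assumes H: "H1_limit \<phi> u g" "H1_limit \<eta> v k" and eq: "AE x in lebesgue. cmod (u x) = cmod (v x)"
  shows "AE x in lebesgue. u x \<bullet> g x $ i = v x \<bullet> k x $ i"
proof -
  interpret C1_bounded squash squash' 1 by (rule squash_C1_bounded)
  note L = H1_limitD(2,3)[OF H(1)] H1_limitD(2,3)[OF H(2)]
  define a where "a x = squash' (u x, u x) (g x $ i, g x $ i)" for x
  define b where "b x = squash' (v x, v x) (k x $ i, k x $ i)" for x
  have mu: "(\<lambda>x. (u x, u x)) \<in> borel_measurable lebesgue" and mv: "(\<lambda>x. (v x, v x)) \<in> borel_measurable lebesgue"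
    by (intro borel_measurable_Pair L2_measurable L)+
  have ab: "a \<in> L2" "b \<in> L2"
  proof -
    have bd: "(cmod (squash' p (h, h)))\<^sup>2 \<le> 4 * (cmod h)\<^sup>2" for p h
      using power_mono[OF bound[of p "(h, h)"] norm_ge_zero, of 2] by (simp add: power_mult_distrib)
    have "integrable lebesgue (\<lambda>x. 4 * (cmod (g x $ i))\<^sup>2)" "integrable lebesgue (\<lambda>x. 4 * (cmod (k x $ i))\<^sup>2)"
      by (intro integrable_mult_right L2_integrable L)+
    note i = this
    show "a \<in> L2" unfolding a_def
      by (rule L2_dominated[OF measurable_F' i(1)]) (intro mu borel_measurable_Pair L2_measurable L AE_I2 bd)+
    show "b \<in> L2" unfolding b_def
      by (rule L2_dominated[OF measurable_F' i(2)]) (intro mv borel_measurable_Pair L2_measurable L AE_I2 bd)+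
  qed
  have "AE x in lebesgue. x \<in> UNIV \<longrightarrow> a x - b x = 0"
  proof (rule AE_eq_0_of_test_complex)
    show "L1_loc (\<lambda>x. a x - b x)" by (intro L2_imp_L1_loc L2_diff ab)
    fix \<theta> :: "real^'a \<Rightarrow> real" assume \<theta>: "\<theta> \<in> test_functions"
    have i: "integrable lebesgue (\<lambda>x. \<theta> x *\<^sub>R w x)" if "w \<in> L2" for w
      using L2_prod_integrable(2)[OF test_functions_L2[OF test_functions_of_real(1)[OF \<theta>]] that]
      by (simp add: scaleR_conv_of_real)
    have "(LINT x|lebesgue. \<theta> x *\<^sub>R (a x - b x)) = (LINT x|lebesgue. \<theta> x *\<^sub>R a x) - (LINT x|lebesgue. \<theta> x *\<^sub>R b x)"
      by (simp add: scaleR_diff_right i ab)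
    also have "\<dots> = (LINT x|lebesgue. partial_deriv i \<theta> x *\<^sub>R squash (v x, v x)) - (LINT x|lebesgue. partial_deriv i \<theta> x *\<^sub>R squash (u x, u x))"
      unfolding a_def b_def weak_chain_rule[OF H(1) H(1) \<theta>] weak_chain_rule[OF H(2) H(2) \<theta>] by simp
    also have "(LINT x|lebesgue. partial_deriv i \<theta> x *\<^sub>R squash (v x, v x)) = (LINT x|lebesgue. partial_deriv i \<theta> x *\<^sub>R squash (u x, u x))"
    proof (rule integral_cong_AE)
      show "AE x in lebesgue. partial_deriv i \<theta> x *\<^sub>R squash (v x, v x) = partial_deriv i \<theta> x *\<^sub>R squash (u x, u x)"
        using eq by eventually_elim (simp add: squash_def dot_square_norm)
    qed (intro borel_measurable_integrable L2_F_integrable L test_functions_partial_deriv \<theta>)+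
    finally show "(LINT x|lebesgue. \<theta> x *\<^sub>R (a x - b x)) = 0" by simp
  qed simp
  then show ?thesis
    using eq
  proof eventually_elim
    case (elim x)
    have ne: "(1 + (cmod (v x))\<^sup>2)\<^sup>2 \<noteq> 0" by (simp add: add_nonneg_eq_0_iff)
    have "a x = b x" using elim by simp
    then have "2 * (u x \<bullet> g x $ i) * (1 / (1 + u x \<bullet> u x)\<^sup>2) = 2 * (v x \<bullet> k x $ i) * (1 / (1 + v x \<bullet> v x)\<^sup>2)"
      unfolding a_def b_def squash'_def of_real_eq_iff fst_conv .
    then show ?case using elim ne by (simp add: dot_square_norm)
  qed
qed

text \<open>A regularisation of \<open>cnj u * v / (|u|\<^sup>2 + |v|\<^sup>2)\<close>, which is half the relative phase of two states
  with the same density and has vanishing weak gradient if the currents agree as well.\<close>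

definition quot :: "real \<Rightarrow> complex \<times> complex \<Rightarrow> complex" where
  "quot l p = (l / (1 + l * (fst p \<bullet> fst p + snd p \<bullet> snd p))) *\<^sub>R (cnj (fst p) * snd p)"

definition quot' :: "real \<Rightarrow> complex \<times> complex \<Rightarrow> complex \<times> complex \<Rightarrow> complex" where
  "quot' l p h = (l / (1 + l * (fst p \<bullet> fst p + snd p \<bullet> snd p))) *\<^sub>R (cnj (fst p) * snd h + cnj (fst h) * snd p)
     + ((2 * (fst p \<bullet> fst h) + 2 * (snd p \<bullet> snd h)) * (- (l\<^sup>2 / (1 + l * (fst p \<bullet> fst p + snd p \<bullet> snd p))\<^sup>2))) *\<^sub>R (cnj (fst p) * snd p)"

text \<open>This bound grows with \<open>l\<close>. That is enough for the chain rule, which is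
  applied at fixed \<open>l\<close>; the passage to infinity uses \<open>quot_bound\<close> and
  \<open>quot'_small\<close> instead.\<close>

lemma quot_C1_bounded:
  assumes l: "l \<ge> 0"
  shows "C1_bounded (quot l) (quot' l) (3 * (1 + l))"
proof
  fix p h :: "complex \<times> complex"
  let ?s = "\<lambda>p::complex \<times> complex. fst p \<bullet> fst p + snd p \<bullet> snd p"
  define z w h1 h2 where "z = fst p" and "w = snd p" and "h1 = fst h" and "h2 = snd h"
  define D where "D = 1 + l * (z \<bullet> z + w \<bullet> w)"
  have pos: "1 + l * ?s p > 0" for p using l by (simp add: add_pos_nonneg)
  have "((\<lambda>s. l / (1 + l * s)) has_real_derivative - (l\<^sup>2 / (1 + l * ?s p)\<^sup>2)) (at (?s p))"
    using pos[of p] by (auto intro!: derivative_eq_intros simp: power2_eq_square)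
  from DERIV_compose_FDERIV[OF this has_derivative_add[OF has_derivative_inner_self]]
  have q: "((\<lambda>p. l / (1 + l * ?s p)) has_derivative
     (\<lambda>h. (2 * (fst p \<bullet> fst h) + 2 * (snd p \<bullet> snd h)) * (- (l\<^sup>2 / (1 + l * ?s p)\<^sup>2)))) (at p)" .
  have "((\<lambda>p. cnj (fst p) * snd p) has_derivative (\<lambda>h. cnj (fst p) * snd h + cnj (fst h) * snd p)) (at p)"
    by (intro has_derivative_mult bounded_linear.has_derivative[OF bounded_linear_cnj]
        has_derivative_fst has_derivative_snd has_derivative_ident)
  from has_derivative_scaleR[OF q this]
  show "(quot l has_derivative quot' l p) (at p)"
    unfolding quot_def[abs_def] quot'_def[abs_def] .
  show "continuous_on UNIV (\<lambda>p. quot' l p h)"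
    unfolding quot'_def by (intro continuous_intros) (use pos in \<open>auto simp: less_le\<close>)
  have D: "D > 0" using pos[of p] by (simp add: D_def z_def w_def)
  have lin: "l * cmod y \<le> (1 + l) * D" if "cmod y ^ 2 \<le> z \<bullet> z + w \<bullet> w" for y :: complex
  proof -
    have "2 * cmod y \<le> 1 + (cmod y)\<^sup>2" using sum_squares_bound[of 1 "cmod y"] by simp
    then have "cmod y \<le> 1 + (cmod y)\<^sup>2" using norm_ge_zero[of y] by linarith
    then have "l * cmod y \<le> l * (1 + (z \<bullet> z + w \<bullet> w))" using l that by (intro mult_left_mono) auto
    also have "\<dots> \<le> (1 + l) * D"
      using l unfolding D_def by (simp add: algebra_simps)
    finally show ?thesis .
  qed
  have sz: "(cmod z)\<^sup>2 \<le> z \<bullet> z + w \<bullet> w" and sw: "(cmod w)\<^sup>2 \<le> z \<bullet> z + w \<bullet> w" by (simp_all add: power2_norm_eq_inner)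
  have lz: "l * cmod z / D \<le> 1 + l" and lw: "l * cmod w / D \<le> 1 + l"
    using lin[OF sz] lin[OF sw] D by (simp_all add: divide_le_eq)
  have lzw: "l * (cmod z * cmod w) / D \<le> 1"
  proof -
    have "2 * (cmod z * cmod w) \<le> z \<bullet> z + w \<bullet> w"
      using sum_squares_bound[of "cmod z" "cmod w"] by (simp add: power2_norm_eq_inner)
    then have "cmod z * cmod w \<le> z \<bullet> z + w \<bullet> w" using mult_nonneg_nonneg[OF norm_ge_zero[of z] norm_ge_zero[of w]] by linarith
    then have "l * (cmod z * cmod w) \<le> l * (z \<bullet> z + w \<bullet> w)" using l by (rule mult_left_mono)
    also have "\<dots> \<le> D" by (simp add: D_def)
    finally show ?thesis using D by simp
  qed
  have t1: "cmod ((l / D) *\<^sub>R (cnj z * h2 + cnj h1 * w)) \<le> (1 + l) * (cmod h1 + cmod h2)"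
  proof -
    have "cmod ((l / D) *\<^sub>R (cnj z * h2 + cnj h1 * w)) \<le> (l / D) * (cmod z * cmod h2 + cmod h1 * cmod w)"
      using l D norm_triangle_ineq[of "cnj z * h2" "cnj h1 * w"]
      by (simp add: norm_mult mult_left_mono divide_right_mono)
    also have "\<dots> = (l * cmod z / D) * cmod h2 + (l * cmod w / D) * cmod h1"
      by (simp add: distrib_left add_divide_distrib mult_ac)
    also have "\<dots> \<le> (1 + l) * cmod h2 + (1 + l) * cmod h1" by (intro add_mono mult_right_mono lz lw) auto
    finally show ?thesis by (simp add: algebra_simps)
  qed
  have t2: "cmod (((2 * (z \<bullet> h1) + 2 * (w \<bullet> h2)) * (- (l\<^sup>2 / D\<^sup>2))) *\<^sub>R (cnj z * w)) \<le> 2 * (1 + l) * (cmod h1 + cmod h2)"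
  proof -
    have "\<bar>2 * (z \<bullet> h1) + 2 * (w \<bullet> h2)\<bar> \<le> 2 * (cmod z * cmod h1) + 2 * (cmod w * cmod h2)"
      using Cauchy_Schwarz_ineq2[of z h1] Cauchy_Schwarz_ineq2[of w h2] by linarith
    then have "cmod (((2 * (z \<bullet> h1) + 2 * (w \<bullet> h2)) * (- (l\<^sup>2 / D\<^sup>2))) *\<^sub>R (cnj z * w))
      \<le> (2 * (cmod z * cmod h1) + 2 * (cmod w * cmod h2)) * (l\<^sup>2 / D\<^sup>2) * (cmod z * cmod w)"
      by (simp add: abs_mult norm_mult mult_right_mono divide_right_mono)
    also have "\<dots> = (l * (cmod z * cmod w) / D) * (2 * ((l * cmod z / D) * cmod h1 + (l * cmod w / D) * cmod h2))"
      by (simp add: power2_eq_square field_simps add_divide_distrib)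
    also have "\<dots> \<le> 1 * (2 * ((1 + l) * cmod h1 + (1 + l) * cmod h2))"
      using l D by (intro mult_mono mult_left_mono add_mono mult_right_mono lz lw lzw) auto
    finally show ?thesis by (simp add: algebra_simps)
  qed
  have "quot' l p h = (l / D) *\<^sub>R (cnj z * h2 + cnj h1 * w) + ((2 * (z \<bullet> h1) + 2 * (w \<bullet> h2)) * (- (l\<^sup>2 / D\<^sup>2))) *\<^sub>R (cnj z * w)"
    by (simp add: quot'_def D_def z_def w_def h1_def h2_def)
  then have "cmod (quot' l p h) \<le> (1 + l) * (cmod h1 + cmod h2) + 2 * (1 + l) * (cmod h1 + cmod h2)"
    using norm_triangle_mono[OF t1 t2] by simp
  also have "\<dots> = 3 * (1 + l) * (cmod h1 + cmod h2)" by (simp add: algebra_simps)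
  finally show "cmod (quot' l p h) \<le> 3 * (1 + l) * (cmod (fst h) + cmod (snd h))" by (simp add: h1_def h2_def)
qed

lemma quot_bound:
  assumes "l \<ge> 0"
  shows "cmod (quot l (z, w)) \<le> 1"
proof -
  define s where "s = z \<bullet> z + w \<bullet> w"
  have s: "s \<ge> 0" "0 < 1 + l * s" using assms by (auto simp: s_def add_pos_nonneg)
  have "2 * (cmod z * cmod w) \<le> s"
    using sum_squares_bound[of "cmod z" "cmod w"] by (simp add: s_def power2_norm_eq_inner)
  then have "cmod z * cmod w \<le> s" using mult_nonneg_nonneg[OF norm_ge_zero[of z] norm_ge_zero[of w]] by linarith
  then have "l * (cmod z * cmod w) \<le> 1 + l * s" using mult_left_mono[OF _ assms] by fastforce
  then show ?thesis using s assms by (simp add: quot_def norm_mult s_def[symmetric] divide_le_eq)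
qed

lemma quot_tendsto:
  "(\<lambda>n. quot (real n) (z, w)) \<longlonglongrightarrow> (1 / (z \<bullet> z + w \<bullet> w)) *\<^sub>R (cnj z * w)"
proof (cases "z \<bullet> z + w \<bullet> w = 0")
  case True
  then have "z = 0" by (simp add: add_nonneg_eq_0_iff)
  then show ?thesis by (simp add: quot_def)
next
  case False
  define s where "s = z \<bullet> z + w \<bullet> w"
  have s: "s \<noteq> 0" "s \<ge> 0" using False by (auto simp: s_def)
  have "(\<lambda>n. 1 / (1 / real n + s)) \<longlonglongrightarrow> 1 / (0 + s)"
    using s by (intro tendsto_intros lim_1_over_n) auto
  moreover have "\<forall>\<^sub>F n in sequentially. 1 / (1 / real n + s) = real n / (1 + real n * s)"
    using eventually_gt_at_top[of 0] by eventually_elim (use s in \<open>simp add: field_simps\<close>)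
  ultimately have "(\<lambda>n. real n / (1 + real n * s)) \<longlonglongrightarrow> 1 / s"
    using Lim_transform_eventually by fastforce
  from tendsto_scaleR[OF this tendsto_const] show ?thesis by (simp add: quot_def s_def)
qed

text \<open>With r = |u|^2 and D = 1 + 2 l r, the two terms of the differential cancel to leading
  order in l: their sum is proportional to l/D - 2 l^2 r/D^2 = l/D^2, which is of order 1/l where
  |u| is bounded away from 0.\<close>

lemma quot'_small:
  assumes uv: "cmod u = cmod v" "u \<noteq> 0" and m: "cnj u * g = cnj v * k" and l: "l > 0"
  shows "cmod (quot' l (u, v) (g, k)) \<le> cmod g / (2 * l * cmod u ^ 3)"
proof -
  define r where "r = (cmod u)\<^sup>2"
  define D where "D = 1 + 2 * l * r"
  define \<mu> where "\<mu> = Re (cnj u * g)"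
  have r: "r > 0" "u \<bullet> u = r" "v \<bullet> v = r" using uv by (auto simp: r_def power2_norm_eq_inner[symmetric])
  have D: "D > 0" "D \<ge> 2 * l * r" using l r by (auto simp: D_def add_pos_pos)
  have cu: "cnj u * u = of_real r" "cnj v * v = of_real r"
    using uv complex_norm_square[of u] complex_norm_square[of v] by (simp_all add: r_def mult.commute)
  \<comment> \<open>Multiplying by \<open>r\<close> replaces division by \<open>cnj u\<close> or
    \<open>cnj v\<close>: it lets the hypothesis \<open>m\<close> express \<open>k\<close> through
    \<open>g\<close>.\<close>
  have k1: "of_real r * (cnj u * k) = (cnj u * g) * (cnj u * v)"
    unfolding cu(2)[symmetric] m by (simp add: mult_ac)
  have g1: "of_real r * (cnj g * v) = cnj (cnj u * g) * (cnj u * v)"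
    unfolding cu(1)[symmetric] by (simp add: mult_ac)
  have sum: "of_real r * (cnj u * k + cnj g * v) = of_real (2 * \<mu>) * (cnj u * v)"
    unfolding distrib_left k1 g1 by (simp only: distrib_right[symmetric] complex_add_cnj \<mu>_def)
  have in_eq: "u \<bullet> g = \<mu>" "v \<bullet> k = \<mu>"
    using m by (simp_all only: \<mu>_def Re_cnj_mult[symmetric])
  have "of_real r * quot' l (u, v) (g, k)
      = of_real (l / D) * (of_real r * (cnj u * k + cnj g * v)) + of_real (r * (4 * \<mu> * (- (l\<^sup>2 / D\<^sup>2)))) * (cnj u * v)"
  proof -
    have "1 + l * (u \<bullet> u + v \<bullet> v) = D" by (simp add: r(2,3) D_def algebra_simps)
    then have q: "quot' l (u, v) (g, k) = (l / D) *\<^sub>R (cnj u * k + cnj g * v) + ((4 * \<mu>) * (- (l\<^sup>2 / D\<^sup>2))) *\<^sub>R (cnj u * v)"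
      by (simp add: quot'_def in_eq)
    have "of_real r * (a *\<^sub>R X + b *\<^sub>R Y) = of_real a * (of_real r * X) + of_real (r * b) * Y" for a b and X Y :: complex
      by (simp add: scaleR_conv_of_real algebra_simps)
    then show ?thesis unfolding q .
  qed
  also have "\<dots> = of_real (2 * \<mu> * l / D - 4 * \<mu> * l\<^sup>2 * r / D\<^sup>2) * (cnj u * v)"
    unfolding sum by (simp add: algebra_simps)
  also have "2 * \<mu> * l / D - 4 * \<mu> * l\<^sup>2 * r / D\<^sup>2 = 2 * \<mu> * l / D\<^sup>2"
  proof -
    have "2 * \<mu> * l / D - 4 * \<mu> * l\<^sup>2 * r / D\<^sup>2 = 2 * \<mu> * l * (D - 2 * l * r) / D\<^sup>2"
      using D by (simp add: power2_eq_square field_simps)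
    then show ?thesis by (simp add: D_def)
  qed
  finally have "r * cmod (quot' l (u, v) (g, k)) = \<bar>2 * \<mu> * l / D\<^sup>2\<bar> * (cmod u * cmod v)"
    using r(1) by (metis norm_mult norm_of_real abs_of_pos complex_mod_cnj)
  also have "\<dots> = r * (2 * \<bar>\<mu>\<bar> * l / D\<^sup>2)"
    using uv l by (simp add: abs_mult r_def power2_eq_square)
  finally have "r * cmod (quot' l (u, v) (g, k)) = r * (2 * \<bar>\<mu>\<bar> * l / D\<^sup>2)" .
  then have "cmod (quot' l (u, v) (g, k)) = 2 * \<bar>\<mu>\<bar> * l / D\<^sup>2"
    by (rule mult_left_cancel[THEN iffD1, rotated]) (use r in simp)
  also have "\<dots> \<le> 2 * (cmod u * cmod g) * l / (2 * l * r)\<^sup>2"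
  proof (rule frac_le)
    show "2 * \<bar>\<mu>\<bar> * l \<le> 2 * (cmod u * cmod g) * l"
      using abs_Re_le_cmod[of "cnj u * g"] l by (simp add: \<mu>_def norm_mult)
    show "(2 * l * r)\<^sup>2 \<le> D\<^sup>2" using D l r by (intro power_mono) auto
  qed (use l r in auto)
  also have "\<dots> = cmod g / (2 * l * cmod u ^ 3)"
    using l uv(2) by (simp add: r_def power2_eq_square power3_eq_cube field_simps)
  finally show ?thesis .
qed

text \<open>The regularised quotients converge boundedly to \<open>E\<close>. A test function
  supported in the component sees only points where |u| has a positive lower bound, so the
  differentials tend to 0 there and \<open>E\<close> has vanishing weak gradient. Connectedness then
  makes \<open>E\<close> constant.\<close>

lemma phase_constant_on_component:
  fixes r :: "real^'d::finite \<Rightarrow> real"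
  assumes H: "H1_limit \<phi> u g" "H1_limit \<eta> v k" and r: "continuous_on UNIV r"
    and ur: "AE x in lebesgue. (cmod (u x))\<^sup>2 = r x" and vr: "AE x in lebesgue. (cmod (v x))\<^sup>2 = r x"
    and J: "AE x in lebesgue. \<forall>i. Im (cnj (u x) * g x $ i) = Im (cnj (v x) * k x $ i)"
    and \<Omega>: "\<Omega> \<in> components {x. r x \<noteq> 0}"
  obtains c where "AE x in lebesgue. x \<in> \<Omega> \<longrightarrow> v x = c * u x"
proof -
  have "open {x. r x \<noteq> 0}" by (intro open_Collect_neq r continuous_on_const)
  then have op: "open \<Omega>" using open_components \<Omega> by blast
  have con: "connected \<Omega>" by (rule in_components_connected[OF \<Omega>])
  have sub: "\<Omega> \<subseteq> {x. r x \<noteq> 0}" by (rule in_components_subset[OF \<Omega>])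
  note L = H1_limitD(2,3)[OF H(1)] H1_limitD(2,3)[OF H(2)]
  have uv: "AE x in lebesgue. cmod (u x) = cmod (v x)"
    using ur vr by eventually_elim (metis norm_ge_zero power2_eq_iff_nonneg)
  have m: "AE x in lebesgue. cnj (u x) * g x $ i = cnj (v x) * k x $ i" for i
    using equal_density_Re[OF H uv, of i] J
    by eventually_elim (rule complex_eqI, simp only: Re_cnj_mult, blast)
  define E where "E x = (1 / (u x \<bullet> u x + v x \<bullet> v x)) *\<^sub>R (cnj (u x) * v x)" for x
  have lim: "(\<lambda>n. quot (real n) (u x, v x)) \<longlonglongrightarrow> E x" for x
    unfolding E_def by (rule quot_tendsto)
  have mq: "(\<lambda>x. quot (real n) (u x, v x)) \<in> borel_measurable lebesgue" for n
  proof -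
    interpret C1_bounded "quot (real n)" "quot' (real n)" "3 * (1 + real n)" by (rule quot_C1_bounded) simp
    show ?thesis
      by (intro measurable_compose[OF _ borel_measurable_continuous_onI[OF F_continuous]] borel_measurable_Pair L2_measurable L)
  qed
  have mE: "E \<in> borel_measurable lebesgue"
    by (rule borel_measurable_LIMSEQ_metric[OF mq lim])
  have bE: "cmod (E x) \<le> 1" for x
    by (rule LIMSEQ_le_const2[OF tendsto_norm[OF lim]]) (use quot_bound in auto)
  have E1: "L1_loc E"
    unfolding L1_loc_def set_integrable_def
  proof safe
    fix K :: "(real^'d) set" assume K: "compact K"
    show "integrable lebesgue (\<lambda>x. indicator K x *\<^sub>R E x)"
    proof (rule Bochner_Integration.integrable_bound[OF L1_locD[OF L1_loc_const[of "1::real"] K]])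
      show "(\<lambda>x. indicator K x *\<^sub>R E x) \<in> borel_measurable lebesgue"
        using K by (intro borel_measurable_scaleR borel_measurable_indicator mE) (simp add: compact_imp_closed)
    qed (use bE in \<open>auto simp: indicator_def\<close>)
  qed
  have zero: "(LINT x|lebesgue. partial_deriv i \<theta> x *\<^sub>R E x) = 0"
    if \<theta>: "\<theta> \<in> test_functions" "supp \<theta> \<subseteq> \<Omega>" for \<theta> :: "real^'d \<Rightarrow> real" and i
  proof -
    have d\<theta>: "integrable lebesgue (partial_deriv i \<theta>)"
      by (intro test_functions_integrable test_functions_partial_deriv \<theta>)
    have lim1: "(\<lambda>n. LINT x|lebesgue. partial_deriv i \<theta> x *\<^sub>R quot (real n) (u x, v x))
        \<longlonglongrightarrow> (LINT x|lebesgue. partial_deriv i \<theta> x *\<^sub>R E x)"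
    proof (rule integral_dominated_convergence[OF _ _ integrable_abs[OF d\<theta>]])
      show "AE x in lebesgue. (\<lambda>n. partial_deriv i \<theta> x *\<^sub>R quot (real n) (u x, v x)) \<longlonglongrightarrow> partial_deriv i \<theta> x *\<^sub>R E x"
        by (intro AE_I2 tendsto_scaleR tendsto_const lim)
      show "AE x in lebesgue. norm (partial_deriv i \<theta> x *\<^sub>R quot (real n) (u x, v x)) \<le> \<bar>partial_deriv i \<theta> x\<bar>" for n
        by (intro AE_I2) (auto intro!: mult_left_le quot_bound)
    qed (intro borel_measurable_scaleR borel_measurable_integrable[OF d\<theta>] mq mE)+
    \<comment> \<open>By compactness the continuous density has a positive lower bound on the
      support; this turns the estimate of \<open>quot'_small\<close> into a uniform one.\<close>
    obtain \<epsilon> where \<epsilon>: "\<epsilon> > 0" "\<And>x. x \<in> supp \<theta> \<Longrightarrow> \<epsilon> \<le> \<bar>r x\<bar>"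
    proof (cases "supp \<theta> = {}")
      case False
      have "continuous_on (supp \<theta>) (\<lambda>x. \<bar>r x\<bar>)"
        by (intro continuous_intros continuous_on_subset[OF r]) auto
      then obtain y where y: "y \<in> supp \<theta>" "\<And>x. x \<in> supp \<theta> \<Longrightarrow> \<bar>r y\<bar> \<le> \<bar>r x\<bar>"
        using continuous_attains_inf[OF test_functions_compact[OF \<theta>(1)] False] by blast
      have "r y \<noteq> 0" using y(1) \<theta>(2) sub by blast
      then show ?thesis using that[of "\<bar>r y\<bar>"] y(2) by simp
    qed (use that[of 1] in auto)
    define \<delta> where "\<delta> = sqrt \<epsilon>"
    have \<delta>: "\<delta> > 0" using \<epsilon> by (simp add: \<delta>_def)
    have pair: "integrable lebesgue (\<lambda>x. \<bar>\<theta> x\<bar> * cmod (g x $ i))"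
      using L2_prod_integrable(1)[OF test_functions_L2[OF test_functions_of_real(1)[OF \<theta>(1)]] L(2)] by simp
    define I where "I = (LINT x|lebesgue. \<bar>\<theta> x\<bar> * cmod (g x $ i))"
    \<comment> \<open>The index is shifted by one because \<open>quot'_small\<close> requires a
      positive parameter.\<close>
    have lim2: "(\<lambda>n. LINT x|lebesgue. \<theta> x *\<^sub>R quot' (real (Suc n)) (u x, v x) (g x $ i, k x $ i))
        \<longlonglongrightarrow> (LINT x|(lebesgue :: (real^'d) measure). 0)"
    proof (rule integral_tendsto_of_bound)
      show "integrable lebesgue (\<lambda>x. \<theta> x *\<^sub>R quot' (real (Suc n)) (u x, v x) (g x $ i, k x $ i))" for n
      proof -
        interpret C1_bounded "quot (real (Suc n))" "quot' (real (Suc n))" "3 * (1 + real (Suc n))"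
          by (rule quot_C1_bounded) simp
        show ?thesis by (rule L2_F'_integrable(1)[OF _ L(2,4) \<theta>(1)]) (intro borel_measurable_Pair L2_measurable L)
      qed
      show "integrable lebesgue (\<lambda>x. (1 / (2 * real (Suc n) * \<delta> ^ 3)) * (\<bar>\<theta> x\<bar> * cmod (g x $ i)))" for n
        by (rule integrable_mult_right[OF pair])
      show "AE x in lebesgue. cmod (\<theta> x *\<^sub>R quot' (real (Suc n)) (u x, v x) (g x $ i, k x $ i) - 0)
          \<le> (1 / (2 * real (Suc n) * \<delta> ^ 3)) * (\<bar>\<theta> x\<bar> * cmod (g x $ i))" for n
        using m[of i] ur uv
      proof eventually_elim
        case (elim x)
        show ?case
        proof (cases "\<theta> x = 0")
          case False
          then have "x \<in> supp \<theta>" by (rule in_supp)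
          then have "\<epsilon> \<le> (cmod (u x))\<^sup>2" using \<epsilon>(2)[of x] elim(2) by (metis abs_of_nonneg zero_le_power2)
          then have \<delta>u: "\<delta> \<le> cmod (u x)" unfolding \<delta>_def by (simp add: real_le_lsqrt)
          then have u0: "u x \<noteq> 0" using \<delta> by auto
          have "cmod (quot' (real (Suc n)) (u x, v x) (g x $ i, k x $ i)) \<le> cmod (g x $ i) / (2 * real (Suc n) * cmod (u x) ^ 3)"
            by (rule quot'_small[OF elim(3) u0 elim(1)]) simp
          also have "\<dots> \<le> cmod (g x $ i) / (2 * real (Suc n) * \<delta> ^ 3)"
            using \<delta> \<delta>u by (intro divide_left_mono mult_left_mono power_mono mult_pos_pos) auto
          finally have "cmod (quot' (real (Suc n)) (u x, v x) (g x $ i, k x $ i)) \<le> cmod (g x $ i) / (2 * real (Suc n) * \<delta> ^ 3)" .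
          from mult_left_mono[OF this abs_ge_zero[of "\<theta> x"]] show ?thesis by simp
        qed simp
      qed
      show "(LINT x|lebesgue. (1 / (2 * real (Suc n) * \<delta> ^ 3)) * (\<bar>\<theta> x\<bar> * cmod (g x $ i))) \<le> (I / (2 * \<delta> ^ 3)) * (1 / real (Suc n))" for n
        by (simp only: integral_mult_right_zero I_def[symmetric]) (simp add: field_simps)
      have "(\<lambda>n. (I / (2 * \<delta> ^ 3)) * (1 / real (Suc n))) \<longlonglongrightarrow> (I / (2 * \<delta> ^ 3)) * 0"
        by (intro tendsto_mult tendsto_const LIMSEQ_Suc[OF lim_1_over_n])
      then show "(\<lambda>n. (I / (2 * \<delta> ^ 3)) * (1 / real (Suc n))) \<longlonglongrightarrow> 0" by simp
    qed simp
    have eq: "(LINT x|lebesgue. partial_deriv i \<theta> x *\<^sub>R quot (real (Suc n)) (u x, v x))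
       = - (LINT x|lebesgue. \<theta> x *\<^sub>R quot' (real (Suc n)) (u x, v x) (g x $ i, k x $ i))" for n
    proof -
      interpret C1_bounded "quot (real (Suc n))" "quot' (real (Suc n))" "3 * (1 + real (Suc n))"
        by (rule quot_C1_bounded) simp
      show ?thesis by (rule weak_chain_rule[OF H \<theta>(1)])
    qed
    have "(\<lambda>n. LINT x|lebesgue. partial_deriv i \<theta> x *\<^sub>R quot (real (Suc n)) (u x, v x)) \<longlonglongrightarrow> 0"
      unfolding eq using tendsto_minus[OF lim2] by simp
    with LIMSEQ_Suc[OF lim1] show ?thesis by (rule LIMSEQ_unique)
  qed
  obtain c where c: "AE x in lebesgue. x \<in> \<Omega> \<longrightarrow> E x = c"
    by (rule zero_gradient_connected[OF E1 op con zero])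
  \<comment> \<open>The factor 2 arises because the denominator of \<open>E\<close> is |u|^2 + |v|^2
    = 2 |u|^2.\<close>
  have "AE x in lebesgue. x \<in> \<Omega> \<longrightarrow> v x = (2 * c) * u x"
    using c ur uv
  proof eventually_elim
    case (elim x)
    show ?case
    proof
      assume x: "x \<in> \<Omega>"
      define s where "s = (cmod (u x))\<^sup>2"
      have s: "s \<noteq> 0" using x sub elim(2) by (auto simp: s_def)
      have inn: "u x \<bullet> u x + v x \<bullet> v x = 2 * s" using elim(3) by (simp add: s_def dot_square_norm)
      have "c = (1 / (2 * s)) *\<^sub>R (cnj (u x) * v x)" using elim(1) x unfolding E_def inn by simp
      then have "(2 * c) * u x = (1 / of_real s) * ((cnj (u x) * u x) * v x)"
        using s by (simp add: scaleR_conv_of_real field_simps)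
      also have "cnj (u x) * u x = of_real s" using complex_norm_square[of "u x"] by (simp add: s_def mult.commute)
      finally show "v x = (2 * c) * u x" using s by simp
    qed
  qed
  then show ?thesis by (rule that)
qed

section \<open>Trajectories of finite energy data\<close>

lemma integrable_imp_L1_loc: "integrable lebesgue f \<Longrightarrow> L1_loc f"
  unfolding L1_loc_def set_integrable_def
  by (auto intro!: integrable_mult_indicator simp: compact_imp_closed)

definition current :: "(real^'d::finite \<Rightarrow> complex) \<Rightarrow> (real^'d \<Rightarrow> complex^'d) \<Rightarrow> real^'d \<Rightarrow> real^'d" where
  "current u g x = (\<chi> i. Im (cnj (u x) * g x $ i))"

lemma current_integrable:
  assumes u: "u \<in> L2" and g: "\<And>i. (\<lambda>x. g x $ i) \<in> L2"
  shows "integrable lebesgue (current u g)"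
    and "(LINT x|lebesgue. norm (current u g x)) \<le> (\<Sum>i\<in>UNIV. L2_norm u * L2_norm (\<lambda>x. g x $ i))"
proof -
  have i: "integrable lebesgue (\<lambda>x. current u g x $ i)" for i
    using integrable_Im[OF L2_inner_integrable[OF u g]] by (simp add: current_def)
  show I: "integrable lebesgue (current u g)" by (rule integrable_vec[OF i])
  have "(LINT x|lebesgue. norm (current u g x)) \<le> (LINT x|lebesgue. (\<Sum>i\<in>UNIV. cmod (u x) * cmod (g x $ i)))"
  proof (rule integral_mono)
    show "integrable lebesgue (\<lambda>x. \<Sum>i\<in>UNIV. cmod (u x) * cmod (g x $ i))"
      by (intro Bochner_Integration.integrable_sum L2_prod_integrable u g)
    fix x
    have "norm (current u g x) \<le> (\<Sum>i\<in>UNIV. \<bar>current u g x $ i\<bar>)" by (rule norm_le_l1_cart)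
    also have "\<dots> \<le> (\<Sum>i\<in>UNIV. cmod (u x) * cmod (g x $ i))"
    proof (rule sum_mono)
      fix i
      show "\<bar>current u g x $ i\<bar> \<le> cmod (u x) * cmod (g x $ i)"
        using abs_Im_le_cmod[of "cnj (u x) * g x $ i"] by (simp add: current_def norm_mult)
    qed
    finally show "norm (current u g x) \<le> (\<Sum>i\<in>UNIV. cmod (u x) * cmod (g x $ i))" .
  qed (use I in simp)
  also have "\<dots> = (\<Sum>i\<in>UNIV. LINT x|lebesgue. cmod (u x) * cmod (g x $ i))"
    by (rule Bochner_Integration.integral_sum) (rule L2_prod_integrable[OF u g])
  also have "\<dots> \<le> (\<Sum>i\<in>UNIV. L2_norm u * L2_norm (\<lambda>x. g x $ i))"
    by (intro sum_mono L2_norm_mult_le u g)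
  finally show "(LINT x|lebesgue. norm (current u g x)) \<le> (\<Sum>i\<in>UNIV. L2_norm u * L2_norm (\<lambda>x. g x $ i))" .
qed

lemma density_L1_distance:
  assumes u: "u \<in> L2" and v: "v \<in> L2"
  shows "(LINT x|lebesgue. \<bar>(cmod (u x))\<^sup>2 - (cmod (v x))\<^sup>2\<bar>) \<le> L2_norm (\<lambda>x. u x - v x) * (L2_norm u + L2_norm v)"
proof -
  note d = L2_diff[OF u v]
  have "(LINT x|lebesgue. \<bar>(cmod (u x))\<^sup>2 - (cmod (v x))\<^sup>2\<bar>)
     \<le> (LINT x|lebesgue. cmod (u x - v x) * cmod (u x) + cmod (u x - v x) * cmod (v x))"
  proof (rule integral_mono)
    show "integrable lebesgue (\<lambda>x. \<bar>(cmod (u x))\<^sup>2 - (cmod (v x))\<^sup>2\<bar>)"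
      by (intro integrable_abs Bochner_Integration.integrable_diff L2_integrable u v)
    show "integrable lebesgue (\<lambda>x. cmod (u x - v x) * cmod (u x) + cmod (u x - v x) * cmod (v x))"
      by (intro Bochner_Integration.integrable_add L2_prod_integrable d u v)
    fix x
    have "\<bar>(cmod (u x))\<^sup>2 - (cmod (v x))\<^sup>2\<bar> = \<bar>cmod (u x) - cmod (v x)\<bar> * (cmod (u x) + cmod (v x))"
      by (simp add: power2_eq_square square_diff_square_factored abs_mult mult.commute)
    also have "\<dots> \<le> cmod (u x - v x) * (cmod (u x) + cmod (v x))"
      by (intro mult_right_mono norm_triangle_ineq3) auto
    finally show "\<bar>(cmod (u x))\<^sup>2 - (cmod (v x))\<^sup>2\<bar> \<le> cmod (u x - v x) * cmod (u x) + cmod (u x - v x) * cmod (v x)"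
      by (simp add: distrib_left)
  qed
  also have "\<dots> = (LINT x|lebesgue. cmod (u x - v x) * cmod (u x)) + (LINT x|lebesgue. cmod (u x - v x) * cmod (v x))"
    by (intro Bochner_Integration.integral_add L2_prod_integrable d u v)
  also have "\<dots> \<le> L2_norm (\<lambda>x. u x - v x) * L2_norm u + L2_norm (\<lambda>x. u x - v x) * L2_norm v"
    by (intro add_mono L2_norm_mult_le d u v)
  finally show ?thesis by (simp add: distrib_left)
qed

section \<open>Continuity in time of density and current\<close>

context energy_form
begin

text \<open>Density follows from the dense domain of the self-adjoint closure, whose elements are
  limits of test functions; no mollification is involved.\<close>

lemma test_functions_dense:
  assumes f: "f \<in> L2" and e: "\<epsilon> > 0"
  obtains \<phi> :: "real^'d \<Rightarrow> complex" where "\<phi> \<in> test_functions" "L2_norm (\<lambda>x. f x - \<phi> x) < \<epsilon>"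
proof -
  have "densely_defined (graph_closure (hamiltonian V))"
    using esa by (simp add: essentially_self_adjoint_def self_adjoint_def)
  then obtain u v where uv: "(u, v) \<in> graph_closure (hamiltonian V)" "L2_norm (\<lambda>x. f x - u x) < \<epsilon>/2"
    using f e unfolding densely_defined_def by (metis (no_types, lifting) case_prodE half_gt_zero)
  obtain \<phi> where \<phi>: "\<And>n::nat. \<phi> n \<in> test_functions" "u \<in> L2" "(\<lambda>n. L2_norm (\<lambda>x. \<phi> n x - u x)) \<longlonglongrightarrow> 0"
    using closure_approx[OF uv(1)] by blast
  obtain n where n: "L2_norm (\<lambda>x. \<phi> n x - u x) < \<epsilon>/2"
    using order_tendstoD(2)[OF \<phi>(3), of "\<epsilon>/2"] e by (auto simp: eventually_sequentially)
  have "L2_norm (\<lambda>x. f x - \<phi> n x) \<le> L2_norm (\<lambda>x. f x - u x) + L2_norm (\<lambda>x. u x - \<phi> n x)"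
    by (intro L2_norm_triangle_diff f \<phi> test_functions_L2)
  also have "\<dots> < \<epsilon>" using n uv(2) by (simp add: L2_norm_minus_commute[of u])
  finally show ?thesis using that \<phi>(1) by blast
qed

text \<open>The evolution is strongly continuous in L2, but no strong continuity of the gradients is
  available here. Against a test function the derivative is moved away; the bound \<open>B\<close>
  extends this to every \<open>f\<close> in L2 by density.\<close>

lemma weak_convergence_of_gradients:
  fixes v :: "real \<Rightarrow> real^'d \<Rightarrow> complex" and G :: "real \<Rightarrow> real^'d \<Rightarrow> complex^'d"
  assumes v: "\<And>t. v t \<in> L2" and G: "\<And>t. weak_gradient (v t) (G t)" "\<And>t. (\<lambda>x. G t x $ i) \<in> L2"
    and B: "\<And>t. L2_norm (\<lambda>x. G t x $ i) \<le> B"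
    and lim: "((\<lambda>t. L2_norm (\<lambda>x. v t x - v s x)) \<longlongrightarrow> 0) (at s within I)" and f: "f \<in> L2"
  shows "((\<lambda>t. L2_inner f (\<lambda>x. G t x $ i - G s x $ i)) \<longlongrightarrow> 0) (at s within I)"
proof (rule tendstoI)
  fix \<epsilon> :: real assume \<epsilon>: "\<epsilon> > 0"
  have B0: "B \<ge> 0" using B[of s] L2_norm_nonneg[of "\<lambda>x. G s x $ i"] by linarith
  \<comment> \<open>The gradient difference has norm at most 2 B; the added 1 avoids division by 0,
    and the outer 2 leaves half of \<open>\<epsilon>\<close> for the test function part.\<close>
  define \<delta> where "\<delta> = \<epsilon> / (2 * (2 * B + 1))"
  have \<delta>: "\<delta> > 0" using \<epsilon> B0 by (simp add: \<delta>_def)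
  obtain \<theta> :: "real^'d \<Rightarrow> complex" where \<theta>: "\<theta> \<in> test_functions" "L2_norm (\<lambda>x. f x - \<theta> x) < \<delta>"
    by (rule test_functions_dense[OF f \<delta>])
  note \<theta>L = test_functions_L2[OF \<theta>(1)] test_functions_L2[OF test_functions_partial_deriv[OF \<theta>(1), of i]]
  have "((\<lambda>t. L2_norm (partial_deriv i \<theta>) * L2_norm (\<lambda>x. v t x - v s x)) \<longlongrightarrow> L2_norm (partial_deriv i \<theta>) * 0) (at s within I)"
    by (intro tendsto_mult tendsto_const lim)
  then have "\<forall>\<^sub>F t in at s within I. L2_norm (partial_deriv i \<theta>) * L2_norm (\<lambda>x. v t x - v s x) < \<epsilon>/2"
    using \<epsilon> by (intro order_tendstoD(2)) auto
  then show "\<forall>\<^sub>F t in at s within I. dist (L2_inner f (\<lambda>x. G t x $ i - G s x $ i)) 0 < \<epsilon>"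
  proof eventually_elim
    case (elim t)
    have d: "(\<lambda>x. G t x $ i - G s x $ i) \<in> L2" by (intro L2_diff G)
    have nd: "L2_norm (\<lambda>x. G t x $ i - G s x $ i) \<le> 2 * B"
      using L2_norm_triangle[OF G(2)[of t] L2_uminus[OF G(2)[of s]]] B[of t] B[of s] L2_norm_cmult[of "-1" "\<lambda>x. G s x $ i"]
      by simp
    have split: "L2_inner f (\<lambda>x. G t x $ i - G s x $ i)
       = L2_inner (\<lambda>x. f x - \<theta> x) (\<lambda>x. G t x $ i - G s x $ i) + L2_inner \<theta> (\<lambda>x. G t x $ i - G s x $ i)"
      by (simp add: L2_inner_diff_left f \<theta>L d)
    have "cmod (L2_inner (\<lambda>x. f x - \<theta> x) (\<lambda>x. G t x $ i - G s x $ i)) \<le> L2_norm (\<lambda>x. f x - \<theta> x) * L2_norm (\<lambda>x. G t x $ i - G s x $ i)"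
      by (intro L2_Cauchy_Schwarz L2_diff f \<theta>L G)
    also have "\<dots> \<le> \<delta> * (2 * B + 1)"
      using \<theta>(2) nd \<delta> by (intro mult_mono) (auto simp: L2_norm_nonneg)
    also have "\<dots> = \<epsilon>/2" using B0 by (simp add: \<delta>_def field_simps)
    finally have 1: "cmod (L2_inner (\<lambda>x. f x - \<theta> x) (\<lambda>x. G t x $ i - G s x $ i)) \<le> \<epsilon>/2" .
    have "L2_inner \<theta> (\<lambda>x. G t x $ i - G s x $ i) = - L2_inner (partial_deriv i \<theta>) (\<lambda>x. v t x - v s x)"
      using weak_gradient_complex_test[OF G(1)[of t] \<theta>(1), of i] weak_gradient_complex_test[OF G(1)[of s] \<theta>(1), of i]
      by (simp add: L2_inner_diff_right \<theta>L G v)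
    then have "cmod (L2_inner \<theta> (\<lambda>x. G t x $ i - G s x $ i)) \<le> L2_norm (partial_deriv i \<theta>) * L2_norm (\<lambda>x. v t x - v s x)"
      using L2_Cauchy_Schwarz[OF \<theta>L(2) L2_diff[OF v[of t] v[of s]]] by simp
    then have 2: "cmod (L2_inner \<theta> (\<lambda>x. G t x $ i - G s x $ i)) < \<epsilon>/2" using elim by linarith
    show ?case unfolding split using norm_triangle_ineq[of "L2_inner (\<lambda>x. f x - \<theta> x) (\<lambda>x. G t x $ i - G s x $ i)" "L2_inner \<theta> (\<lambda>x. G t x $ i - G s x $ i)"] 1 2
      by (simp add: dist_norm)
  qed
qed

text \<open>Prescribes the state at an arbitrary time \<open>T\<close> instead of time 0, as needed
  for data altered at an end time. The approximations in H1 are returned as well, so that the chain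
  rule applies to the new solution.\<close>

lemma solution_trajectory:
  fixes T :: real
  assumes U: "unitary_group U" and gen: "group_generator U = graph_closure (hamiltonian V)"
    and u: "finite_energy V u"
  defines "v \<equiv> \<lambda>t. U (t - T) u"
  shows "\<exists>G. (\<forall>t. \<exists>\<phi>. H1_limit \<phi> (v t) (G t)) \<and>
    qhd_trajectory V I (\<lambda>t x. (cmod (v t x))\<^sup>2) (\<lambda>t. current (v t) (G t))"
proof -
  have uL: "u \<in> L2" using u by (simp add: finite_energy_def)
  have vL: "v t \<in> L2" for t unfolding v_def by (rule unitary_groupD(1)[OF U uL])
  obtain M where M: "\<And>t w. w \<in> L2 \<Longrightarrow> AE x in lebesgue. w x = U t u x \<Longrightarrow>
      \<exists>\<phi> g. H1_limit \<phi> w g \<and> (\<forall>n. form (\<phi> n) \<le> M)"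
    using evolution_finite_energy[OF U gen u] by blast
  have "\<exists>g \<phi>. H1_limit \<phi> (v t) g \<and> (\<forall>n. form (\<phi> n) \<le> M)" for t
    using M[OF vL, of t "t - T"] by (auto simp: v_def)
  then have "\<forall>t. \<exists>g. \<exists>\<phi>. H1_limit \<phi> (v t) g \<and> (\<forall>n. form (\<phi> n) \<le> M)" by blast
  from choice[OF this] obtain G where G: "\<And>t. \<exists>\<phi>. H1_limit \<phi> (v t) (G t) \<and> (\<forall>n. form (\<phi> n) \<le> M)" by blast
  have fin: "finite_energy V (v t)" and GL: "(\<lambda>x. G t x $ i) \<in> L2" and GB: "L2_norm (\<lambda>x. G t x $ i) \<le> sqrt (2 * M)"
    and vB: "L2_norm (v t) \<le> sqrt M" and wg: "weak_gradient (v t) (G t)" for t i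
    using G[of t] H1_limit_finite_energy H1_limitD(3) H1_limit_weak_gradient by metis+
  have cont: "((\<lambda>t. L2_norm (\<lambda>x. v t x - v s x)) \<longlongrightarrow> 0) (at s)" for s
  proof -
    have "((\<lambda>t. L2_norm (\<lambda>x. U t u x - U (s - T) u x)) \<longlongrightarrow> 0) (at (s - T))"
      by (rule unitary_groupD(6)[OF U uL])
    then have "((\<lambda>t. L2_norm (\<lambda>x. U (t - T) u x - U (s - T) u x)) \<longlongrightarrow> 0) (at s)"
      by (subst (asm) at_to_0) (subst at_to_0, simp add: filterlim_filtermap algebra_simps)
    then show ?thesis by (simp add: v_def)
  qed
  have contI: "((\<lambda>t. L2_norm (\<lambda>x. v t x - v s x)) \<longlongrightarrow> 0) (at s within I)" for s
    by (rule tendsto_within_subset[OF cont]) simp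
  have bes: "bounded_energy_solution V v"
    unfolding bounded_energy_solution_def
  proof (intro exI[of _ U] conjI U gen allI fin vL)
    fix t
    have "AE x in lebesgue. U (t + - T) u x = U t (U (- T) u) x" by (rule unitary_groupD(5)[OF U uL])
    then show "AE x in lebesgue. v t x = U t (v 0) x" by (simp add: v_def)
  qed
  have "qhd_trajectory V I (\<lambda>t x. (cmod (v t x))\<^sup>2) (\<lambda>t. current (v t) (G t))"
    unfolding qhd_trajectory_def
  proof (intro conjI ballI)
    have "hydrodynamic_state (v t) (\<lambda>x. (cmod (v t x))\<^sup>2) (current (v t) (G t))" for t
      unfolding hydrodynamic_state_def using wg[of t] by (auto simp: current_def)
    then show "\<exists>\<psi>. bounded_energy_solution V \<psi> \<and>
      (\<forall>t\<in>I. hydrodynamic_state (\<psi> t) (\<lambda>x. (cmod (v t x))\<^sup>2) (current (v t) (G t)))"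
      using bes by blast
    show "integrable lebesgue (\<lambda>x. (cmod (v t x))\<^sup>2)" for t by (rule L2_integrable[OF vL])
    show "L1_loc (current (v t) (G t))" for t
      by (rule integrable_imp_L1_loc[OF current_integrable(1)[OF vL GL]])
    show "\<exists>C. AE t in lebesgue. t \<in> I \<longrightarrow>
        integrable lebesgue (current (v t) (G t)) \<and> (LINT x|lebesgue. norm (current (v t) (G t) x)) \<le> C"
    proof (intro exI AE_I2 impI conjI)
      fix t
      show "integrable lebesgue (current (v t) (G t))" by (rule current_integrable(1)[OF vL GL])
      have "(LINT x|lebesgue. norm (current (v t) (G t) x)) \<le> (\<Sum>i\<in>UNIV. L2_norm (v t) * L2_norm (\<lambda>x. G t x $ i))"
        by (rule current_integrable(2)[OF vL GL])
      also have "\<dots> \<le> (\<Sum>i\<in>(UNIV::'d set). sqrt M * sqrt (2 * M))"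
        using order_trans[OF L2_norm_nonneg vB] by (intro sum_mono mult_mono vB GB L2_norm_nonneg)
      finally show "(LINT x|lebesgue. norm (current (v t) (G t) x)) \<le> (\<Sum>i\<in>(UNIV::'d set). sqrt M * sqrt (2 * M))" .
    qed
    show "((\<lambda>t. LINT x|lebesgue. \<bar>(cmod (v t x))\<^sup>2 - (cmod (v s x))\<^sup>2\<bar>) \<longlongrightarrow> 0) (at s within I)" for s
    proof (rule tendsto_sandwich[OF _ _ tendsto_const])
      show "\<forall>\<^sub>F t in at s within I. (LINT x|lebesgue. \<bar>(cmod (v t x))\<^sup>2 - (cmod (v s x))\<^sup>2\<bar>)
          \<le> L2_norm (\<lambda>x. v t x - v s x) * (sqrt M + sqrt M)"
      proof (intro always_eventually allI)
        fix t
        have "L2_norm (\<lambda>x. v t x - v s x) * (L2_norm (v t) + L2_norm (v s)) \<le> L2_norm (\<lambda>x. v t x - v s x) * (sqrt M + sqrt M)"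
          by (intro mult_left_mono add_mono vB L2_norm_nonneg)
        then show "(LINT x|lebesgue. \<bar>(cmod (v t x))\<^sup>2 - (cmod (v s x))\<^sup>2\<bar>) \<le> L2_norm (\<lambda>x. v t x - v s x) * (sqrt M + sqrt M)"
          using density_L1_distance[OF vL vL, of t s] by linarith
      qed
      have "((\<lambda>t. L2_norm (\<lambda>x. v t x - v s x) * (sqrt M + sqrt M)) \<longlongrightarrow> 0 * (sqrt M + sqrt M)) (at s within I)"
        by (intro tendsto_mult tendsto_const contI)
      then show "((\<lambda>t. L2_norm (\<lambda>x. v t x - v s x) * (sqrt M + sqrt M)) \<longlongrightarrow> 0) (at s within I)" by simp
    qed simp
    fix \<theta> :: "real^'d \<Rightarrow> real" assume \<theta>: "\<theta> \<in> test_functions"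
    define T where "T x = complex_of_real (\<theta> x)" for x
    have Tt: "T \<in> test_functions" unfolding T_def by (rule test_functions_of_real(1)[OF \<theta>])
    have Tm: "T \<in> borel_measurable lebesgue" by (rule L2_measurable[OF test_functions_L2[OF Tt]])
    obtain C where C: "C \<ge> 0" "\<And>x. cmod (T x) \<le> C"
      using continuous_compact_supp_bounded[OF Ck_imp_continuous[OF test_functions_Ck[OF Tt]] test_functions_compact[OF Tt]] by blast
    have TL: "(\<lambda>x. T x * f x) \<in> L2" if "f \<in> L2" for f by (rule L2_mult_bounded[OF that Tm C(2)])
    have comp: "(LINT x|lebesgue. \<theta> x *\<^sub>R current (v t) (G t) x) $ i = Im (L2_inner (\<lambda>x. T x * v t x) (\<lambda>x. G t x $ i))" for t i
    proof -
      have "integrable lebesgue (\<lambda>x. \<theta> x *\<^sub>R current (v t) (G t) x)"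
        by (rule integrable_bilinear_L1_loc[OF bounded_bilinear_scaleR integrable_imp_L1_loc[OF current_integrable(1)[OF vL GL]]
              Ck_imp_continuous[OF test_functions_Ck[OF \<theta>]] test_functions_compact[OF \<theta>]])
      from integral_bounded_linear[OF bounded_linear_vec_nth this, of i]
      have "(LINT x|lebesgue. \<theta> x *\<^sub>R current (v t) (G t) x) $ i = (LINT x|lebesgue. \<theta> x * Im (cnj (v t x) * G t x $ i))"
        by (simp add: current_def)
      also have "\<dots> = (LINT x|lebesgue. Im (cnj (T x * v t x) * G t x $ i))"
        by (intro Bochner_Integration.integral_cong refl) (simp add: T_def algebra_simps)
      also have "\<dots> = Im (L2_inner (\<lambda>x. T x * v t x) (\<lambda>x. G t x $ i))"
        unfolding L2_inner_def by (rule integral_Im[OF L2_inner_integrable[OF TL[OF vL] GL]])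
      finally show ?thesis .
    qed
    have "((\<lambda>t. L2_inner (\<lambda>x. T x * v t x) (\<lambda>x. G t x $ i)) \<longlongrightarrow> L2_inner (\<lambda>x. T x * v s x) (\<lambda>x. G s x $ i)) (at s within I)" for s i
    proof -
      \<comment> \<open>Strong convergence of the state times weak convergence of the gradient: the
        first error is small in norm against a bounded gradient, the second has a fixed first
        factor.\<close>
      have split: "L2_inner (\<lambda>x. T x * v t x) (\<lambda>x. G t x $ i) = L2_inner (\<lambda>x. T x * v s x) (\<lambda>x. G s x $ i)
         + (L2_inner (\<lambda>x. T x * (v t x - v s x)) (\<lambda>x. G t x $ i) + L2_inner (\<lambda>x. T x * v s x) (\<lambda>x. G t x $ i - G s x $ i))" for t
        by (simp add: right_diff_distrib L2_inner_diff_left L2_inner_diff_right TL vL GL)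
      have 1: "((\<lambda>t. L2_inner (\<lambda>x. T x * (v t x - v s x)) (\<lambda>x. G t x $ i)) \<longlongrightarrow> 0) (at s within I)"
      proof (rule Lim_null_comparison)
        have "cmod (L2_inner (\<lambda>x. T x * (v t x - v s x)) (\<lambda>x. G t x $ i)) \<le> C * L2_norm (\<lambda>x. v t x - v s x) * sqrt (2 * M)" for t
        proof -
          have "L2_norm (\<lambda>x. T x * (v t x - v s x)) \<le> L2_norm (\<lambda>x. of_real C * (v t x - v s x))"
            unfolding L2_norm_def
          proof (intro real_sqrt_le_mono integral_mono L2_integrable TL L2_cmult L2_diff vL power_mono norm_ge_zero)
            show "cmod (T x * (v t x - v s x)) \<le> cmod (of_real C * (v t x - v s x))" for x
              using mult_right_mono[OF C(2) norm_ge_zero, of x "v t x - v s x"] C(1) by (simp add: norm_mult)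
          qed
          also have "\<dots> = C * L2_norm (\<lambda>x. v t x - v s x)" using C(1) by (simp add: L2_norm_cmult)
          finally have "L2_norm (\<lambda>x. T x * (v t x - v s x)) * L2_norm (\<lambda>x. G t x $ i) \<le> C * L2_norm (\<lambda>x. v t x - v s x) * sqrt (2 * M)"
            using C(1) by (intro mult_mono GB mult_nonneg_nonneg L2_norm_nonneg)
          then show ?thesis using L2_Cauchy_Schwarz[OF TL[OF L2_diff[OF vL[of t] vL[of s]]] GL[of t i]] by linarith
        qed
        then show "\<forall>\<^sub>F t in at s within I. cmod (L2_inner (\<lambda>x. T x * (v t x - v s x)) (\<lambda>x. G t x $ i)) \<le> C * L2_norm (\<lambda>x. v t x - v s x) * sqrt (2 * M)"
          by (intro always_eventually allI)
        have "((\<lambda>t. C * L2_norm (\<lambda>x. v t x - v s x) * sqrt (2 * M)) \<longlongrightarrow> C * 0 * sqrt (2 * M)) (at s within I)"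
          by (intro tendsto_mult tendsto_const contI)
        then show "((\<lambda>t. C * L2_norm (\<lambda>x. v t x - v s x) * sqrt (2 * M)) \<longlongrightarrow> 0) (at s within I)" by simp
      qed
      have 2: "((\<lambda>t. L2_inner (\<lambda>x. T x * v s x) (\<lambda>x. G t x $ i - G s x $ i)) \<longlongrightarrow> 0) (at s within I)"
        by (rule weak_convergence_of_gradients[OF vL wg GL GB contI TL[OF vL]])
      from tendsto_add[OF tendsto_const tendsto_add[OF 1 2]]
      show ?thesis by (subst split) simp
    qed
    then show "continuous_on I (\<lambda>t. LINT x|lebesgue. \<theta> x *\<^sub>R current (v t) (G t) x)"
      unfolding continuous_on_def by (intro ballI vec_tendstoI) (simp only: comp, intro tendsto_Im)
  qed
  then show ?thesis using G by blast
qed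

end

text \<open>A homogeneous system with more unknowns than equations, solved by Gaussian elimination:
  a pivot \<open>p\<close> removes one equation together with one unknown.\<close>

lemma exists_linear_dependency:
  fixes d :: "'j \<Rightarrow> 'k \<Rightarrow> complex"
  assumes "finite K" "finite J" "card K < card J"
  shows "\<exists>a. (\<exists>j\<in>J. a j \<noteq> 0) \<and> (\<forall>k\<in>K. (\<Sum>j\<in>J. a j * d j k) = 0)"
  using assms
proof (induction K arbitrary: J d rule: finite_induct)
  case empty
  then obtain j where "j \<in> J" by (auto simp: card_gt_0_iff)
  then show ?case by (intro exI[of _ "\<lambda>_. 1"]) auto
next
  case (insert k K)
  show ?case
  proof (cases "\<forall>j\<in>J. d j k = 0")
    case True
    have "card K < card J" using insert by simp
    then obtain a where "\<exists>j\<in>J. a j \<noteq> 0" "\<forall>k\<in>K. (\<Sum>j\<in>J. a j * d j k) = 0"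
      using insert.IH[OF insert.prems(1)] by blast
    then show ?thesis using True by auto
  next
    case False
    then obtain p where p: "p \<in> J" "d p k \<noteq> 0" by blast
    define J' where "J' = J - {p}"
    have J': "finite J'" "card K < card J'" using insert p by (auto simp: J'_def)
    obtain a where a: "\<exists>j\<in>J'. a j \<noteq> 0" "\<And>l. l \<in> K \<Longrightarrow> (\<Sum>j\<in>J'. a j * (d j l - d j k / d p k * d p l)) = 0"
      using insert.IH[OF J', of "\<lambda>j l. d j l - d j k / d p k * d p l"] by blast
    \<comment> \<open>The value at the pivot is the one that solves the eliminated equation.\<close>
    define b where "b = a(p := - (\<Sum>j\<in>J'. a j * d j k) / d p k)"
    have sum: "(\<Sum>j\<in>J. b j * d j l) = (\<Sum>j\<in>J'. a j * d j l) - (\<Sum>j\<in>J'. a j * d j k) / d p k * d p l" for l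
    proof -
      have "(\<Sum>j\<in>J. b j * d j l) = b p * d p l + (\<Sum>j\<in>J'. b j * d j l)"
        unfolding J'_def by (rule sum.remove[OF insert.prems(1) p(1)])
      also have "(\<Sum>j\<in>J'. b j * d j l) = (\<Sum>j\<in>J'. a j * d j l)"
        by (rule sum.cong) (auto simp: b_def J'_def)
      finally show ?thesis by (simp add: b_def)
    qed
    have "(\<Sum>j\<in>J. b j * d j l) = 0" if "l \<in> K" for l
      using a(2)[OF that] unfolding sum
      by (simp add: right_diff_distrib sum_subtractf sum_distrib_left sum_divide_distrib mult_ac)
    moreover have "(\<Sum>j\<in>J. b j * d j k) = 0" unfolding sum using p by simp
    moreover have "\<exists>j\<in>J. b j \<noteq> 0" using a(1) by (auto simp: b_def J'_def)
    ultimately show ?thesis by blast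
  qed
qed

lemma unitary_group_sum:
  assumes U: "unitary_group U" and f: "\<And>j. j \<in> J \<Longrightarrow> f j \<in> L2"
  shows "AE x in lebesgue. U t (\<lambda>x. \<Sum>j\<in>J. a j * f j x) x = (\<Sum>j\<in>J. a j * U t (f j) x)"
  using f
proof (induction J rule: infinite_finite_induct)
  case (insert j J)
  have s: "(\<lambda>x. \<Sum>j\<in>J. a j * f j x) \<in> L2" using insert by (intro L2_sum L2_cmult) auto
  have "AE x in lebesgue. U t (\<lambda>x. a j * f j x + 1 * (\<Sum>j\<in>J. a j * f j x)) x
     = a j * U t (f j) x + 1 * U t (\<lambda>x. \<Sum>j\<in>J. a j * f j x) x"
    using insert.prems by (intro unitary_groupD(3)[OF U _ s]) auto
  moreover have "AE x in lebesgue. U t (\<lambda>x. \<Sum>j\<in>J. a j * f j x) x = (\<Sum>j\<in>J. a j * U t (f j) x)"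
    using insert by auto
  ultimately show ?case
    by eventually_elim (use insert.hyps in simp)
qed (use unitary_groupD(3)[OF U L2_zero L2_zero, of t 0 0] in auto)

section \<open>Non-uniqueness\<close>

context energy_form
begin

text \<open>Changing the sign of the state on one component at time \<open>T\<close> produces another trajectory
  through the same hydrodynamic state.  If it agrees with the given one at time \<open>T'\<close>, then there
  the evolved restriction is a constant multiple of the state on every component.\<close>

lemma evolved_restriction:
  assumes U: "unitary_group U" and gen: "group_generator U = graph_closure (hamiltonian V)"
    and \<psi>: "finite_energy V (\<psi> 0)" "\<And>t. \<psi> t \<in> L2" "\<And>t. AE x in lebesgue. \<psi> t x = U t (\<psi> 0) x"
    and hyd: "\<And>t. t \<in> I \<Longrightarrow> hydrodynamic_state (\<psi> t) (\<rho> t) (J t)"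
    and uniq: "trajectory_unique V I \<rho> J" and T: "T \<in> I" "T' \<in> I"
    and r: "continuous_on UNIV r" "AE x in lebesgue. \<rho> T x = r x"
    and r': "continuous_on UNIV r'" "AE x in lebesgue. \<rho> T' x = r' x"
    and \<Omega>: "\<Omega> \<in> components {x. r x \<noteq> 0}"
  shows "\<exists>d. (\<forall>\<Omega>'\<in>components {x. r' x \<noteq> 0}. AE x in lebesgue. x \<in> \<Omega>' \<longrightarrow>
        U (T' - T) (\<lambda>x. indicator \<Omega> x * \<psi> T x) x = d \<Omega>' * \<psi> T' x) \<and>
      (AE x in lebesgue. r' x = 0 \<longrightarrow> U (T' - T) (\<lambda>x. indicator \<Omega> x * \<psi> T x) x = 0)"
proof -
  have H1: "\<exists>\<phi> g. H1_limit \<phi> (\<psi> t) g \<and> finite_energy V (\<psi> t)" for t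
  proof -
    obtain M where "\<And>t w. w \<in> L2 \<Longrightarrow> AE x in lebesgue. w x = U t (\<psi> 0) x \<Longrightarrow>
      \<exists>\<phi> g. H1_limit \<phi> w g \<and> (\<forall>n. form (\<phi> n) \<le> M)"
      using evolution_finite_energy[OF U gen \<psi>(1)] by blast
    from this[OF \<psi>(2,3), of t] show ?thesis using H1_limit_finite_energy(1) by blast
  qed
  have dens: "AE x in lebesgue. (cmod (\<psi> t x))\<^sup>2 = \<rho> t x" if "t \<in> I" for t
    using hyd[OF that] unfolding hydrodynamic_state_def by auto
  \<comment> \<open>The gradient chosen in the hydrodynamic state is exchanged for the one that
    belongs to the approximating sequence.\<close>
  have cur: "AE x in lebesgue. J t x = current (\<psi> t) g x" if tI: "t \<in> I" and Hg: "H1_limit \<phi> (\<psi> t) g" for t \<phi> g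
  proof -
    obtain g' where g': "weak_gradient (\<psi> t) g'" "AE x in lebesgue. J t x = (\<chi> i. Im (cnj (\<psi> t x) * g' x $ i))"
      using hyd[OF tI] unfolding hydrodynamic_state_def by blast
    have "AE x in lebesgue. g' x = g x"
      by (rule weak_gradient_unique[OF g'(1) H1_limit_weak_gradient[OF Hg]]) simp
    then show ?thesis using g'(2) by eventually_elim (simp add: current_def)
  qed
  define u where "u = \<psi> T"
  obtain \<phi> g where H: "H1_limit \<phi> u g" and fu: "finite_energy V u" using H1[of T] unfolding u_def by blast
  obtain \<phi>' g' where H': "H1_limit \<phi>' (\<psi> T') g'" using H1[of T'] by blast
  have uL: "u \<in> L2" by (rule H1_limitD(2)[OF H])
  have ur: "AE x in lebesgue. (cmod (u x))\<^sup>2 = r x"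
    using dens[OF T(1)] r(2) unfolding u_def by eventually_elim simp
  have wr: "AE x in lebesgue. (cmod (\<psi> T' x))\<^sup>2 = r' x"
    using dens[OF T(2)] r'(2) by eventually_elim simp
  have "open {x. r x \<noteq> 0}" by (intro open_Collect_neq r continuous_on_const)
  then have op: "open \<Omega>" using open_components \<Omega> by blast
  define f where "f x = indicator \<Omega> x * u x" for x
  \<comment> \<open>A real sign with square 1: the products cnj u u and cnj u times the gradient of
    u are both unchanged.\<close>
  define s where "s x = (if x \<in> \<Omega> then - 1 else 1 :: complex)" for x
  have s1: "s x = 1 - 2 * indicator \<Omega> x" "s x * s x = 1" "cnj (s x) = s x" "cmod (s x) = 1" for x
    by (auto simp: s_def indicator_def)
  have sm: "s \<in> borel_measurable lebesgue"
    unfolding s1(1)[abs_def] using op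
    by (intro borel_measurable_diff borel_measurable_times borel_measurable_const borel_measurable_indicator) simp
  have sL: "(\<lambda>x. s x * h x) \<in> L2" if "h \<in> L2" for h
    by (rule L2_mult_bounded[OF that sm, of 1]) (simp add: s1(4))
  define u' where "u' x = s x * u x" for x
  define g'' where "g'' x = (\<chi> i. s x * g x $ i)" for x
  have u'L: "u' \<in> L2" unfolding u'_def by (rule sL[OF uL])
  have gL: "(\<lambda>x. g'' x $ i) \<in> L2" for i using sL[OF H1_limitD(3)[OF H, of i]] by (simp add: g''_def)
  have wg: "weak_gradient u' g''"
    unfolding weak_gradient_def
  proof (intro conjI ballI allI)
    show "L1_loc u'" by (rule L2_imp_L1_loc[OF u'L])
    show "L1_loc g''" by (intro L1_loc_vec L2_imp_L1_loc gL)
    fix \<theta> :: "real^'d \<Rightarrow> real" and i assume \<theta>: "\<theta> \<in> test_functions"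
    \<comment> \<open>Writing the sign as 1 minus twice the indicator reduces the weak gradient of
      the altered state to the restriction to the component.\<close>
    have dec: "(LINT x|lebesgue. \<tau> x *\<^sub>R (s x * h x)) = (LINT x|lebesgue. \<tau> x *\<^sub>R h x) - 2 * (LINT x|lebesgue. \<tau> x *\<^sub>R (indicator \<Omega> x *\<^sub>R h x))"
      if "\<tau> \<in> test_functions" "h \<in> L2" for \<tau> :: "real^'d \<Rightarrow> real" and h
    proof -
      have T: "(\<lambda>x. complex_of_real (\<tau> x)) \<in> L2" by (rule test_functions_L2[OF test_functions_of_real(1)[OF that(1)]])
      have i1: "integrable lebesgue (\<lambda>x. \<tau> x *\<^sub>R h x)"
        using L2_prod_integrable(2)[OF T that(2)] by (simp add: scaleR_conv_of_real)
      have "integrable lebesgue (\<lambda>x. indicator \<Omega> x *\<^sub>R (\<tau> x *\<^sub>R h x))"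
        using op by (intro integrable_mult_indicator i1) simp
      then have i2: "integrable lebesgue (\<lambda>x. \<tau> x *\<^sub>R (indicator \<Omega> x *\<^sub>R h x))" by (simp add: mult.commute)
      have "\<tau> x *\<^sub>R (s x * h x) = \<tau> x *\<^sub>R h x - 2 * (\<tau> x *\<^sub>R (indicator \<Omega> x *\<^sub>R h x))" for x
        by (simp add: s1 indicator_def)
      then show ?thesis
        by (simp only: Bochner_Integration.integral_diff[OF i1 integrable_mult_right[OF i2]] integral_mult_right_zero)
    qed
    show "(LINT x|lebesgue. partial_deriv i \<theta> x *\<^sub>R u' x) = - (LINT x|lebesgue. \<theta> x *\<^sub>R g'' x $ i)"
      using H1_limit_weak_gradient[OF H] \<theta>
      unfolding u'_def g''_def vec_lambda_beta dec[OF test_functions_partial_deriv[OF \<theta>] uL] dec[OF \<theta> H1_limitD(3)[OF H]]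
        weak_gradient_component[OF H r(1) ur \<Omega> \<theta>]
      by (simp add: weak_gradient_def)
  qed
  obtain g0 where "(\<lambda>x. root_W x * u x) \<in> L2" using finite_energyD[OF fu] by metis
  then have "(\<lambda>x. s x * (root_W x * u x)) \<in> L2" by (rule sL)
  then have fe: "finite_energy V u'"
    using finite_energyI[OF u'L wg gL] by (simp add: u'_def mult.left_commute)
  define v where "v t = U (t - T) u'" for t
  obtain G where G: "\<forall>t. \<exists>\<phi>. H1_limit \<phi> (v t) (G t)"
    and traj: "qhd_trajectory V I (\<lambda>t x. (cmod (v t x))\<^sup>2) (\<lambda>t. current (v t) (G t))"
    using solution_trajectory[OF U gen fe, where T=T and I=I] unfolding v_def by (elim exE conjE)
  have vT: "AE x in lebesgue. v T x = u' x"
    using unitary_groupD(4)[OF U u'L] by (simp add: v_def)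
  have "same_state (\<rho> T) (J T) (\<lambda>x. (cmod (v T x))\<^sup>2) (current (v T) (G T))"
    unfolding same_state_def
  proof
    show "AE x in lebesgue. \<rho> T x = (cmod (v T x))\<^sup>2"
      using dens[OF T(1)] vT by eventually_elim (simp add: u'_def u_def norm_mult s1(4))
    obtain \<eta> where "H1_limit \<eta> (v T) (G T)" using G by blast
    then have "AE x in lebesgue. G T x = g'' x"
      by (intro weak_gradient_unique[OF H1_limit_weak_gradient wg vT])
    then show "AE x in lebesgue. J T x = current (v T) (G T) x"
      using cur[OF T(1) H[unfolded u_def]] vT
    proof eventually_elim
      case (elim x)
      have inv: "cnj (s x * a) * (s x * b) = cnj a * b" for a b
        using s1(2)[of x] by (simp add: s1(3) mult_ac)
      have "current (v T) (G T) x = current (\<psi> T) g x"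
        unfolding current_def elim(1,3) u'_def g''_def u_def vec_lambda_beta inv ..
      then show ?case using elim(2) by simp
    qed
  qed
  then have "same_state (\<rho> T') (J T') (\<lambda>x. (cmod (v T' x))\<^sup>2) (current (v T') (G T'))"
    using uniq traj T unfolding trajectory_unique_def by blast
  then have dv: "AE x in lebesgue. \<rho> T' x = (cmod (v T' x))\<^sup>2" and cv: "AE x in lebesgue. J T' x = current (v T') (G T') x"
    by (auto simp: same_state_def)
  have vr: "AE x in lebesgue. (cmod (v T' x))\<^sup>2 = r' x"
    using dv r'(2) by eventually_elim simp
  have Jeq: "AE x in lebesgue. \<forall>i. Im (cnj (\<psi> T' x) * g' x $ i) = Im (cnj (v T' x) * G T' x $ i)"
    using cv cur[OF T(2) H'] by eventually_elim (simp add: current_def vec_eq_iff)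
  obtain \<eta> where Hv: "H1_limit \<eta> (v T') (G T')" using G by blast
  have "\<forall>\<Omega>'\<in>components {x. r' x \<noteq> 0}. \<exists>c. AE x in lebesgue. x \<in> \<Omega>' \<longrightarrow> v T' x = c * \<psi> T' x"
  proof
    fix \<Omega>' assume "\<Omega>' \<in> components {x. r' x \<noteq> 0}"
    then obtain c where "AE x in lebesgue. x \<in> \<Omega>' \<longrightarrow> v T' x = c * \<psi> T' x"
      by (rule phase_constant_on_component[OF H' Hv r'(1) wr vr Jeq])
    then show "\<exists>c. AE x in lebesgue. x \<in> \<Omega>' \<longrightarrow> v T' x = c * \<psi> T' x" by blast
  qed
  from bchoice[OF this] obtain c where
    c: "\<And>\<Omega>'. \<Omega>' \<in> components {x. r' x \<noteq> 0} \<Longrightarrow> AE x in lebesgue. x \<in> \<Omega>' \<longrightarrow> v T' x = c \<Omega>' * \<psi> T' x" by blast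
  \<comment> \<open>The restriction is half the difference of the state and its altered copy, so
    linearity of the group reduces its evolution to that of two solutions.\<close>
  have f_eq: "(\<lambda>x. indicator \<Omega> x * \<psi> T x) = (\<lambda>x. (1/2) * u x + (- 1/2) * u' x)"
    by (auto simp: u_def u'_def s_def indicator_def fun_eq_iff)
  have \<psi>T': "AE x in lebesgue. \<psi> T' x = U (T' - T) u x"
  proof -
    have uU: "U T (\<psi> 0) \<in> L2" by (rule unitary_groupD(1)[OF U]) (use \<psi>(1) in \<open>simp add: finite_energy_def\<close>)
    have "AE x in lebesgue. U (T' - T) u x = U (T' - T) (U T (\<psi> 0)) x"
      unfolding u_def by (rule unitary_group_cong_AE[OF U \<psi>(2) uU \<psi>(3)])
    moreover have "AE x in lebesgue. U ((T' - T) + T) (\<psi> 0) x = U (T' - T) (U T (\<psi> 0)) x"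
      by (rule unitary_groupD(5)[OF U]) (use \<psi>(1) in \<open>simp add: finite_energy_def\<close>)
    ultimately show ?thesis using \<psi>(3)[of T'] by eventually_elim simp
  qed
  have Uf: "AE x in lebesgue. U (T' - T) (\<lambda>x. indicator \<Omega> x * \<psi> T x) x = (1/2) * \<psi> T' x + (- 1/2) * v T' x"
    using unitary_groupD(3)[OF U uL u'L, of "T' - T" "1/2" "- 1/2"] \<psi>T'
    unfolding f_eq v_def by eventually_elim simp
  show ?thesis
  \<comment> \<open>The evolved restriction is (\<open>\<psi> T'\<close> - \<open>v T'\<close>)/2,
    and \<open>v T'\<close> is \<open>c \<Omega>'\<close> times \<open>\<psi> T'\<close> on the
    component.\<close>
  proof (intro exI[of _ "\<lambda>\<Omega>'. 1/2 - c \<Omega>'/2"] conjI ballI)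
    fix \<Omega>' assume "\<Omega>' \<in> components {x. r' x \<noteq> 0}"
    from c[OF this] Uf show "AE x in lebesgue. x \<in> \<Omega>' \<longrightarrow>
        U (T' - T) (\<lambda>x. indicator \<Omega> x * \<psi> T x) x = (1/2 - c \<Omega>'/2) * \<psi> T' x"
    proof eventually_elim
      case (elim x)
      show ?case
      proof
        assume "x \<in> \<Omega>'"
        then show "U (T' - T) (\<lambda>x. indicator \<Omega> x * \<psi> T x) x = (1/2 - c \<Omega>'/2) * \<psi> T' x"
          using elim(1) unfolding elim(2) by (simp add: algebra_simps)
      qed
    qed
  next
    \<comment> \<open>Where the common density vanishes, both solutions vanish.\<close>
    show "AE x in lebesgue. r' x = 0 \<longrightarrow> U (T' - T) (\<lambda>x. indicator \<Omega> x * \<psi> T x) x = 0"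
      using wr vr Uf by eventually_elim auto
  qed
qed

text \<open>With more restrictions than components at \<open>T'\<close>, some nontrivial combination
  has coefficient 0 on every component at \<open>T'\<close> and evolves to 0. The evolution is
  isometric, so the combination is 0 already at \<open>T\<close>, although restrictions to disjoint
  nonempty components are independent. Taking an arbitrary finite family \<open>C\<close> allows
  infinitely many components at \<open>T\<close>.\<close>

lemma unique_imp_card_components_le:
  assumes U: "unitary_group U" and gen: "group_generator U = graph_closure (hamiltonian V)"
    and \<psi>: "finite_energy V (\<psi> 0)" "\<And>t. \<psi> t \<in> L2" "\<And>t. AE x in lebesgue. \<psi> t x = U t (\<psi> 0) x"
    and hyd: "\<And>t. t \<in> I \<Longrightarrow> hydrodynamic_state (\<psi> t) (\<rho> t) (J t)"
    and uniq: "trajectory_unique V I \<rho> J" and T: "T \<in> I" "T' \<in> I"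
    and r: "continuous_on UNIV r" "AE x in lebesgue. \<rho> T x = r x"
    and r': "continuous_on UNIV r'" "AE x in lebesgue. \<rho> T' x = r' x"
    and fin': "finite (components {x. r' x \<noteq> 0})"
    and C: "C \<subseteq> components {x. r x \<noteq> 0}" "finite C"
  shows "card C \<le> card (components {x. r' x \<noteq> 0})"
proof (rule ccontr)
  assume "\<not> card C \<le> card (components {x. r' x \<noteq> 0})"
  then have card: "card (components {x. r' x \<noteq> 0}) < card C" by simp
  define F where "F \<Omega> x = indicator \<Omega> x * \<psi> T x" for \<Omega> x
  define S where "S = T' - T"
  have "\<forall>\<Omega>\<in>C. \<exists>d. (\<forall>\<Omega>'\<in>components {x. r' x \<noteq> 0}. AE x in lebesgue. x \<in> \<Omega>' \<longrightarrow> U S (F \<Omega>) x = d \<Omega>' * \<psi> T' x) \<and>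
      (AE x in lebesgue. r' x = 0 \<longrightarrow> U S (F \<Omega>) x = 0)"
    unfolding F_def S_def
    using evolved_restriction[where \<psi>=\<psi>, OF U gen \<psi> hyd uniq T r r'] C(1) by blast
  from bchoice[OF this] obtain d where
    d: "\<And>\<Omega> \<Omega>'. \<Omega> \<in> C \<Longrightarrow> \<Omega>' \<in> components {x. r' x \<noteq> 0} \<Longrightarrow> AE x in lebesgue. x \<in> \<Omega>' \<longrightarrow> U S (F \<Omega>) x = d \<Omega> \<Omega>' * \<psi> T' x"
    and d0: "\<And>\<Omega>. \<Omega> \<in> C \<Longrightarrow> AE x in lebesgue. r' x = 0 \<longrightarrow> U S (F \<Omega>) x = 0" by blast
  obtain a where a: "\<exists>\<Omega>\<in>C. a \<Omega> \<noteq> 0" "\<And>\<Omega>'. \<Omega>' \<in> components {x. r' x \<noteq> 0} \<Longrightarrow> (\<Sum>\<Omega>\<in>C. a \<Omega> * d \<Omega> \<Omega>') = 0"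
    using exists_linear_dependency[OF fin' C(2) card, of d] by blast
  have op: "open \<Omega>" if "\<Omega> \<in> C" for \<Omega>
  proof -
    have "open {x. r x \<noteq> 0}" by (intro open_Collect_neq r continuous_on_const)
    then show ?thesis using open_components C(1) that by blast
  qed
  have FL: "F \<Omega> \<in> L2" if "\<Omega> \<in> C" for \<Omega>
    unfolding F_def
  proof (rule L2_mult_bounded[OF \<psi>(2)])
    show "(indicator \<Omega> :: _ \<Rightarrow> complex) \<in> borel_measurable lebesgue"
      using op[OF that] by (intro borel_measurable_indicator) simp
    show "cmod (indicator \<Omega> x) \<le> 1" for x by (simp add: indicator_def)
  qed
  define E where "E x = (\<Sum>\<Omega>\<in>C. a \<Omega> * F \<Omega> x)" for x
  have EL: "E \<in> L2" unfolding E_def by (intro L2_sum L2_cmult FL)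
  have UE: "AE x in lebesgue. U S E x = (\<Sum>\<Omega>\<in>C. a \<Omega> * U S (F \<Omega>) x)"
    unfolding E_def[abs_def] by (rule unitary_group_sum[OF U FL])
  have "AE x in lebesgue. \<forall>\<Omega>'\<in>components {x. r' x \<noteq> 0}. \<forall>\<Omega>\<in>C. x \<in> \<Omega>' \<longrightarrow> U S (F \<Omega>) x = d \<Omega> \<Omega>' * \<psi> T' x"
    by (intro AE_finite_allI fin' C(2) d)
  moreover have "AE x in lebesgue. \<forall>\<Omega>\<in>C. r' x = 0 \<longrightarrow> U S (F \<Omega>) x = 0"
    by (intro AE_finite_allI C(2) d0)
  ultimately have "AE x in lebesgue. U S E x = 0"
    using UE
  proof eventually_elim
    case (elim x)
    show ?case
    proof (cases "r' x = 0")
      case True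
      then show ?thesis using elim by simp
    next
      case False
      then obtain \<Omega>' where \<Omega>': "\<Omega>' \<in> components {x. r' x \<noteq> 0}" "x \<in> \<Omega>'"
        using Union_components[of "{x. r' x \<noteq> 0}"] by blast
      have "U S E x = (\<Sum>\<Omega>\<in>C. (a \<Omega> * d \<Omega> \<Omega>') * \<psi> T' x)"
        unfolding elim(3) using elim(1) \<Omega>' by (intro sum.cong) auto
      also have "\<dots> = (\<Sum>\<Omega>\<in>C. a \<Omega> * d \<Omega> \<Omega>') * \<psi> T' x" by (simp add: sum_distrib_right)
      finally show ?thesis using a(2)[OF \<Omega>'(1)] by simp
    qed
  qed
  then have "L2_norm (U S E) = 0" using L2_norm_eq_0_iff[OF unitary_groupD(1)[OF U EL]] by simp
  then have E0: "AE x in lebesgue. E x = 0"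
    using unitary_groupD(2)[OF U EL] L2_norm_eq_0_iff[OF EL] by simp
  obtain \<Omega> where \<Omega>: "\<Omega> \<in> C" "a \<Omega> \<noteq> 0" using a(1) by blast
  have ur: "AE x in lebesgue. (cmod (\<psi> T x))\<^sup>2 = r x"
    using hyd[OF T(1)] r(2) unfolding hydrodynamic_state_def by (auto elim: eventually_elim2)
  have "AE x in lebesgue. x \<notin> \<Omega>"
    using E0 ur
  proof eventually_elim
    case (elim x)
    show ?case
    proof
      assume x: "x \<in> \<Omega>"
      \<comment> \<open>Components are disjoint, so on \<open>\<Omega>\<close> a single summand of
        the combination survives.\<close>
      have "x \<notin> \<Omega>''" if "\<Omega>'' \<in> C" "\<Omega>'' \<noteq> \<Omega>" for \<Omega>''
        using components_nonoverlap[of \<Omega> "{x. r x \<noteq> 0}" \<Omega>''] C(1) \<Omega>(1) that x by blast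
      then have "E x = (\<Sum>\<Omega>''\<in>C. if \<Omega>'' = \<Omega> then a \<Omega> * \<psi> T x else 0)"
        unfolding E_def F_def using x by (intro sum.cong) auto
      also have "\<dots> = a \<Omega> * \<psi> T x" using C(2) \<Omega>(1) by simp
      finally have "\<psi> T x = 0" using elim(1) \<Omega>(2) by simp
      moreover have "r x \<noteq> 0" using x in_components_subset[of \<Omega> "{x. r x \<noteq> 0}"] C(1) \<Omega>(1) by blast
      ultimately show False using elim(2) by simp
    qed
  qed
  moreover have "\<Omega> \<noteq> {}" using in_components_nonempty C(1) \<Omega>(1) by blast
  ultimately show False using AE_open_nonempty[OF op[OF \<Omega>(1)]] by blast
qed

text \<open>If there are finitely many components at \<open>T'\<close>, a family with one more
  member at \<open>T\<close> is excluded, which also rules out infinitely many there. Otherwise the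
  right-hand side is infinite.\<close>

lemma unique_imp_num_components_le:
  assumes U: "unitary_group U" and gen: "group_generator U = graph_closure (hamiltonian V)"
    and \<psi>: "finite_energy V (\<psi> 0)" "\<And>t. \<psi> t \<in> L2" "\<And>t. AE x in lebesgue. \<psi> t x = U t (\<psi> 0) x"
    and hyd: "\<And>t. t \<in> I \<Longrightarrow> hydrodynamic_state (\<psi> t) (\<rho> t) (J t)"
    and uniq: "trajectory_unique V I \<rho> J" and T: "T \<in> I" "T' \<in> I"
    and r: "continuous_on UNIV r" "AE x in lebesgue. \<rho> T x = r x"
    and r': "continuous_on UNIV r'" "AE x in lebesgue. \<rho> T' x = r' x"
  shows "num_components {x. r x \<noteq> 0} \<le> num_components {x. r' x \<noteq> 0}"
proof (cases "finite (components {x. r' x \<noteq> 0})")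
  case fin': True
  note le = unique_imp_card_components_le[where \<psi>=\<psi>, OF U gen \<psi> hyd uniq T r r' fin']
  have "finite (components {x. r x \<noteq> 0})"
  proof (rule ccontr)
    assume "infinite (components {x. r x \<noteq> 0})"
    then obtain C where "finite C" "card C = Suc (card (components {x. r' x \<noteq> 0}))" "C \<subseteq> components {x. r x \<noteq> 0}"
      using infinite_arbitrarily_large by blast
    then show False using le[of C] by simp
  qed
  then show ?thesis using le[of "components {x. r x \<noteq> 0}"] fin' by (simp add: num_components_def)
qed (simp add: num_components_def)

end

lemma C11_loc_continuous: "C11_loc V \<Longrightarrow> continuous_on UNIV V"
  unfolding C11_loc_def gderiv_def
  by (metis continuous_at_imp_continuous_on has_derivative_continuous)

theorem proposition5:
  fixes V :: "real^'d::finite \<Rightarrow> real"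
    and \<psi> :: "real \<Rightarrow> real^'d \<Rightarrow> complex"
    and \<rho> :: "real \<Rightarrow> real^'d \<Rightarrow> real"
    and J :: "real \<Rightarrow> real^'d \<Rightarrow> real^'d"
    and r\<^sub>1 r\<^sub>2 :: "real^'d \<Rightarrow> real"
    and T\<^sub>1 T\<^sub>2 :: real
  assumes "C11_loc V" and "bdd_below (range V)"
    and "essentially_self_adjoint (hamiltonian V)"
    and "T\<^sub>1 < T\<^sub>2"
    and "bounded_energy_solution V \<psi>"
    and "\<And>t. t \<in> {T\<^sub>1..T\<^sub>2} \<Longrightarrow> hydrodynamic_state (\<psi> t) (\<rho> t) (J t)"
    (* r_1 and r_2 are the continuous representatives of the densities at the end times *)
    and "continuous_on UNIV r\<^sub>1" and "AE x in lebesgue. \<rho> T\<^sub>1 x = r\<^sub>1 x"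
    and "continuous_on UNIV r\<^sub>2" and "AE x in lebesgue. \<rho> T\<^sub>2 x = r\<^sub>2 x"
    and "\<And>C. C \<in> components {x. r\<^sub>1 x \<noteq> 0} \<Longrightarrow> caccioppoli C"
    and "\<And>C. C \<in> components {x. r\<^sub>2 x \<noteq> 0} \<Longrightarrow> caccioppoli C"
    and "num_components {x. r\<^sub>1 x \<noteq> 0} \<noteq> num_components {x. r\<^sub>2 x \<noteq> 0}"
  shows "\<not> trajectory_unique V {T\<^sub>1..T\<^sub>2} \<rho> J"
proof
  assume uniq: "trajectory_unique V {T\<^sub>1..T\<^sub>2} \<rho> J"
  obtain m where m: "\<And>x. m \<le> V x" using assms(2) by (auto simp: bdd_below_def)
  \<comment> \<open>With \<open>m\<close> a lower bound of the potential, this shift makes the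
    shifted potential at least 1.\<close>
  interpret energy_form V "1 - m"
    by unfold_locales (use m C11_loc_continuous[OF assms(1)] assms(3) in auto)
  obtain U where U: "unitary_group U" "group_generator U = graph_closure (hamiltonian V)"
    and \<psi>: "finite_energy V (\<psi> 0)" "\<And>t. \<psi> t \<in> L2" "\<And>t. AE x in lebesgue. \<psi> t x = U t (\<psi> 0) x"
    using assms(5) unfolding bounded_energy_solution_def by blast
  have T: "T\<^sub>1 \<in> {T\<^sub>1..T\<^sub>2}" "T\<^sub>2 \<in> {T\<^sub>1..T\<^sub>2}" using assms(4) by auto
  \<comment> \<open>The comparison holds for any two times of the interval in either order, since
    the evolution is a group; exchanging the end times gives the reverse inequality.\<close>
  have "num_components {x. r\<^sub>1 x \<noteq> 0} \<le> num_components {x. r\<^sub>2 x \<noteq> 0}"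
    "num_components {x. r\<^sub>2 x \<noteq> 0} \<le> num_components {x. r\<^sub>1 x \<noteq> 0}"
    using unique_imp_num_components_le[where \<psi>=\<psi>, OF U \<psi> assms(6) uniq T assms(7-10)]
      unique_imp_num_components_le[where \<psi>=\<psi>, OF U \<psi> assms(6) uniq T(2,1) assms(9,10,7,8)] by auto
  then show False using assms(13) by simp
qed

end
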